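(* Let $\mathcal C$ be an injective (unital) C*-algebra, and let $\mathcal A\subseteq\mathcal B$ be an inclusion of C*-algebras. Then the following hold: (1) For all completely positive maps $\varphi_1,\varphi_2,\varphi:\mathcal A\to\mathcal C$ with $\varphi_1\le\varphi$ and $\varphi_2\le\varphi$, there are completely positive maps $\tilde\varphi_1,\tilde\varphi_2,\tilde\varphi:\mathcal B\to\mathcal C$ extending $\varphi_1,\varphi_2,\varphi$, respectively, with $\tilde\varphi_1\le\tilde\varphi$ and $\tilde\varphi_2\le\tilde\varphi$. (2) For all completely positive maps $\varphi_1,\varphi_2,\varphi_3,\varphi_4:\mathcal A\to\mathcal C$ with $\varphi_1+\varphi_2=\varphi_3+\varphi_4$, there are completely positive maps $\tilde\varphi_1,\tilde\varphi_2,\tilde\varphi_3,\tilde\varphi_4:\mathcal B\to\mathcal C$ extending $\varphi_1,\varphi_2,\varphi_3,\varphi_4$, respectively, with $\tilde\varphi_1+\tilde\varphi_2=\tilde\varphi_3+\tilde\varphi_4$.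
   Context: All C*-algebras are unital, and an inclusion $\mathcal A\subseteq\mathcal B$ of C*-algebras means that $\mathcal A$ is a C*-subalgebra of $\mathcal B$ containing the unit of $\mathcal B$. For completely bounded self-adjoint maps $\varphi_1,\varphi_2$ with the same domain and codomain, $\varphi_1\le\varphi_2$ means that $\varphi_2-\varphi_1$ is completely positive. *)

theory Defs
  imports Complex_Main "HOL-Algebra.Subrings"
begin

text \<open>
  C*-algebras are carrier-based structures, so that they can be quantified over inside a
  definition (as injectivity requires). All laws are relativised to the carrier, and maps between
  C*-algebras matter only on the carrier. The zero algebra is not excluded.
\<close>

record 'a cstar = "(complex, 'a) module" +
  star :: "'a \<Rightarrow> 'a"
  nrm :: "'a \<Rightarrow> real"

locale cstar_algebra = ring F for F :: "'a cstar" (structure) +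
  assumes smult_closed: "x \<in> carrier F \<Longrightarrow> c \<odot> x \<in> carrier F"
    and smult_add_left: "x \<in> carrier F \<Longrightarrow> (c + d) \<odot> x = c \<odot> x \<oplus> d \<odot> x"
    and smult_add_right:
      "\<lbrakk>x \<in> carrier F; y \<in> carrier F\<rbrakk> \<Longrightarrow> c \<odot> (x \<oplus> y) = c \<odot> x \<oplus> c \<odot> y"
    and smult_smult: "x \<in> carrier F \<Longrightarrow> (c * d) \<odot> x = c \<odot> (d \<odot> x)"
    and smult_1: "x \<in> carrier F \<Longrightarrow> 1 \<odot> x = x"
    and smult_mult_left:
      "\<lbrakk>x \<in> carrier F; y \<in> carrier F\<rbrakk> \<Longrightarrow> (c \<odot> x) \<otimes> y = c \<odot> (x \<otimes> y)"
    and smult_mult_right: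
      "\<lbrakk>x \<in> carrier F; y \<in> carrier F\<rbrakk> \<Longrightarrow> x \<otimes> (c \<odot> y) = c \<odot> (x \<otimes> y)"
    and star_closed: "x \<in> carrier F \<Longrightarrow> star F x \<in> carrier F"
    and star_star: "x \<in> carrier F \<Longrightarrow> star F (star F x) = x"
    and star_add:
      "\<lbrakk>x \<in> carrier F; y \<in> carrier F\<rbrakk> \<Longrightarrow> star F (x \<oplus> y) = star F x \<oplus> star F y"
    and star_smult: "x \<in> carrier F \<Longrightarrow> star F (c \<odot> x) = cnj c \<odot> star F x"
    and star_mult:
      "\<lbrakk>x \<in> carrier F; y \<in> carrier F\<rbrakk> \<Longrightarrow> star F (x \<otimes> y) = star F y \<otimes> star F x"
    and nrm_nonneg: "x \<in> carrier F \<Longrightarrow> 0 \<le> nrm F x"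
    and nrm_eq_0: "x \<in> carrier F \<Longrightarrow> nrm F x = 0 \<longleftrightarrow> x = \<zero>"
    and nrm_smult: "x \<in> carrier F \<Longrightarrow> nrm F (c \<odot> x) = cmod c * nrm F x"
    and nrm_add:
      "\<lbrakk>x \<in> carrier F; y \<in> carrier F\<rbrakk> \<Longrightarrow> nrm F (x \<oplus> y) \<le> nrm F x + nrm F y"
    and nrm_mult:
      "\<lbrakk>x \<in> carrier F; y \<in> carrier F\<rbrakk> \<Longrightarrow> nrm F (x \<otimes> y) \<le> nrm F x * nrm F y"
    and cstar_identity: "x \<in> carrier F \<Longrightarrow> nrm F (star F x \<otimes> x) = (nrm F x)\<^sup>2"
    and complete:
      "\<lbrakk>\<And>n. X n \<in> carrier F; \<forall>e>0. \<exists>N. \<forall>m\<ge>N. \<forall>n\<ge>N. nrm F (X m \<ominus> X n) < e\<rbrakk>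
        \<Longrightarrow> \<exists>l\<in>carrier F. (\<lambda>n. nrm F (X n \<ominus> l)) \<longlonglongrightarrow> 0"

text \<open>A unital C*-subalgebra is given by its carrier; as a C*-algebra it is \<open>B\<lparr>carrier := A\<rparr>\<close>.\<close>

definition cstar_subalgebra :: "'b set \<Rightarrow> 'b cstar \<Rightarrow> bool" where
  "cstar_subalgebra A B \<longleftrightarrow>
     subring A B
     \<and> (\<forall>c. \<forall>x\<in>A. c \<odot>\<^bsub>B\<^esub> x \<in> A)
     \<and> (\<forall>x\<in>A. star B x \<in> A)
     \<and> (\<forall>X l. (\<forall>n. X n \<in> A) \<and> l \<in> carrier B
          \<and> (\<lambda>n. nrm B (X n \<ominus>\<^bsub>B\<^esub> l)) \<longlonglongrightarrow> 0 \<longrightarrow> l \<in> A)"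

text \<open>Operator systems, as in Paulsen's book, need not be norm-closed.\<close>

definition operator_system :: "'b set \<Rightarrow> 'b cstar \<Rightarrow> bool" where
  "operator_system E D \<longleftrightarrow>
     E \<subseteq> carrier D \<and> \<one>\<^bsub>D\<^esub> \<in> E
     \<and> (\<forall>x\<in>E. \<forall>y\<in>E. x \<oplus>\<^bsub>D\<^esub> y \<in> E)
     \<and> (\<forall>c. \<forall>x\<in>E. c \<odot>\<^bsub>D\<^esub> x \<in> E)
     \<and> (\<forall>x\<in>E. star D x \<in> E)"

text \<open>
  An \<open>n \<times> n\<close> matrix over \<open>D\<close> is a function \<open>X\<close> of which only the entries \<open>X i j\<close> with
  \<open>i, j < n\<close> matter. It is positive in the C*-algebra \<open>M\<^sub>n(D)\<close> if it is of the form \<open>Y\<^sup>*Y\<close>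
  with \<open>Y\<close> in \<open>M\<^sub>n(D)\<close>.
\<close>

definition mat_pos :: "'a cstar \<Rightarrow> nat \<Rightarrow> (nat \<Rightarrow> nat \<Rightarrow> 'a) \<Rightarrow> bool" where
  "mat_pos D n X \<longleftrightarrow>
     (\<exists>Y. (\<forall>i<n. \<forall>j<n. Y i j \<in> carrier D)
        \<and> (\<forall>i<n. \<forall>j<n. X i j = (\<Oplus>\<^bsub>D\<^esub>k\<in>{..<n}. star D (Y k i) \<otimes>\<^bsub>D\<^esub> Y k j)))"

text \<open>
  Completely positive maps from an operator system \<open>E\<close> in \<open>D\<close> to a C*-algebra \<open>C\<close>; positivity of
  matrices over \<open>E\<close> is positivity in the matrix algebras over the ambient \<open>D\<close>.
\<close>

definition cp_on :: "'a set \<Rightarrow> 'a cstar \<Rightarrow> 'c cstar \<Rightarrow> ('a \<Rightarrow> 'c) \<Rightarrow> bool" where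
  "cp_on E D C \<phi> \<longleftrightarrow>
     (\<forall>x\<in>E. \<phi> x \<in> carrier C)
     \<and> (\<forall>x\<in>E. \<forall>y\<in>E. \<phi> (x \<oplus>\<^bsub>D\<^esub> y) = \<phi> x \<oplus>\<^bsub>C\<^esub> \<phi> y)
     \<and> (\<forall>c. \<forall>x\<in>E. \<phi> (c \<odot>\<^bsub>D\<^esub> x) = c \<odot>\<^bsub>C\<^esub> \<phi> x)
     \<and> (\<forall>n X. (\<forall>i<n. \<forall>j<n. X i j \<in> E) \<and> mat_pos D n X
          \<longrightarrow> mat_pos C n (\<lambda>i j. \<phi> (X i j)))"

definition completely_positive :: "'a cstar \<Rightarrow> 'c cstar \<Rightarrow> ('a \<Rightarrow> 'c) \<Rightarrow> bool" where
  "completely_positive A C \<phi> \<longleftrightarrow> cp_on (carrier A) A C \<phi>"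

definition cp_le :: "'a cstar \<Rightarrow> 'c cstar \<Rightarrow> ('a \<Rightarrow> 'c) \<Rightarrow> ('a \<Rightarrow> 'c) \<Rightarrow> bool" where
  "cp_le A C \<phi> \<psi> \<longleftrightarrow> completely_positive A C (\<lambda>x. \<psi> x \<ominus>\<^bsub>C\<^esub> \<phi> x)"

text \<open>
  \<open>C\<close> is injective if every completely positive map into \<open>C\<close> extends along every inclusion
  \<open>E \<subseteq> F\<close> of operator systems. HOL cannot quantify over types, so the C*-algebras \<open>D\<close> containing
  these operator systems range over the fixed type \<open>('i \<Rightarrow> complex) \<Rightarrow> ('i \<Rightarrow> complex)\<close>. This type
  contains the algebra of bounded operators on \<open>\<ell>\<^sup>2(I)\<close> for every \<open>I :: 'i set\<close>. If \<open>C\<close> is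
  injective in the unrestricted sense, then this condition holds for all \<open>'i\<close>. Conversely, suppose
  that the carrier of \<open>C\<close> embeds into \<open>'i\<close>. Then \<open>C\<close> is faithfully represented on some \<open>\<ell>\<^sup>2(I)\<close>,
  the condition gives a completely positive retraction of the bounded operators on \<open>\<ell>\<^sup>2(I)\<close>
  onto \<open>C\<close>, and by Arveson's extension theorem \<open>C\<close> is injective in the unrestricted sense. So for
  such \<open>'i\<close> the condition does not depend on \<open>'i\<close>.
\<close>

definition injective_cstar :: "'i itself \<Rightarrow> 'c cstar \<Rightarrow> bool" where
  "injective_cstar _ C \<longleftrightarrow>
     cstar_algebra C
     \<and> (\<forall>(D :: (('i \<Rightarrow> complex) \<Rightarrow> ('i \<Rightarrow> complex)) cstar) E F \<phi>.
          cstar_algebra D \<and> operator_system E D \<and> operator_system F D \<and> E \<subseteq> F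
          \<and> cp_on E D C \<phi>
          \<longrightarrow> (\<exists>\<psi>. cp_on F D C \<psi> \<and> (\<forall>x\<in>E. \<psi> x = \<phi> x)))"

end

theory Submission
  imports Defs "HOL-Library.Nat_Bijection"
begin

text \<open>
  Write \<open>\<phi> = \<phi>1 + \<phi>2 = \<phi>3 + \<phi>4\<close>. Quadruples with this property are maps \<open>\<Phi>\<close> on formal sums
  \<open>a + b u + c v\<close>, where \<open>u\<close> and \<open>v\<close> are the free involutions generating the infinite dihedral
  group: \<open>\<Phi> (a + b u + c v) = \<phi> a + (\<phi>1 - \<phi>2) b + (\<phi>3 - \<phi>4) c\<close>, and \<open>\<phi>1 a\<close> is the value at
  \<open>a (1 + u) / 2\<close>. Realise \<open>u\<close> and \<open>v\<close> on long finite paths, as the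
  involutions that swap the ends of every edge of even, respectively odd, position, so that \<open>a + b u + c v\<close> becomes a sequence of tridiagonal matrices.

  The crucial point is that \<open>\<Phi>\<close> is completely positive on the operator system of these elements
  with coefficients in \<open>A\<close>. If all the tridiagonal matrices are positive, block Cholesky
  decomposition writes them as sums of positive matrices supported on single edges, and averaging
  along the path (the dihedral group is amenable) yields, for each \<open>\<delta> > 0\<close>, a splitting
  \<open>a + \<delta> = s + t\<close> over \<open>A\<close> with \<open>-s \<le> b \<le> s\<close> and \<open>-t \<le> c \<le> t\<close>. Then
  \<open>\<Phi> (a + b u + c v) + \<delta> \<phi> 1 = \<phi>1 (s + b) + \<phi>2 (s - b) + \<phi>3 (t + c) + \<phi>4 (t - c)\<close> is positive.
  Injectivity extends \<open>\<Phi>\<close> to coefficients in \<open>B\<close>, and its values at \<open>b (1 \<plusminus> u) / 2\<close> and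
  \<open>b (1 \<plusminus> v) / 2\<close> are the required extensions. The first part follows from the second by
  \<open>\<phi>1 + (\<phi> - \<phi>1) = \<phi>2 + (\<phi> - \<phi>2)\<close>.
\<close>

context cstar_algebra begin

lemmas cstar_closed [simp] = smult_closed star_closed

declare star_star [simp] smult_1 [simp]

lemma smult_zero_left [simp]: "x \<in> carrier F \<Longrightarrow> 0 \<odot> x = \<zero>"
  using smult_add_left[of x 0 0] by (simp add: add.l_cancel_one')

lemma smult_zero_right [simp]: "c \<odot> \<zero> = \<zero>"
  using smult_add_right[of \<zero> \<zero> c] by (simp add: add.l_cancel_one')

lemma smult_minus_one: "x \<in> carrier F \<Longrightarrow> (- 1) \<odot> x = \<ominus> x"
  using smult_add_left[of x "- 1" 1] by (simp add: minus_equality)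

lemma smult_minus_right: "x \<in> carrier F \<Longrightarrow> c \<odot> (\<ominus> x) = \<ominus> (c \<odot> x)"
  using smult_smult[of x c "-1"] smult_smult[of x "-1" c]
  by (simp add: smult_minus_one)

lemma smult_minus_left: "x \<in> carrier F \<Longrightarrow> (- c) \<odot> x = \<ominus> (c \<odot> x)"
  using smult_smult[of x "-1" c] by (simp add: smult_minus_one)

lemma smult_diff_right:
  "\<lbrakk>x \<in> carrier F; y \<in> carrier F\<rbrakk> \<Longrightarrow> c \<odot> (x \<ominus> y) = c \<odot> x \<ominus> c \<odot> y"
  by (simp add: minus_eq smult_add_right smult_minus_right)

lemma star_zero [simp]: "star F \<zero> = \<zero>"
  using star_smult[of \<zero> 0] by simp

lemma star_one [simp]: "star F \<one> = \<one>"
  using star_mult[of "star F \<one>" \<one>] by simp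

lemma star_minus: "x \<in> carrier F \<Longrightarrow> star F (\<ominus> x) = \<ominus> star F x"
  using star_smult[of x "-1"] by (simp add: smult_minus_one)

lemma star_diff: "\<lbrakk>x \<in> carrier F; y \<in> carrier F\<rbrakk> \<Longrightarrow> star F (x \<ominus> y) = star F x \<ominus> star F y"
  by (simp add: minus_eq star_add star_minus)

lemma nrm_zero [simp]: "nrm F \<zero> = 0"
  using nrm_eq_0 by blast

lemma nrm_minus [simp]: "x \<in> carrier F \<Longrightarrow> nrm F (\<ominus> x) = nrm F x"
  using nrm_smult[of x "-1"] by (simp add: smult_minus_one)

lemma diff_swap: "\<lbrakk>x \<in> carrier F; y \<in> carrier F\<rbrakk> \<Longrightarrow> \<ominus> (x \<ominus> y) = y \<ominus> x"
  by algebra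

lemma nrm_diff_commute: "\<lbrakk>x \<in> carrier F; y \<in> carrier F\<rbrakk> \<Longrightarrow> nrm F (x \<ominus> y) = nrm F (y \<ominus> x)"
  using nrm_minus[of "x \<ominus> y"] by (simp add: diff_swap)

lemma nrm_triangle:
  "\<lbrakk>x \<in> carrier F; y \<in> carrier F; z \<in> carrier F\<rbrakk>
    \<Longrightarrow> nrm F (x \<ominus> z) \<le> nrm F (x \<ominus> y) + nrm F (y \<ominus> z)"
  using nrm_add[of "x \<ominus> y" "y \<ominus> z"]
  by (subgoal_tac "x \<ominus> z = (x \<ominus> y) \<oplus> (y \<ominus> z)") (simp, algebra)

lemma nrm_le_diff: "\<lbrakk>x \<in> carrier F; y \<in> carrier F\<rbrakk> \<Longrightarrow> nrm F x \<le> nrm F (x \<ominus> y) + nrm F y"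
  using nrm_triangle[of x y \<zero>] by (simp add: minus_eq)

lemma diff_eq_zero: "\<lbrakk>x \<in> carrier F; y \<in> carrier F\<rbrakk> \<Longrightarrow> x \<ominus> y = \<zero> \<longleftrightarrow> x = y"
  using r_right_minus_eq by blast

lemma nrm_star [simp]: assumes "x \<in> carrier F" shows "nrm F (star F x) = nrm F x"
proof -
  have le: "nrm F y \<le> nrm F (star F y)" if "y \<in> carrier F" for y
    using cstar_identity[OF that] nrm_mult[of "star F y" y] nrm_nonneg[OF that] nrm_nonneg[of "star F y"] that
    by (cases "nrm F y = 0") (auto simp: power2_eq_square)
  show ?thesis
    using le[OF assms] le[of "star F x"] assms by simp
qed

lemma nrm_one_le: "nrm F \<one> \<le> 1"
proof -
  have "(nrm F \<one>)\<^sup>2 = nrm F \<one>"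
    using cstar_identity[of \<one>] by simp
  then show ?thesis by (auto simp: power2_eq_square)
qed

lemma smult_cancel_iff: "\<lbrakk>c \<noteq> 0; x \<in> carrier F; y \<in> carrier F\<rbrakk> \<Longrightarrow> c \<odot> x = c \<odot> y \<longleftrightarrow> x = y"
  by (metis left_inverse smult_1 smult_smult)

lemma smult_eq_zero: "\<lbrakk>c \<noteq> 0; x \<in> carrier F\<rbrakk> \<Longrightarrow> c \<odot> x = \<zero> \<longleftrightarrow> x = \<zero>"
  using smult_cancel_iff[of c x \<zero>] by simp

lemma smult_two: "x \<in> carrier F \<Longrightarrow> 2 \<odot> x = x \<oplus> x"
  using smult_add_left[of x 1 1] by simp

lemma smult_halves: "x \<in> carrier F \<Longrightarrow> (1/2) \<odot> (x \<oplus> x) = x"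
  using smult_smult[of x "1/2" 2] by (simp add: smult_two)

lemma smult_one_commute: "x \<in> carrier F \<Longrightarrow> c \<odot> \<one> \<otimes> x = x \<otimes> (c \<odot> \<one>)"
  by (simp add: smult_mult_left smult_mult_right)

subsection \<open>Limits\<close>

definition converges :: "(nat \<Rightarrow> 'a) \<Rightarrow> 'a \<Rightarrow> bool" where
  "converges X l \<longleftrightarrow> (\<forall>n. X n \<in> carrier F) \<and> l \<in> carrier F \<and> (\<lambda>n. nrm F (X n \<ominus> l)) \<longlonglongrightarrow> 0"

lemma convergesD: "converges X l \<Longrightarrow> X n \<in> carrier F" "converges X l \<Longrightarrow> l \<in> carrier F"
  "converges X l \<Longrightarrow> (\<lambda>n. nrm F (X n \<ominus> l)) \<longlonglongrightarrow> 0"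
  by (auto simp: converges_def)

lemma convergesI:
  assumes "\<And>n. X n \<in> carrier F" "l \<in> carrier F" "\<And>n. nrm F (X n \<ominus> l) \<le> f n" "f \<longlonglongrightarrow> 0"
  shows "converges X l"
  unfolding converges_def using assms
  by (auto intro!: tendsto_sandwich[of "\<lambda>_. 0" "\<lambda>n. nrm F (X n \<ominus> l)" sequentially f] simp: nrm_nonneg)

lemma converges_const: "x \<in> carrier F \<Longrightarrow> converges (\<lambda>_. x) x"
  by (simp add: converges_def minus_eq r_neg)

lemma converges_unique:
  assumes "converges X l" "converges X m" shows "l = m"
proof -
  note [simp] = convergesD(1,2)[OF assms(1)] convergesD(1,2)[OF assms(2)]
  have "nrm F (l \<ominus> m) \<le> nrm F (X n \<ominus> l) + nrm F (X n \<ominus> m)" for n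
    using nrm_triangle[of l "X n" m] nrm_diff_commute[of l "X n"] by simp
  moreover have "(\<lambda>n. nrm F (X n \<ominus> l) + nrm F (X n \<ominus> m)) \<longlonglongrightarrow> 0"
    using tendsto_add[OF convergesD(3)[OF assms(1)] convergesD(3)[OF assms(2)]] by simp
  ultimately have "nrm F (l \<ominus> m) \<le> 0"
    by (meson LIMSEQ_le_const)
  then have "l \<ominus> m = \<zero>"
    using nrm_nonneg[of "l \<ominus> m"] nrm_eq_0[of "l \<ominus> m"] by simp
  then show ?thesis by (simp add: diff_eq_zero)
qed

lemma converges_add:
  assumes "converges X l" "converges Y m" shows "converges (\<lambda>n. X n \<oplus> Y n) (l \<oplus> m)"
proof -
  note [simp] = convergesD(1,2)[OF assms(1)] convergesD(1,2)[OF assms(2)]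
  show ?thesis
  proof (rule convergesI)
    fix n
    have "X n \<oplus> Y n \<ominus> (l \<oplus> m) = (X n \<ominus> l) \<oplus> (Y n \<ominus> m)"
      by (simp add: minus_eq minus_add a_ac)
    then show "nrm F (X n \<oplus> Y n \<ominus> (l \<oplus> m)) \<le> nrm F (X n \<ominus> l) + nrm F (Y n \<ominus> m)"
      by (simp add: nrm_add)
    show "(\<lambda>n. nrm F (X n \<ominus> l) + nrm F (Y n \<ominus> m)) \<longlonglongrightarrow> 0"
      using tendsto_add[OF convergesD(3)[OF assms(1)] convergesD(3)[OF assms(2)]] by simp
  qed simp_all
qed

lemma converges_smult:
  assumes "converges X l" shows "converges (\<lambda>n. c \<odot> X n) (c \<odot> l)"
proof -
  note [simp] = convergesD(1,2)[OF assms(1)]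
  show ?thesis
    using tendsto_mult_left[OF convergesD(3)[OF assms], of "cmod c"]
    by (simp add: converges_def flip: smult_diff_right nrm_smult)
qed

lemma converges_star:
  assumes "converges X l" shows "converges (\<lambda>n. star F (X n)) (star F l)"
proof -
  note [simp] = convergesD(1,2)[OF assms(1)]
  show ?thesis
    using convergesD(3)[OF assms] by (simp add: converges_def flip: star_diff)
qed

lemma converges_mult:
  assumes "converges X l" "converges Y m" shows "converges (\<lambda>n. X n \<otimes> Y n) (l \<otimes> m)"
proof -
  note [simp] = convergesD(1,2)[OF assms(1)] convergesD(1,2)[OF assms(2)]
  note [simp] = nrm_nonneg
  show ?thesis
  proof (rule convergesI)
    fix n
    have "X n \<otimes> Y n \<ominus> l \<otimes> m = (X n \<ominus> l) \<otimes> Y n \<oplus> l \<otimes> (Y n \<ominus> m)"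
      using convergesD(1,2)[OF assms(1)] convergesD(1,2)[OF assms(2)] by algebra
    also have "nrm F \<dots> \<le> nrm F ((X n \<ominus> l) \<otimes> Y n) + nrm F (l \<otimes> (Y n \<ominus> m))"
      by (simp add: nrm_add)
    also have "\<dots> \<le> nrm F (X n \<ominus> l) * nrm F (Y n) + nrm F l * nrm F (Y n \<ominus> m)"
      by (intro add_mono nrm_mult) simp_all
    also have "\<dots> \<le> nrm F (X n \<ominus> l) * (nrm F (Y n \<ominus> m) + nrm F m) + nrm F l * nrm F (Y n \<ominus> m)"
      by (intro add_mono mult_left_mono nrm_le_diff) simp_all
    finally show "nrm F (X n \<otimes> Y n \<ominus> l \<otimes> m)
      \<le> nrm F (X n \<ominus> l) * (nrm F (Y n \<ominus> m) + nrm F m) + nrm F l * nrm F (Y n \<ominus> m)" .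
    show "(\<lambda>n. nrm F (X n \<ominus> l) * (nrm F (Y n \<ominus> m) + nrm F m) + nrm F l * nrm F (Y n \<ominus> m)) \<longlonglongrightarrow> 0"
      using tendsto_add[OF tendsto_mult[OF convergesD(3)[OF assms(1)]
          tendsto_add[OF convergesD(3)[OF assms(2)] tendsto_const[of "nrm F m"]]]
          tendsto_mult[OF tendsto_const[of "nrm F l"] convergesD(3)[OF assms(2)]]] by simp
  qed simp_all
qed

lemma converges_nrm_le:
  assumes "converges X l" "\<And>n. nrm F (X n) \<le> c" shows "nrm F l \<le> c"
proof -
  note [simp] = convergesD(1,2)[OF assms(1)]
  have "nrm F l \<le> nrm F (X n \<ominus> l) + c" for n
    using nrm_le_diff[of l "X n"] nrm_diff_commute[of l "X n"] assms(2)[of n] by simp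
  moreover have "(\<lambda>n. nrm F (X n \<ominus> l) + c) \<longlonglongrightarrow> 0 + c"
    by (intro tendsto_intros convergesD(3)[OF assms(1)])
  ultimately show ?thesis
    using LIMSEQ_le_const[of "\<lambda>n. nrm F (X n \<ominus> l) + c" c "nrm F l"] by simp
qed

lemma converges_Suc: "converges X l \<Longrightarrow> converges (\<lambda>n. X (Suc n)) l"
  by (auto simp: converges_def intro: LIMSEQ_Suc)

lemma converges_if_dominated:
  assumes X: "\<And>n. X n \<in> carrier F" and d: "\<And>n. nrm F (X (Suc n) \<ominus> X n) \<le> t (Suc n) - t n"
    and t: "convergent t"
  shows "\<exists>l. converges X l"
proof -
  note [simp] = X
  have mono: "nrm F (X (m + k) \<ominus> X m) \<le> t (m + k) - t m" for m k
  proof (induction k)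
    case (Suc k)
    then show ?case
      using nrm_triangle[of "X (Suc (m + k))" "X (m + k)" "X m"] d[of "m + k"] by simp
  qed (simp add: minus_eq r_neg)
  have le: "nrm F (X n \<ominus> X m) \<le> \<bar>t n - t m\<bar>" for m n
  proof (cases "m \<le> n")
    case True
    then show ?thesis using mono[of m "n - m"] by simp
  next
    case False
    then show ?thesis using mono[of n "m - n"] nrm_diff_commute[of "X n" "X m"] by simp
  qed
  have "\<forall>e>0. \<exists>N. \<forall>m\<ge>N. \<forall>n\<ge>N. nrm F (X m \<ominus> X n) < e"
  proof (intro allI impI)
    fix e :: real assume "e > 0"
    have "Cauchy t" using t by (simp add: Cauchy_convergent_iff)
    then obtain N where "\<forall>m\<ge>N. \<forall>n\<ge>N. norm (t m - t n) < e"
      using \<open>e > 0\<close> CauchyD by blast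
    then show "\<exists>N. \<forall>m\<ge>N. \<forall>n\<ge>N. nrm F (X m \<ominus> X n) < e"
      using le by (metis order_le_less_trans real_norm_def)
  qed
  then show ?thesis
    using complete[of X] by (auto simp: converges_def)
qed

subsection \<open>Square roots\<close>

text \<open>The scalar iteration \<open>t \<mapsto> (1 + t\<^sup>2) / 2\<close> increases to its fixed point 1 and
  majorises the iteration \<open>y \<mapsto> (z + y\<^sup>2) / 2\<close>, whose limit satisfies \<open>(1 - y)\<^sup>2 = 1 - z\<close>.\<close>

lemma sqrt_iteration:
  assumes z [simp]: "z \<in> carrier F" and nz: "nrm F z \<le> 1"
  shows "\<exists>y\<in>carrier F. y \<oplus> y = z \<oplus> y \<otimes> y \<and> nrm F y \<le> 1 \<and> (star F z = z \<longrightarrow> star F y = y)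
    \<and> (\<forall>w\<in>carrier F. w \<otimes> z = z \<otimes> w \<longrightarrow> w \<otimes> y = y \<otimes> w)"
proof -
  define Y where "Y = rec_nat \<zero> (\<lambda>_ y. (1/2) \<odot> (z \<oplus> y \<otimes> y))"
  define t where "t = rec_nat (0::real) (\<lambda>_ t. (1 + t\<^sup>2) / 2)"
  have Y0: "Y 0 = \<zero>" and YS: "Y (Suc n) = (1/2) \<odot> (z \<oplus> Y n \<otimes> Y n)" for n
    by (simp_all add: Y_def)
  have t0: "t 0 = 0" and tS: "t (Suc n) = (1 + (t n)\<^sup>2) / 2" for n
    by (simp_all add: t_def)
  have Yc [simp]: "Y n \<in> carrier F" for n
    by (induction n) (simp_all add: Y0 YS)
  note [simp] = nrm_nonneg
  have t01: "0 \<le> t n \<and> t n \<le> 1" for n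
    by (induction n) (auto simp: t0 tS abs_square_le_1)
  have t_mono: "t n \<le> t (Suc n)" for n
    using zero_le_power2[of "t n - 1"] unfolding tS by (simp add: power2_diff)
  have Yt: "nrm F (Y n) \<le> t n" for n
  proof (induction n)
    case (Suc n)
    have "nrm F (z \<oplus> Y n \<otimes> Y n) \<le> 1 + nrm F (Y n) * nrm F (Y n)"
      using nrm_add[of z "Y n \<otimes> Y n"] nrm_mult[of "Y n" "Y n"] nz by simp
    also have "\<dots> \<le> 1 + t n * t n"
      using Suc t01[of n] by (simp add: mult_mono)
    finally show ?case
      by (simp add: YS tS nrm_smult power2_eq_square)
  qed (simp add: Y0 t0)
  have d: "nrm F (Y (Suc n) \<ominus> Y n) \<le> t (Suc n) - t n" for n
  proof (induction n)
    case 0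
    show ?case by (simp add: Y0 YS t0 tS nrm_smult nz minus_eq)
  next
    case (Suc n)
    let ?a = "Y (Suc n)" and ?b = "Y n"
    have "Y (Suc (Suc n)) \<ominus> Y (Suc n) = (1/2) \<odot> (z \<oplus> ?a \<otimes> ?a) \<ominus> (1/2) \<odot> (z \<oplus> ?b \<otimes> ?b)"
      by (simp add: YS[symmetric])
    also have "\<dots> = (1/2) \<odot> ((z \<oplus> ?a \<otimes> ?a) \<ominus> (z \<oplus> ?b \<otimes> ?b))"
      by (subst smult_diff_right) simp_all
    also have "(z \<oplus> ?a \<otimes> ?a) \<ominus> (z \<oplus> ?b \<otimes> ?b) = ?a \<otimes> (?a \<ominus> ?b) \<oplus> (?a \<ominus> ?b) \<otimes> ?b"
      using Yc[of "Suc n"] Yc[of n] z by algebra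
    finally have "nrm F (Y (Suc (Suc n)) \<ominus> Y (Suc n))
        = nrm F (?a \<otimes> (?a \<ominus> ?b) \<oplus> (?a \<ominus> ?b) \<otimes> ?b) / 2"
      by (simp add: nrm_smult)
    also have "\<dots> \<le> (nrm F ?a * nrm F (?a \<ominus> ?b) + nrm F (?a \<ominus> ?b) * nrm F ?b) / 2"
      using nrm_add[of "?a \<otimes> (?a \<ominus> ?b)" "(?a \<ominus> ?b) \<otimes> ?b"] nrm_mult[of ?a "?a \<ominus> ?b"]
        nrm_mult[of "?a \<ominus> ?b" ?b] by simp
    also have "\<dots> = (nrm F ?a + nrm F ?b) * nrm F (?a \<ominus> ?b) / 2"
      by (simp add: algebra_simps)
    also have "\<dots> \<le> (t (Suc n) + t n) * (t (Suc n) - t n) / 2"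
      using Suc Yt[of n] Yt[of "Suc n"] t01[of n] t01[of "Suc n"]
      by (intro divide_right_mono mult_mono add_mono) auto
    also have "\<dots> = t (Suc (Suc n)) - t (Suc n)"
      unfolding tS[of "Suc n"] tS[of n] by (simp add: field_simps power2_eq_square)
    finally show ?case .
  qed
  have "convergent t"
    using Bseq_mono_convergent[of t] t01 t_mono
    by (metis (no_types, lifting) abs_of_nonneg BseqI' real_norm_def mono_iff_le_Suc monoD)
  then obtain y where y: "converges Y y"
    using converges_if_dominated[of Y t] d by auto
  have yc [simp]: "y \<in> carrier F" by (rule convergesD(2)[OF y])
  have "converges (\<lambda>n. (1/2) \<odot> (z \<oplus> Y n \<otimes> Y n)) ((1/2) \<odot> (z \<oplus> y \<otimes> y))"
    by (intro converges_smult converges_add converges_mult converges_const y z)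
  then have eq: "y = (1/2) \<odot> (z \<oplus> y \<otimes> y)"
    using converges_unique[OF converges_Suc[OF y]] unfolding YS by blast
  have "y \<oplus> y = z \<oplus> y \<otimes> y"
  proof -
    have "2 \<odot> y = 2 \<odot> ((1/2) \<odot> (z \<oplus> y \<otimes> y))" by (rule arg_cong[OF eq])
    also have "\<dots> = z \<oplus> y \<otimes> y" using smult_smult[of "z \<oplus> y \<otimes> y" 2 "1/2"] by simp
    finally show ?thesis by (simp add: smult_two)
  qed
  moreover have "nrm F y \<le> 1"
    using converges_nrm_le[OF y] Yt t01 by (meson order_trans)
  moreover have "star F y = y" if "star F z = z"
  proof -
    have "star F (Y n) = Y n" for n
      by (induction n) (simp_all add: Y0 YS star_smult star_add star_mult that)
    then have "converges Y (star F y)"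
      using converges_star[OF y] by simp
    then show ?thesis
      by (rule converges_unique[OF _ y])
  qed
  moreover have "w \<otimes> y = y \<otimes> w" if w [simp]: "w \<in> carrier F" and wz: "w \<otimes> z = z \<otimes> w" for w
  proof -
    have "w \<otimes> Y n = Y n \<otimes> w" for n
    proof (induction n)
      case (Suc n)
      have "w \<otimes> (Y n \<otimes> Y n) = (Y n \<otimes> Y n) \<otimes> w"
        by (metis Suc Yc m_assoc w)
      then show ?case
        by (simp add: YS smult_mult_left smult_mult_right r_distr l_distr wz)
    qed (simp add: Y0)
    then have "converges (\<lambda>n. Y n \<otimes> w) (w \<otimes> y)"
      using converges_mult[OF converges_const[OF w] y] by simp
    then show ?thesis
      by (rule converges_unique) (rule converges_mult[OF y converges_const[OF w]])
  qed
  ultimately show ?thesis using yc by blast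
qed

end

subsection \<open>The positive cone\<close>

text \<open>With this norm characterisation of positivity it is evident that the positive elements form
  a convex cone, and that positivity in a subalgebra is positivity in the whole algebra.\<close>

definition cstar_pos :: "'a cstar \<Rightarrow> 'a set" where
  "cstar_pos F = {x \<in> carrier F. star F x = x
     \<and> (\<exists>t::real. nrm F (complex_of_real t \<odot>\<^bsub>F\<^esub> \<one>\<^bsub>F\<^esub> \<ominus>\<^bsub>F\<^esub> x) \<le> t)}"

context cstar_algebra begin

declare r_one [algebra ring "zero F" "add F" "a_inv F" "a_minus F" "one F" "mult F"]

abbreviation pos :: "'a set" where "pos \<equiv> cstar_pos F"

abbreviation scal :: "real \<Rightarrow> 'a" where "scal t \<equiv> complex_of_real t \<odot> \<one>"

lemma pos_closed [simp]: "x \<in> pos \<Longrightarrow> x \<in> carrier F"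
  and pos_star [simp]: "x \<in> pos \<Longrightarrow> star F x = x"
  by (auto simp: cstar_pos_def)

lemma posE:
  assumes "x \<in> pos" obtains t where "nrm F (scal t \<ominus> x) \<le> t"
  using assms unfolding cstar_pos_def by blast

lemma posI:
  "\<lbrakk>x \<in> carrier F; star F x = x; nrm F (scal t \<ominus> x) \<le> t\<rbrakk> \<Longrightarrow> x \<in> pos"
  unfolding cstar_pos_def by blast

lemma scal_add: "scal (s + t) = scal s \<oplus> scal t"
  by (simp add: smult_add_left)

lemma star_scal [simp]: "star F (scal t) = scal t"
  by (simp add: star_smult)

lemma nrm_scal_le: "nrm F (scal t) \<le> \<bar>t\<bar>"
  using mult_left_mono[OF nrm_one_le, of "\<bar>t\<bar>"] by (simp add: nrm_smult)

lemma nrm_scal_diff_mono: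
  assumes "x \<in> carrier F" "nrm F (scal t \<ominus> x) \<le> t" "t \<le> s"
  shows "nrm F (scal s \<ominus> x) \<le> s"
proof -
  have "scal s \<ominus> x = scal (s - t) \<oplus> (scal t \<ominus> x)"
    using scal_add[of "s - t" t] assms(1) by (simp add: minus_eq a_assoc)
  then show ?thesis
    using nrm_add[of "scal (s - t)" "scal t \<ominus> x"] nrm_scal_le[of "s - t"] assms by simp
qed

lemma scal_pos: "0 \<le> t \<Longrightarrow> scal t \<in> pos"
  by (rule posI[of _ t]) (simp_all add: minus_eq r_neg)

lemma zero_pos [simp]: "\<zero> \<in> pos"
  using scal_pos[of 0] by simp

lemma one_pos [simp]: "\<one> \<in> pos"
  using scal_pos[of 1] by simp

lemma pos_add [intro]: assumes "x \<in> pos" "y \<in> pos" shows "x \<oplus> y \<in> pos"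
proof -
  obtain s t where st: "nrm F (scal s \<ominus> x) \<le> s" "nrm F (scal t \<ominus> y) \<le> t"
    using assms by (meson posE)
  have "scal (s + t) \<ominus> (x \<oplus> y) = (scal s \<ominus> x) \<oplus> (scal t \<ominus> y)"
    unfolding scal_add using pos_closed[OF assms(1)] pos_closed[OF assms(2)]
      smult_closed[OF one_closed, of "complex_of_real s"] smult_closed[OF one_closed, of "complex_of_real t"]
    by algebra
  then have "nrm F (scal (s + t) \<ominus> (x \<oplus> y)) \<le> s + t"
    using nrm_add[of "scal s \<ominus> x" "scal t \<ominus> y"] st assms by simp
  then show ?thesis
    using assms by (intro posI[of _ "s + t"]) (simp_all add: star_add)
qed

lemma pos_smult: assumes "x \<in> pos" "0 \<le> r" shows "complex_of_real r \<odot> x \<in> pos"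
proof -
  obtain t where t: "nrm F (scal t \<ominus> x) \<le> t"
    using assms(1) by (rule posE)
  have "scal (r * t) \<ominus> complex_of_real r \<odot> x = complex_of_real r \<odot> (scal t \<ominus> x)"
    using assms by (simp add: smult_diff_right smult_smult)
  then have "nrm F (scal (r * t) \<ominus> complex_of_real r \<odot> x) \<le> r * t"
    using t assms by (simp add: nrm_smult mult_left_mono)
  then show ?thesis
    using assms by (intro posI[of _ "r * t"]) (simp_all add: star_smult)
qed

lemma pos_halves: assumes "x \<in> carrier F" "x \<oplus> x \<in> pos" shows "x \<in> pos"
  using pos_smult[OF assms(2), of "1/2"] assms by (simp add: smult_halves)

lemma pos_sqrt:
  assumes x: "x \<in> pos"
  shows "\<exists>b\<in>pos. b \<otimes> b = x \<and> (\<forall>w\<in>carrier F. w \<otimes> x = x \<otimes> w \<longrightarrow> w \<otimes> b = b \<otimes> w)"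
proof -
  note [simp] = pos_closed[OF x] pos_star[OF x]
  obtain t0 where t0: "nrm F (scal t0 \<ominus> x) \<le> t0"
    using x by (rule posE)
  define t where "t = t0 + 1"
  have t: "nrm F (scal t \<ominus> x) \<le> t"
    using nrm_scal_diff_mono[OF pos_closed[OF x] t0, of t] by (simp add: t_def)
  have tp: "0 < t"
    using order_trans[OF nrm_nonneg t0] by (simp add: t_def)
  have sq: "complex_of_real (sqrt t) * complex_of_real (sqrt t) = complex_of_real t"
    using tp by (simp flip: of_real_mult)
  define z where "z = complex_of_real (1/t) \<odot> (scal t \<ominus> x)"
  have zc [simp]: "z \<in> carrier F" by (simp add: z_def)
  have "nrm F z \<le> 1" "star F z = z"
    using t tp by (simp_all add: z_def nrm_smult norm_divide star_smult star_diff)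
  then obtain y where y [simp]: "y \<in> carrier F" and yy: "y \<oplus> y = z \<oplus> y \<otimes> y"
    and ny: "nrm F y \<le> 1" and sy [simp]: "star F y = y"
    and comm: "\<And>w. w \<in> carrier F \<Longrightarrow> w \<otimes> z = z \<otimes> w \<Longrightarrow> w \<otimes> y = y \<otimes> w"
    using sqrt_iteration[OF zc] by blast
  define b where "b = complex_of_real (sqrt t) \<odot> (\<one> \<ominus> y)"
  have tz: "complex_of_real t \<odot> z = scal t \<ominus> x"
    unfolding z_def using tp by (simp flip: smult_smult of_real_mult)
  have "(\<one> \<ominus> y) \<otimes> (\<one> \<ominus> y) = \<one> \<ominus> (y \<oplus> y) \<oplus> y \<otimes> y"
    using y by algebra
  also have "\<dots> = \<one> \<ominus> z"
    unfolding yy using y zc by algebra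
  finally have "b \<otimes> b = complex_of_real t \<odot> (\<one> \<ominus> z)"
    by (simp add: b_def smult_mult_left smult_mult_right sq flip: smult_smult)
  also have "\<dots> = scal t \<ominus> (scal t \<ominus> x)"
    by (simp add: smult_diff_right tz)
  also have "\<dots> = x"
    using pos_closed[OF x] smult_closed[OF one_closed, of "complex_of_real t"] by algebra
  finally have bb: "b \<otimes> b = x" .
  have bc: "b \<in> carrier F" by (simp add: b_def)
  have "scal (sqrt t) \<ominus> b = complex_of_real (sqrt t) \<odot> (\<one> \<ominus> (\<one> \<ominus> y))"
    by (simp add: b_def smult_diff_right)
  also have "\<one> \<ominus> (\<one> \<ominus> y) = y" using y by algebra
  finally have "nrm F (scal (sqrt t) \<ominus> b) \<le> sqrt t"
    using ny tp by (simp add: nrm_smult)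
  then have "b \<in> pos"
    using bc by (intro posI[of b "sqrt t"]) (simp_all add: b_def star_smult star_diff)
  moreover have "w \<otimes> b = b \<otimes> w" if w [simp]: "w \<in> carrier F" and wx: "w \<otimes> x = x \<otimes> w" for w
  proof -
    have "w \<otimes> z = z \<otimes> w"
      by (simp add: z_def smult_mult_left smult_mult_right minus_eq l_distr r_distr l_minus r_minus wx)
    then have "w \<otimes> y = y \<otimes> w" by (simp add: comm)
    then show ?thesis
      by (simp add: b_def smult_mult_left smult_mult_right minus_eq l_distr r_distr l_minus r_minus)
  qed
  ultimately show ?thesis using bb by blast
qed

lemma sa_square_bound:
  assumes b [simp]: "b \<in> carrier F" and sb [simp]: "star F b = b" and nb: "nrm F b \<le> 1"
  shows "nrm F (\<one> \<ominus> b \<otimes> b) \<le> 1"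
proof -
  have "nrm F (b \<otimes> b) \<le> 1"
    using cstar_identity[OF b] nb nrm_nonneg[OF b] by (simp add: power_le_one)
  then obtain y where y [simp]: "y \<in> carrier F" and yy: "y \<oplus> y = b \<otimes> b \<oplus> y \<otimes> y"
    and sy: "star F y = y" and comm: "b \<otimes> y = y \<otimes> b"
    using sqrt_iteration[of "b \<otimes> b"] m_assoc[OF b b b] star_mult[OF b b] m_closed[OF b b] b
    unfolding sb by metis
  define s where "s = \<i> \<odot> (\<one> \<ominus> y)"
  have s [simp]: "s \<in> carrier F" by (simp add: s_def)
  have ss [simp]: "star F s = \<ominus> s"
    by (simp add: s_def star_smult star_diff sy smult_minus_left)
  have bs: "b \<otimes> s = s \<otimes> b"
    by (simp add: s_def smult_mult_left smult_mult_right minus_eq l_distr r_distr l_minus r_minus comm)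
  have "s \<otimes> s = \<ominus> ((\<one> \<ominus> y) \<otimes> (\<one> \<ominus> y))"
    using smult_minus_one by (simp add: s_def smult_mult_left smult_mult_right flip: smult_smult)
  also have "(\<one> \<ominus> y) \<otimes> (\<one> \<ominus> y) = \<one> \<ominus> (y \<oplus> y) \<oplus> y \<otimes> y"
    using y by algebra
  also have "\<dots> = \<one> \<ominus> b \<otimes> b"
    unfolding yy using y b by algebra
  finally have s2: "s \<otimes> s = b \<otimes> b \<ominus> \<one>"
    using b by algebra
  define u where "u = b \<oplus> s"
  have u [simp]: "u \<in> carrier F" by (simp add: u_def)
  have su: "star F u = b \<ominus> s" by (simp add: u_def star_add minus_eq)
  have "star F u \<otimes> u = b \<otimes> b \<ominus> s \<otimes> s \<oplus> (b \<otimes> s \<ominus> s \<otimes> b)"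
    unfolding su unfolding u_def using b s by algebra
  also have "\<dots> = \<one>"
    unfolding s2 bs using b s by algebra
  finally have "(nrm F u)\<^sup>2 \<le> 1"
    using cstar_identity[OF u] nrm_one_le by simp
  then have nu: "nrm F u \<le> 1" by (simp add: nrm_nonneg abs_square_le_1)
  have "u \<otimes> u \<oplus> star F u \<otimes> star F u = (b \<otimes> b \<oplus> s \<otimes> s) \<oplus> (b \<otimes> b \<oplus> s \<otimes> s)"
    unfolding su unfolding u_def using b s by algebra
  also have "\<dots> = \<ominus> ((\<one> \<ominus> (b \<otimes> b \<oplus> b \<otimes> b)) \<oplus> (\<one> \<ominus> (b \<otimes> b \<oplus> b \<otimes> b)))"
    unfolding s2 using b by algebra
  finally have eq: "u \<otimes> u \<oplus> star F u \<otimes> star F u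
    = \<ominus> ((\<one> \<ominus> (b \<otimes> b \<oplus> b \<otimes> b)) \<oplus> (\<one> \<ominus> (b \<otimes> b \<oplus> b \<otimes> b)))" .
  have "2 * nrm F (\<one> \<ominus> (b \<otimes> b \<oplus> b \<otimes> b)) = nrm F (u \<otimes> u \<oplus> star F u \<otimes> star F u)"
    unfolding eq by (simp add: nrm_smult flip: smult_two)
  also have "\<dots> \<le> nrm F u * nrm F u + nrm F u * nrm F u"
    using nrm_add[of "u \<otimes> u" "star F u \<otimes> star F u"] nrm_mult[of u u]
      nrm_mult[of "star F u" "star F u"] by simp
  also have "\<dots> \<le> 2"
    using mult_mono[OF nu nu] nrm_nonneg[OF u] by simp
  finally have half: "nrm F (\<one> \<ominus> (b \<otimes> b \<oplus> b \<otimes> b)) \<le> 1" by simp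
  have "(\<one> \<ominus> b \<otimes> b) \<oplus> (\<one> \<ominus> b \<otimes> b) = \<one> \<oplus> (\<one> \<ominus> (b \<otimes> b \<oplus> b \<otimes> b))"
    using b by algebra
  then have "2 * nrm F (\<one> \<ominus> b \<otimes> b) = nrm F (\<one> \<oplus> (\<one> \<ominus> (b \<otimes> b \<oplus> b \<otimes> b)))"
    using nrm_smult[of "\<one> \<ominus> b \<otimes> b" 2] by (simp add: smult_two)
  also have "\<dots> \<le> 2"
    using nrm_add[of \<one> "\<one> \<ominus> (b \<otimes> b \<oplus> b \<otimes> b)"] half nrm_one_le by simp
  finally show ?thesis by simp
qed

lemma sa_square_scal_bound:
  assumes b [simp]: "b \<in> carrier F" and sb [simp]: "star F b = b"
  shows "nrm F (scal ((nrm F b)\<^sup>2) \<ominus> b \<otimes> b) \<le> (nrm F b)\<^sup>2"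
proof (cases "nrm F b = 0")
  case True
  then have "b = \<zero>" using nrm_eq_0 by simp
  then show ?thesis by (simp add: minus_eq)
next
  case False
  define r where "r = nrm F b"
  have r: "r > 0" using False nrm_nonneg[OF b] by (simp add: r_def)
  define c where "c = complex_of_real (1/r) \<odot> b"
  have bc: "b = complex_of_real r \<odot> c"
    using r by (simp add: c_def flip: smult_smult)
  have c [simp]: "c \<in> carrier F" "star F c = c" by (simp_all add: c_def star_smult)
  have "nrm F c \<le> 1" using r by (simp add: c_def nrm_smult norm_divide r_def)
  then have "nrm F (\<one> \<ominus> c \<otimes> c) \<le> 1" by (simp add: sa_square_bound)
  moreover have "scal (r\<^sup>2) \<ominus> b \<otimes> b = complex_of_real (r\<^sup>2) \<odot> (\<one> \<ominus> c \<otimes> c)"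
    by (simp add: bc smult_diff_right smult_mult_left smult_mult_right power2_eq_square smult_smult)
  ultimately show ?thesis
    by (simp add: nrm_smult norm_power flip: r_def)
       (use r mult_left_mono[of "nrm F (\<one> \<ominus> c \<otimes> c)" 1 "r\<^sup>2"] in simp)
qed

lemma sa_square_pos: "\<lbrakk>b \<in> carrier F; star F b = b\<rbrakk> \<Longrightarrow> b \<otimes> b \<in> pos"
  by (intro posI[OF _ _ sa_square_scal_bound]) (simp_all add: star_mult)

lemma pos_mult:
  assumes "x \<in> pos" "y \<in> pos" "x \<otimes> y = y \<otimes> x"
  shows "x \<otimes> y \<in> pos"
proof -
  obtain b where b: "b \<in> pos" "b \<otimes> b = x" and bw: "\<And>w. w \<in> carrier F \<Longrightarrow> w \<otimes> x = x \<otimes> w \<Longrightarrow> w \<otimes> b = b \<otimes> w"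
    using pos_sqrt[OF assms(1)] by blast
  obtain c where c: "c \<in> pos" "c \<otimes> c = y" and cw: "\<And>w. w \<in> carrier F \<Longrightarrow> w \<otimes> y = y \<otimes> w \<Longrightarrow> w \<otimes> c = c \<otimes> w"
    using pos_sqrt[OF assms(2)] by blast
  note [simp] = pos_closed[OF b(1)] pos_closed[OF c(1)]
  have "y \<otimes> b = b \<otimes> y" using bw assms by simp
  then have bc: "b \<otimes> c = c \<otimes> b" using cw by simp
  have "(b \<otimes> c) \<otimes> (b \<otimes> c) = b \<otimes> (c \<otimes> b) \<otimes> c" by (simp add: m_assoc)
  also have "\<dots> = x \<otimes> y" by (simp add: m_assoc flip: bc b(2) c(2))
  finally show ?thesis
    using sa_square_pos[of "b \<otimes> c"] bc b c by (simp add: star_mult)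
qed

lemma pos_nrm: assumes "x \<in> pos" shows "nrm F (scal (nrm F x) \<ominus> x) \<le> nrm F x"
proof -
  obtain b where b: "b \<in> pos" "b \<otimes> b = x" using pos_sqrt[OF assms] by blast
  have "nrm F x = (nrm F b)\<^sup>2" using cstar_identity[of b] b by simp
  then show ?thesis using sa_square_scal_bound[of b] b by simp
qed

lemma pos_limit:
  assumes X: "converges X l" and p: "\<And>n. X n \<in> pos" shows "l \<in> pos"
proof -
  note [simp] = convergesD(1,2)[OF X]
  have "Bseq (\<lambda>n. nrm F (X n \<ominus> l))"
    using convergesD(3)[OF X] by (rule convergent_imp_Bseq[OF convergentI])
  then obtain K where K: "\<And>n. nrm F (X n \<ominus> l) \<le> K"
    using nrm_nonneg by (auto simp: Bseq_def)
  define T where "T = K + nrm F l"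
  have "nrm F (X n) \<le> T" for n
    using nrm_le_diff[of "X n" l] K[of n] by (simp add: T_def)
  then have b: "nrm F (scal T \<ominus> X n) \<le> T" for n
    using nrm_scal_diff_mono[OF _ pos_nrm[OF p]] by simp
  have "converges (\<lambda>n. scal T \<oplus> (-1) \<odot> X n) (scal T \<oplus> (-1) \<odot> l)"
    by (intro converges_add converges_const converges_smult X) simp
  then have "converges (\<lambda>n. scal T \<ominus> X n) (scal T \<ominus> l)"
    by (simp add: smult_minus_one minus_eq)
  then have "nrm F (scal T \<ominus> l) \<le> T"
    using b by (rule converges_nrm_le)
  moreover have "star F l = l"
    using converges_star[OF X] X p by (auto intro: converges_unique)
  ultimately show ?thesis by (intro posI) simp_all
qed

lemma nrm_le_posI:
  assumes x [simp]: "x \<in> carrier F" and M: "0 \<le> M" and p: "scal M \<ominus> x \<in> pos" "scal M \<oplus> x \<in> pos"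
  shows "nrm F x \<le> M"
proof -
  have "star F (scal M \<oplus> x) = scal M \<oplus> x" using p by simp
  then have sx [simp]: "star F x = x" by (simp add: star_add)
  let ?s = "scal M"
  have sc [simp]: "?s \<in> carrier F" by simp
  have comm: "?s \<otimes> x = x \<otimes> ?s" by (simp add: smult_one_commute)
  have "(?s \<ominus> x) \<otimes> (?s \<oplus> x) = ?s \<otimes> ?s \<ominus> x \<otimes> x \<oplus> (?s \<otimes> x \<ominus> x \<otimes> ?s)"
    using x sc by algebra
  also have "\<dots> = ?s \<otimes> ?s \<ominus> x \<otimes> x"
    unfolding comm using x sc by algebra
  finally have e1: "(?s \<ominus> x) \<otimes> (?s \<oplus> x) = ?s \<otimes> ?s \<ominus> x \<otimes> x" .
  have "(?s \<oplus> x) \<otimes> (?s \<ominus> x) = ?s \<otimes> ?s \<ominus> x \<otimes> x \<ominus> (?s \<otimes> x \<ominus> x \<otimes> ?s)"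
    using x sc by algebra
  also have "\<dots> = ?s \<otimes> ?s \<ominus> x \<otimes> x"
    unfolding comm using x sc by algebra
  finally have e2: "(?s \<oplus> x) \<otimes> (?s \<ominus> x) = ?s \<otimes> ?s \<ominus> x \<otimes> x" .
  have sp: "?s \<otimes> ?s \<ominus> x \<otimes> x \<in> pos"
    using pos_mult[OF p] unfolding e1 e2 by blast
  obtain d where d: "d \<in> pos" and dd: "d \<otimes> d = ?s \<otimes> ?s \<ominus> x \<otimes> x"
    and dw: "\<And>w. w \<in> carrier F \<Longrightarrow> w \<otimes> (?s \<otimes> ?s \<ominus> x \<otimes> x) = (?s \<otimes> ?s \<ominus> x \<otimes> x) \<otimes> w \<Longrightarrow> w \<otimes> d = d \<otimes> w"
    using pos_sqrt[OF sp] by blast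
  have dc [simp]: "d \<in> carrier F" using d by simp
  have "x \<otimes> (?s \<otimes> ?s \<ominus> x \<otimes> x) = (x \<otimes> ?s) \<otimes> ?s \<ominus> x \<otimes> x \<otimes> x"
    using x sc by algebra
  also have "\<dots> = (?s \<otimes> x) \<otimes> ?s \<ominus> x \<otimes> x \<otimes> x"
    by (simp only: comm)
  also have "\<dots> = ?s \<otimes> (x \<otimes> ?s) \<ominus> x \<otimes> x \<otimes> x"
    using x sc by algebra
  also have "\<dots> = ?s \<otimes> (?s \<otimes> x) \<ominus> x \<otimes> x \<otimes> x"
    by (simp only: comm)
  also have "\<dots> = (?s \<otimes> ?s \<ominus> x \<otimes> x) \<otimes> x"
    using x sc by algebra
  finally have xd: "x \<otimes> d = d \<otimes> x" by (simp add: dw)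
  define e where "e = \<i> \<odot> d"
  have e [simp]: "e \<in> carrier F" by (simp add: e_def)
  have se [simp]: "star F e = \<ominus> e" using d by (simp add: e_def star_smult smult_minus_left)
  have xe: "x \<otimes> e = e \<otimes> x" by (simp add: e_def smult_mult_left smult_mult_right xd)
  have ee: "e \<otimes> e = \<ominus> (?s \<otimes> ?s \<ominus> x \<otimes> x)"
    using smult_minus_one by (simp add: e_def smult_mult_left smult_mult_right dd flip: smult_smult)
  define w where "w = x \<oplus> e"
  have w [simp]: "w \<in> carrier F" by (simp add: w_def)
  have sw: "star F w = x \<ominus> e" by (simp add: w_def star_add minus_eq)
  have "star F w \<otimes> w = x \<otimes> x \<ominus> e \<otimes> e \<oplus> (x \<otimes> e \<ominus> e \<otimes> x)"
    unfolding sw unfolding w_def using x e by algebra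
  also have "\<dots> = ?s \<otimes> ?s"
    unfolding ee xe using x e sc by algebra
  finally have "(nrm F w)\<^sup>2 \<le> nrm F ?s * nrm F ?s"
    using cstar_identity[OF w] nrm_mult[OF sc sc] by simp
  also have "\<dots> \<le> M\<^sup>2"
    using nrm_scal_le[of M] M nrm_nonneg[OF sc] unfolding power2_eq_square by (intro mult_mono) auto
  finally have nw: "nrm F w \<le> M" using M by (rule power2_le_imp_le)
  have "x \<oplus> x = w \<oplus> star F w"
    unfolding sw unfolding w_def using x e by algebra
  then have "2 * nrm F x \<le> M + M"
    using nrm_smult[OF x, of 2] nrm_add[of w "star F w"] nw by (simp add: smult_two)
  then show ?thesis by simp
qed

lemma scal_nrm_diff_pos: "\<lbrakk>x \<in> carrier F; star F x = x\<rbrakk> \<Longrightarrow> scal (nrm F x) \<ominus> x \<in> pos"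
proof (rule posI[of _ "nrm F x"])
  assume x: "x \<in> carrier F" "star F x = x"
  have "scal (nrm F x) \<ominus> (scal (nrm F x) \<ominus> x) = x"
    using x(1) smult_closed[OF one_closed, of "complex_of_real (nrm F x)"] by algebra
  then show "nrm F (scal (nrm F x) \<ominus> (scal (nrm F x) \<ominus> x)) \<le> nrm F x" by simp
qed (simp_all add: star_diff)

lemma nrm_mono:
  assumes "x \<in> pos" "y \<in> carrier F" "y \<ominus> x \<in> pos" shows "nrm F x \<le> nrm F y"
proof (rule nrm_le_posI)
  note [simp] = pos_closed[OF assms(1)] assms(2)
  have "y = (y \<ominus> x) \<oplus> x" using assms(2) pos_closed[OF assms(1)] by algebra
  then have "y \<in> pos" using pos_add[OF assms(3,1)] by simp
  then have "(scal (nrm F y) \<ominus> y) \<oplus> (y \<ominus> x) \<in> pos"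
    using scal_nrm_diff_pos assms by auto
  moreover have "(scal (nrm F y) \<ominus> y) \<oplus> (y \<ominus> x) = scal (nrm F y) \<ominus> x"
    using assms(2) pos_closed[OF assms(1)] smult_closed[OF one_closed, of "complex_of_real (nrm F y)"]
    by algebra
  ultimately show "scal (nrm F y) \<ominus> x \<in> pos" by simp
  show "scal (nrm F y) \<oplus> x \<in> pos"
    using scal_pos assms(1) nrm_nonneg[OF assms(2)] by blast
qed (use assms nrm_nonneg in simp_all)

lemma pos_antisym: assumes "x \<in> pos" "\<ominus> x \<in> pos" shows "x = \<zero>"
proof -
  have "nrm F x \<le> 0"
    using nrm_le_posI[of x 0] assms by (simp add: minus_eq)
  then show ?thesis using nrm_nonneg[of x] nrm_eq_0[of x] assms by simp
qed

lemma sa_nilpotent: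
  assumes u [simp]: "u \<in> carrier F" "star F u = u" and "u \<otimes> u \<otimes> u = \<zero>" shows "u = \<zero>"
proof -
  have "nrm F (u \<otimes> u) ^ 2 = nrm F (u \<otimes> u \<otimes> u \<otimes> u)"
    using cstar_identity[of "u \<otimes> u"] by (simp add: star_mult m_assoc)
  then have "nrm F (u \<otimes> u) = 0" using assms by simp
  then show ?thesis using cstar_identity[of u] nrm_eq_0[of u] by simp
qed

text \<open>The witness is \<open>u = \<bar>x\<bar> - x\<close>, twice the negative part of \<open>x\<close>.\<close>

lemma sa_neg_part:
  assumes x: "x \<in> carrier F" "star F x = x"
  obtains u where "u \<in> carrier F" "star F u = u" "u \<otimes> u \<otimes> u \<in> pos"
    "u \<otimes> x \<otimes> u \<oplus> u \<otimes> x \<otimes> u = \<ominus> (u \<otimes> u \<otimes> u)" "u = \<zero> \<Longrightarrow> x \<in> pos"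
proof -
  obtain a where a: "a \<in> pos" and aa: "a \<otimes> a = x \<otimes> x" and xa: "x \<otimes> a = a \<otimes> x"
    using pos_sqrt[OF sa_square_pos[OF x]] m_assoc[OF x(1) x(1) x(1)] x(1) by metis
  have ac: "a \<in> carrier F" using a by simp
  define u where "u = a \<ominus> x"
  have u: "u \<in> carrier F" "star F u = u" using a x by (simp_all add: u_def star_diff)
  have "u \<otimes> x = a \<otimes> x \<ominus> x \<otimes> x" unfolding u_def using x(1) ac by algebra
  also have "\<dots> = \<ominus> (u \<otimes> a)"
    unfolding u_def xa[symmetric] aa[symmetric] using x(1) ac by algebra
  finally have ux: "u \<otimes> x = \<ominus> (u \<otimes> a)" .
  have "u \<otimes> a = a \<otimes> a \<ominus> x \<otimes> a" unfolding u_def using x(1) ac by algebra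
  also have "\<dots> = a \<otimes> u" unfolding u_def xa using x(1) ac by algebra
  finally have ua: "u \<otimes> a = a \<otimes> u" .
  have "u \<otimes> u = u \<otimes> (a \<ominus> x)"
    by (simp add: u_def)
  also have "\<dots> = u \<otimes> a \<ominus> u \<otimes> x"
    using x(1) ac u(1) by algebra
  finally have "u \<otimes> u \<otimes> u = u \<otimes> (u \<otimes> a \<ominus> u \<otimes> x)"
    using u(1) by (metis m_assoc)
  also have "\<dots> = u \<otimes> u \<otimes> a \<oplus> u \<otimes> u \<otimes> a"
    unfolding ux using u(1) ac by algebra
  finally have uuu: "u \<otimes> u \<otimes> u = u \<otimes> u \<otimes> a \<oplus> u \<otimes> u \<otimes> a" .
  have "u \<otimes> u \<otimes> a = a \<otimes> (u \<otimes> u)"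
    using ua u(1) ac by (metis m_assoc)
  then have p: "u \<otimes> u \<otimes> a \<in> pos"
    using pos_mult sa_square_pos[OF u] a by simp
  have "u \<otimes> x \<otimes> u = \<ominus> (u \<otimes> (a \<otimes> u))"
    unfolding ux using u(1) ac by algebra
  also have "\<dots> = \<ominus> (u \<otimes> u \<otimes> a)"
    unfolding ua[symmetric] using u(1) ac by algebra
  finally have "u \<otimes> x \<otimes> u \<oplus> u \<otimes> x \<otimes> u = \<ominus> (u \<otimes> u \<otimes> u)"
    unfolding uuu using u(1) ac by algebra
  moreover have "x \<in> pos" if "u = \<zero>"
    using that a x(1) ac by (simp add: u_def diff_eq_zero)
  ultimately show ?thesis using that u p uuu pos_add[OF p p] by auto
qed

subsection \<open>Squares are positive\<close>

text \<open>Write \<open>q = - a\<^sup>*a\<close> and \<open>p = aa\<^sup>*\<close>. Both are positive and \<open>(1 - p) a = a (1 + q)\<close>, so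
  \<open>q (1 + q)\<^sup>n\<close> stays bounded by 1, while it dominates \<open>n q\<^sup>2\<close>.\<close>

lemma neg_star_mult_contraction:
  assumes a: "a \<in> carrier F" and na: "nrm F a \<le> 1" and q: "\<ominus> (star F a \<otimes> a) \<in> pos"
  shows "a = \<zero>"
proof -
  define s where "s = star F a"
  have s: "s \<in> carrier F" using a by (simp add: s_def)
  define q where "q = \<ominus> (s \<otimes> a)"
  have q: "q \<in> pos" using q by (simp add: q_def s_def)
  have qc: "q \<in> carrier F" using q by simp
  define k where "k = \<i> \<odot> (a \<ominus> s)"
  have kc: "k \<in> carrier F" using a s by (simp add: k_def)
  have "star F k = (- \<i>) \<odot> (s \<ominus> a)"
    using a s by (simp add: k_def star_smult star_diff s_def)
  also have "\<dots> = k"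
    using a s by (simp add: k_def smult_minus_left diff_swap flip: smult_minus_right)
  finally have sk: "star F k = k" .
  have kk: "k \<otimes> k = \<ominus> ((a \<ominus> s) \<otimes> (a \<ominus> s))"
    using a s smult_minus_one by (simp add: k_def smult_mult_left smult_mult_right flip: smult_smult)
  have h: "star F (a \<oplus> s) = a \<oplus> s" using a s by (simp add: star_add s_def a_comm)
  have "(a \<oplus> s) \<otimes> (a \<oplus> s) \<oplus> k \<otimes> k \<oplus> (q \<oplus> q) \<in> pos"
    using a s q kc sk h by (intro pos_add sa_square_pos) simp_all
  moreover have "(a \<oplus> s) \<otimes> (a \<oplus> s) \<oplus> k \<otimes> k \<oplus> (q \<oplus> q) = a \<otimes> s \<oplus> a \<otimes> s"
    unfolding kk q_def using a s by algebra
  ultimately have "a \<otimes> s \<oplus> a \<otimes> s \<in> pos" by (simp only:)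
  then have p: "a \<otimes> s \<in> pos"
    by (rule pos_halves[OF m_closed[OF a s]])
  have "nrm F (a \<otimes> s) \<le> 1"
    using nrm_mult[OF a s] mult_mono[OF na na] nrm_nonneg[OF a] a by (simp add: s_def)
  then have np: "nrm F (\<one> \<ominus> a \<otimes> s) \<le> 1"
    using nrm_scal_diff_mono[OF pos_closed[OF p] pos_nrm[OF p], of 1] by simp
  define r where "r = \<one> \<oplus> q"
  have rc: "r \<in> carrier F" using qc by (simp add: r_def)
  have pr: "(\<one> \<ominus> a \<otimes> s) \<otimes> a = a \<otimes> r"
    unfolding r_def q_def using a s by algebra
  have ar: "nrm F (a \<otimes> r [^] n) \<le> 1" for n :: nat
  proof (induction n)
    case (Suc n)
    have "a \<otimes> r [^] Suc n = (\<one> \<ominus> a \<otimes> s) \<otimes> (a \<otimes> r [^] n)"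
      using a s rc pr by (metis m_assoc minus_closed m_closed nat_pow_Suc2 nat_pow_closed one_closed)
    then show ?case
      using nrm_mult[of "\<one> \<ominus> a \<otimes> s" "a \<otimes> r [^] n"] mult_mono[OF np Suc] nrm_nonneg a s rc by simp
  qed (use a na in simp)
  have qr: "nrm F (q \<otimes> r [^] n) \<le> 1" for n :: nat
  proof -
    have "q \<otimes> r [^] n = \<ominus> (s \<otimes> (a \<otimes> r [^] n))"
      using a s rc by (simp add: q_def l_minus m_assoc)
    then have "nrm F (q \<otimes> r [^] n) \<le> nrm F s * nrm F (a \<otimes> r [^] n)"
      using nrm_mult[of s "a \<otimes> r [^] n"] a s rc by simp
    also have "\<dots> \<le> 1"
      using mult_mono[OF na ar[of n]] nrm_nonneg a rc by (simp add: s_def)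
    finally show ?thesis .
  qed
  have q2: "q \<otimes> q \<in> pos" using q by (simp add: sa_square_pos)
  have q3: "q \<otimes> q \<otimes> q \<in> pos" using q qc by (intro pos_mult q2) (simp_all add: m_assoc)
  have "\<exists>S\<in>pos. S \<otimes> q = q \<otimes> S \<and> q \<otimes> r [^] n = S \<oplus> q \<oplus> complex_of_real (real n) \<odot> (q \<otimes> q)" for n
  proof (induction n)
    case 0
    show ?case using qc by (intro bexI[of _ \<zero>]) simp_all
  next
    case (Suc n)
    then obtain S where S: "S \<in> pos" "S \<otimes> q = q \<otimes> S"
      and eq: "q \<otimes> r [^] n = S \<oplus> q \<oplus> complex_of_real (real n) \<odot> (q \<otimes> q)" by blast
    have Sc: "S \<in> carrier F" using S by simp
    define m where "m = complex_of_real (real n) \<odot> (q \<otimes> q)"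
    have mc: "m \<in> carrier F" using qc by (simp add: m_def)
    have mq: "m \<otimes> q = complex_of_real (real n) \<odot> (q \<otimes> q \<otimes> q)" "q \<otimes> m = m \<otimes> q"
      using qc by (simp_all add: m_def smult_mult_left smult_mult_right m_assoc)
    have mS: "complex_of_real (real (Suc n)) \<odot> (q \<otimes> q) = q \<otimes> q \<oplus> m"
      using qc by (simp add: m_def smult_add_left)
    let ?S = "S \<oplus> S \<otimes> q \<oplus> m \<otimes> q"
    have "m \<otimes> q \<in> pos" unfolding mq by (intro pos_smult q3) simp
    then have "?S \<in> pos" using pos_mult[OF S(1) q S(2)] S(1) by (intro pos_add)
    moreover have "?S \<otimes> q = S \<otimes> q \<oplus> S \<otimes> q \<otimes> q \<oplus> m \<otimes> q \<otimes> q" using Sc qc mc by algebra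
    moreover have "S \<otimes> q \<oplus> S \<otimes> q \<otimes> q \<oplus> m \<otimes> q \<otimes> q = q \<otimes> S \<oplus> q \<otimes> S \<otimes> q \<oplus> q \<otimes> m \<otimes> q"
      by (simp only: S(2) mq(2))
    moreover have "\<dots> = q \<otimes> ?S" using Sc qc mc by algebra
    moreover have "q \<otimes> r [^] Suc n = (q \<otimes> r [^] n) \<otimes> r"
      using qc rc by (simp add: m_assoc)
    moreover have "\<dots> = ?S \<oplus> q \<oplus> (q \<otimes> q \<oplus> m)"
      unfolding eq unfolding m_def[symmetric] r_def using Sc qc mc by algebra
    ultimately show ?case unfolding mS by (intro bexI[of _ ?S]) simp_all
  qed
  then have bound: "real n * nrm F (q \<otimes> q) \<le> 1" for n
  proof -
    obtain S where S: "S \<in> pos"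
      and eq: "q \<otimes> r [^] n = S \<oplus> q \<oplus> complex_of_real (real n) \<odot> (q \<otimes> q)"
      using \<open>\<And>n. \<exists>S\<in>pos. S \<otimes> q = q \<otimes> S \<and> q \<otimes> r [^] n = S \<oplus> q \<oplus> complex_of_real (real n) \<odot> (q \<otimes> q)\<close> by blast
    define m where "m = complex_of_real (real n) \<odot> (q \<otimes> q)"
    have mc: "m \<in> carrier F" using qc by (simp add: m_def)
    have "S \<oplus> q \<oplus> m \<ominus> m = S \<oplus> q" using pos_closed[OF S] qc mc by algebra
    then have "nrm F m \<le> nrm F (q \<otimes> r [^] n)"
      unfolding eq m_def[symmetric] using pos_smult[OF q2, of "real n"] S q
      by (intro nrm_mono) (auto simp: m_def)
    then show ?thesis using qr[of n] qc by (simp add: m_def nrm_smult)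
  qed
  have "nrm F (q \<otimes> q) = 0"
  proof (rule ccontr)
    assume "nrm F (q \<otimes> q) \<noteq> 0"
    then have "nrm F (q \<otimes> q) > 0" using nrm_nonneg[of "q \<otimes> q"] qc by simp
    then obtain n where "1 < real n * nrm F (q \<otimes> q)"
      using reals_Archimedean3 by blast
    then show False using bound[of n] by simp
  qed
  then have "nrm F q = 0" using cstar_identity[OF qc] q by simp
  then have "nrm F (star F a \<otimes> a) = 0" using a s nrm_minus[of "s \<otimes> a"] by (simp add: q_def s_def)
  then show ?thesis using cstar_identity[OF a] nrm_eq_0[OF a] by simp
qed

lemma neg_star_mult_eq_zero:
  assumes a: "a \<in> carrier F" and q: "\<ominus> (star F a \<otimes> a) \<in> pos"
  shows "a = \<zero>"
proof (cases "nrm F a = 0")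
  case True
  then show ?thesis using nrm_eq_0[OF a] by simp
next
  case False
  define r where "r = 1 / nrm F a"
  have r: "r > 0" using False nrm_nonneg[OF a] by (simp add: r_def)
  define b where "b = complex_of_real r \<odot> a"
  have b: "b \<in> carrier F" using a by (simp add: b_def)
  have "star F b \<otimes> b = complex_of_real (r * r) \<odot> (star F a \<otimes> a)"
    using a by (simp add: b_def star_smult smult_mult_left smult_mult_right smult_smult)
  then have "\<ominus> (star F b \<otimes> b) \<in> pos"
    using pos_smult[OF q, of "r * r"] a r by (simp add: smult_minus_right)
  moreover have "nrm F b \<le> 1"
    using r nrm_nonneg[OF a] by (simp add: b_def nrm_smult a r_def norm_divide)
  ultimately have "b = \<zero>" using neg_star_mult_contraction[OF b] by simp
  then show ?thesis using smult_eq_zero[of "complex_of_real r" a] a r by (simp add: b_def)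
qed

theorem star_mult_pos [simp]:
  assumes a: "a \<in> carrier F" shows "star F a \<otimes> a \<in> pos"
proof -
  define c where "c = star F a \<otimes> a"
  have c: "c \<in> carrier F" "star F c = c" using a by (simp_all add: c_def star_mult)
  obtain u where u: "u \<in> carrier F" "star F u = u" and u3: "u \<otimes> u \<otimes> u \<in> pos"
    and ucu: "u \<otimes> c \<otimes> u \<oplus> u \<otimes> c \<otimes> u = \<ominus> (u \<otimes> u \<otimes> u)" and uz: "u = \<zero> \<Longrightarrow> c \<in> pos"
    using sa_neg_part[OF c] by blast
  have eq: "star F (a \<otimes> u) \<otimes> (a \<otimes> u) = u \<otimes> c \<otimes> u"
    using a u by (simp add: star_mult c_def m_assoc)
  have "\<ominus> (u \<otimes> c \<otimes> u) \<oplus> \<ominus> (u \<otimes> c \<otimes> u) = \<ominus> (u \<otimes> c \<otimes> u \<oplus> u \<otimes> c \<otimes> u)"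
    using c(1) u(1) by algebra
  also have "\<dots> = u \<otimes> u \<otimes> u"
    unfolding ucu using u(1) by algebra
  finally have "\<ominus> (u \<otimes> c \<otimes> u) \<oplus> \<ominus> (u \<otimes> c \<otimes> u) \<in> pos"
    using u3 by (simp only:)
  then have "\<ominus> (u \<otimes> c \<otimes> u) \<in> pos"
    by (rule pos_halves[rotated]) (use c u in simp)
  then have "a \<otimes> u = \<zero>"
    using neg_star_mult_eq_zero[of "a \<otimes> u"] a u eq by simp
  then have "u \<otimes> c \<otimes> u = \<zero>" using eq by simp
  then have "\<ominus> (u \<otimes> u \<otimes> u) = \<zero>" using ucu by simp
  then have "u \<otimes> u \<otimes> u = \<zero>" using u by (metis minus_minus minus_zero m_closed)
  then show ?thesis
    using uz sa_nilpotent[OF u] by (simp add: c_def)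
qed

lemma conj_pos:
  assumes "x \<in> pos" "a \<in> carrier F" shows "star F a \<otimes> x \<otimes> a \<in> pos"
proof -
  obtain b where b: "b \<in> pos" "b \<otimes> b = x" using pos_sqrt[OF assms(1)] by blast
  have "star F (b \<otimes> a) \<otimes> (b \<otimes> a) = star F a \<otimes> x \<otimes> a"
    using b assms by (simp add: star_mult m_assoc flip: b(2))
  then show ?thesis using star_mult_pos[of "b \<otimes> a"] b assms by simp
qed

lemma conj_scal_diff_pos:
  assumes "x \<in> pos" "nrm F x \<le> M" "a \<in> carrier F"
  shows "complex_of_real M \<odot> (star F a \<otimes> a) \<ominus> star F a \<otimes> x \<otimes> a \<in> pos"
proof -
  have x: "x \<in> carrier F" using assms by simp
  have "scal M = scal (M - nrm F x) \<oplus> scal (nrm F x)"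
    using scal_add[of "M - nrm F x" "nrm F x"] by simp
  then have "scal M \<ominus> x = scal (M - nrm F x) \<oplus> (scal (nrm F x) \<ominus> x)"
    using x smult_closed[OF one_closed] by (simp add: minus_eq a_assoc)
  then have "scal M \<ominus> x \<in> pos"
    using pos_add[OF scal_pos[of "M - nrm F x"] scal_nrm_diff_pos[of x]] assms by simp
  then have "star F a \<otimes> (scal M \<ominus> x) \<otimes> a \<in> pos" using conj_pos assms by blast
  moreover have "star F a \<otimes> (scal M \<ominus> x) \<otimes> a = complex_of_real M \<odot> (star F a \<otimes> a) \<ominus> star F a \<otimes> x \<otimes> a"
    using assms x by (simp add: minus_eq r_distr l_distr r_minus l_minus smult_mult_left smult_mult_right)
  ultimately show ?thesis by simp
qed

lemma star_inverse_eq: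
  assumes "x \<in> carrier F" "star F x = x" "y \<in> carrier F" "x \<otimes> y = \<one>"
  shows "star F y = y" "y \<otimes> x = \<one>"
proof -
  have yx: "star F y \<otimes> x = \<one>" using star_mult[of x y] assms by simp
  then have "star F y = star F y \<otimes> (x \<otimes> y)" using assms by simp
  also have "\<dots> = y" using yx assms by (metis m_assoc l_one star_closed)
  finally show "star F y = y" .
  then show "y \<otimes> x = \<one>" using yx by simp
qed

lemma pos_inverse:
  assumes x: "x \<in> carrier F" and d: "x \<ominus> scal e \<in> pos" and e: "0 < e"
  obtains y where "y \<in> carrier F" "star F y = y" "x \<otimes> y = \<one>" "y \<otimes> x = \<one>"
proof -
  define T where "T = nrm F (x \<ominus> scal e)"
  have T: "0 \<le> T" using nrm_nonneg x by (simp add: T_def)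
  define t where "t = T + e"
  have t: "0 < t" using T e by (simp add: t_def)
  define z where "z = complex_of_real (1/t) \<odot> (scal T \<ominus> (x \<ominus> scal e))"
  have z: "z \<in> carrier F" using x by (simp add: z_def)
  have "scal T \<ominus> (x \<ominus> scal e) = scal t \<ominus> x"
    unfolding t_def scal_add
    using x smult_closed[OF one_closed, of "complex_of_real T"] smult_closed[OF one_closed, of "complex_of_real e"]
    by algebra
  then have tz: "complex_of_real t \<odot> z = scal t \<ominus> x"
    unfolding z_def using t x by (simp flip: smult_smult of_real_mult)
  have xz: "x = complex_of_real t \<odot> (\<one> \<ominus> z)"
  proof -
    have "complex_of_real t \<odot> (\<one> \<ominus> z) = scal t \<ominus> (scal t \<ominus> x)"
      using z by (simp add: smult_diff_right tz)
    also have "\<dots> = x"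
      using x smult_closed[OF one_closed, of "complex_of_real t"] by algebra
    finally show ?thesis by simp
  qed
  define q where "q = T / t"
  have q: "0 \<le> q" "q < 1" using T t e by (simp_all add: q_def t_def)
  have nz: "nrm F z \<le> q"
    using pos_nrm[OF d] t x by (simp add: z_def nrm_smult norm_divide q_def T_def divide_right_mono)
  define Y where "Y = rec_nat \<zero> (\<lambda>_ y. \<one> \<oplus> z \<otimes> y)"
  have Y0: "Y 0 = \<zero>" and YS: "Y (Suc n) = \<one> \<oplus> z \<otimes> Y n" for n by (simp_all add: Y_def)
  have Yc: "Y n \<in> carrier F" for n by (induction n) (simp_all add: Y0 YS z)
  have "nrm F (Y (Suc n) \<ominus> Y n) \<le> q ^ n" for n
  proof (induction n)
    case 0
    show ?case using z nrm_one_le by (simp add: Y0 YS minus_eq)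
  next
    case (Suc n)
    have "Y (Suc (Suc n)) \<ominus> Y (Suc n) = z \<otimes> (Y (Suc n) \<ominus> Y n)"
      unfolding YS[of "Suc n"] using z Yc[of "Suc n"] Yc[of n]
      by (subst (2) YS) algebra
    then show ?case
      using nrm_mult[of z "Y (Suc n) \<ominus> Y n"] mult_mono[OF nz Suc] nrm_nonneg q z Yc by simp
  qed
  then have "\<exists>l. converges Y l"
    using Yc q by (intro converges_if_dominated[of Y "\<lambda>n. \<Sum>k<n. q ^ k"])
      (auto simp: summable_iff_convergent[symmetric] intro: summable_geometric)
  then obtain y where y: "converges Y y" by blast
  have yc: "y \<in> carrier F" by (rule convergesD(2)[OF y])
  have "converges (\<lambda>n. \<one> \<oplus> z \<otimes> Y n) (\<one> \<oplus> z \<otimes> y)"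
    by (intro converges_add converges_mult converges_const y z one_closed)
  then have eq: "y = \<one> \<oplus> z \<otimes> y"
    using converges_unique[OF converges_Suc[OF y]] unfolding YS by blast
  have "(\<one> \<ominus> z) \<otimes> y = y \<ominus> z \<otimes> y" using yc z by algebra
  also have "\<dots> = (\<one> \<oplus> z \<otimes> y) \<ominus> z \<otimes> y" using eq by metis
  also have "\<dots> = \<one>" using yc z by algebra
  finally have xy: "x \<otimes> (complex_of_real (1/t) \<odot> y) = \<one>"
    unfolding xz using t yc z by (simp add: smult_mult_left smult_mult_right flip: smult_smult of_real_mult)
  have "star F (x \<ominus> scal e) = x \<ominus> scal e" using d by simp
  then have "star F x \<ominus> scal e = x \<ominus> scal e" using x by (simp add: star_diff)
  then have "star F x = x" using x by (simp add: minus_eq)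
  then show ?thesis
    using that[of "complex_of_real (1/t) \<odot> y"] star_inverse_eq[OF x _ _ xy] xy yc by simp
qed

subsection \<open>Tridiagonal forms\<close>

primrec tridiag :: "'a \<Rightarrow> (nat \<Rightarrow> 'a) \<Rightarrow> nat \<Rightarrow> (nat \<Rightarrow> 'a) \<Rightarrow> 'a" where
  "tridiag a e 0 w = star F (w 0) \<otimes> a \<otimes> w 0"
| "tridiag a e (Suc n) w = tridiag a e n w \<oplus> star F (w (Suc n)) \<otimes> a \<otimes> w (Suc n)
     \<oplus> (star F (w n) \<otimes> e n \<otimes> w (Suc n) \<oplus> star F (w (Suc n)) \<otimes> e n \<otimes> w n)"

lemma tridiag_closed [simp]:
  "\<lbrakk>a \<in> carrier F; \<And>n. e n \<in> carrier F; \<And>k. w k \<in> carrier F\<rbrakk> \<Longrightarrow> tridiag a e n w \<in> carrier F"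
  by (induction n) simp_all

lemma tridiag_cong: "(\<And>k. k \<le> n \<Longrightarrow> w k = w' k) \<Longrightarrow> tridiag a e n w = tridiag a e n w'"
  by (induction n) simp_all

lemma tridiag_shift_diagonal:
  assumes a: "a \<in> carrier F" and e: "\<And>n. e n \<in> carrier F" and w: "\<And>k. w k \<in> carrier F"
    and r: "0 \<le> r"
  shows "\<exists>q\<in>pos. tridiag (a \<oplus> scal r) e n w
    = tridiag a e n w \<oplus> q \<oplus> complex_of_real r \<odot> (star F (w n) \<otimes> w n)"
proof (induction n)
  case 0
  show ?case using a w
    by (intro bexI[of _ \<zero>]) (simp_all add: r_distr l_distr smult_mult_left smult_mult_right)
next
  case (Suc n)
  then obtain q where q: "q \<in> pos" and eq: "tridiag (a \<oplus> scal r) e n w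
    = tridiag a e n w \<oplus> q \<oplus> complex_of_real r \<odot> (star F (w n) \<otimes> w n)" by blast
  let ?q = "q \<oplus> complex_of_real r \<odot> (star F (w n) \<otimes> w n)"
  have "?q \<in> pos" using q w r by (intro pos_add pos_smult) simp_all
  moreover have "star F (w (Suc n)) \<otimes> (a \<oplus> scal r) \<otimes> w (Suc n)
    = star F (w (Suc n)) \<otimes> a \<otimes> w (Suc n) \<oplus> complex_of_real r \<odot> (star F (w (Suc n)) \<otimes> w (Suc n))"
    using a w by (simp add: r_distr l_distr smult_mult_left smult_mult_right)
  ultimately show ?case using a e w q
    by (intro bexI[of _ ?q]) (simp_all add: eq a_ac)
qed

text \<open>The elements \<open>\<alpha> n\<close> are the pivots in the block Cholesky decomposition.\<close>

lemma pivots_exist: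
  assumes a: "a \<in> carrier F" and e: "\<And>n. e n \<in> carrier F" "\<And>n. star F (e n) = e n"
    and p: "\<And>n w. (\<And>k. w k \<in> carrier F) \<Longrightarrow> tridiag a e n w \<in> pos" and r: "0 < r"
  obtains \<alpha> where "\<And>n. \<alpha> n \<in> pos" "\<alpha> 0 = a \<oplus> scal r"
    "\<And>n. \<alpha> n \<ominus> \<alpha> (Suc n) \<oplus> (a \<oplus> scal r) \<oplus> (e n \<oplus> e n) \<in> pos"
    "\<And>n. \<alpha> n \<ominus> \<alpha> (Suc n) \<oplus> (a \<oplus> scal r) \<ominus> (e n \<oplus> e n) \<in> pos"
proof -
  define a' where "a' = a \<oplus> scal r"
  have a'c: "a' \<in> carrier F" using a by (simp add: a'_def)
  have "a \<in> pos" using p[of "\<lambda>_. \<one>" 0] a by simp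
  then have a'p: "a' \<in> pos" using scal_pos r by (auto simp: a'_def)
  define isinv where "isinv x y \<longleftrightarrow> y \<in> carrier F \<and> star F y = y \<and> x \<otimes> y = \<one> \<and> y \<otimes> x = \<one>" for x y
  define \<alpha> where "\<alpha> = rec_nat a' (\<lambda>n x. a' \<ominus> e n \<otimes> (SOME y. isinv x y) \<otimes> e n)"
  define \<beta> where "\<beta> n = (SOME y. isinv (\<alpha> n) y)" for n
  have \<alpha>0: "\<alpha> 0 = a'" and \<alpha>S: "\<alpha> (Suc n) = a' \<ominus> e n \<otimes> \<beta> n \<otimes> e n" for n
    by (simp_all add: \<alpha>_def \<beta>_def)
  define P where "P n \<longleftrightarrow> \<alpha> n \<in> carrier F \<and> (\<forall>x\<in>carrier F. \<exists>w. (\<forall>k. w k \<in> carrier F) \<and> w n = x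
      \<and> tridiag a' e n w = star F x \<otimes> \<alpha> n \<otimes> x)" for n
  have lower: "\<alpha> n \<ominus> scal r \<in> pos" if Pn: "P n" for n
  proof -
    obtain w where w: "\<And>k. w k \<in> carrier F" "w n = \<one>"
      and eq: "tridiag a' e n w = star F \<one> \<otimes> \<alpha> n \<otimes> \<one>" and \<alpha>c: "\<alpha> n \<in> carrier F"
      using Pn one_closed unfolding P_def by blast
    obtain q where q: "q \<in> pos" and eq2: "tridiag a' e n w
        = tridiag a e n w \<oplus> q \<oplus> complex_of_real r \<odot> (star F (w n) \<otimes> w n)"
      using tridiag_shift_diagonal[where e = e and w = w and r = r and n = n, OF a e(1)] w r unfolding a'_def by auto
    have c: "tridiag a e n w \<in> carrier F" using a e w by simp
    have "\<alpha> n = tridiag a e n w \<oplus> q \<oplus> scal r"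
      using eq eq2 w \<alpha>c by simp
    also have "\<dots> \<ominus> scal r = tridiag a e n w \<oplus> q"
      using c pos_closed[OF q] smult_closed[OF one_closed, of "complex_of_real r"] by algebra
    also have "\<dots> \<in> pos" using p q w by auto
    finally show ?thesis .
  qed
  have inv: "\<beta> n \<in> carrier F \<and> star F (\<beta> n) = \<beta> n \<and> \<alpha> n \<otimes> \<beta> n = \<one> \<and> \<beta> n \<otimes> \<alpha> n = \<one>"
    if Pn: "P n" for n
  proof -
    have "\<alpha> n \<in> carrier F" using Pn by (simp add: P_def)
    then have "\<exists>y. isinv (\<alpha> n) y"
      unfolding isinv_def using pos_inverse[OF _ lower[OF Pn] r] by metis
    then show ?thesis unfolding \<beta>_def by (metis (mono_tags, lifting) isinv_def someI_ex)
  qed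
  have P: "P n" for n
  proof (induction n)
    case 0
    have "\<exists>w. (\<forall>k. w k \<in> carrier F) \<and> w 0 = x \<and> tridiag a' e 0 w = star F x \<otimes> a' \<otimes> x"
      if "x \<in> carrier F" for x
      using that by (intro exI[of _ "\<lambda>_. x"]) simp
    then show ?case unfolding P_def \<alpha>0 using a'c by blast
  next
    case (Suc n)
    note b = inv[OF Suc]
    have bc: "\<beta> n \<in> carrier F" using b by simp
    have \<alpha>c: "\<alpha> n \<in> carrier F" using Suc by (simp add: P_def)
    have en: "e n \<in> carrier F" by (rule e)
    have "\<exists>w. (\<forall>k. w k \<in> carrier F) \<and> w (Suc n) = x \<and> tridiag a' e (Suc n) w = star F x \<otimes> \<alpha> (Suc n) \<otimes> x"
      if x: "x \<in> carrier F" for x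
    proof -
      define y where "y = \<ominus> (\<beta> n \<otimes> e n \<otimes> x)"
      have y: "y \<in> carrier F" using bc en x by (simp add: y_def)
      obtain w where w: "\<forall>k. w k \<in> carrier F" "w n = y"
        and eq: "tridiag a' e n w = star F y \<otimes> \<alpha> n \<otimes> y"
        using Suc y unfolding P_def by blast
      define w' where "w' = w(Suc n := x)"
      have eq': "tridiag a' e n w' = star F y \<otimes> \<alpha> n \<otimes> y"
        unfolding eq[symmetric] by (rule tridiag_cong) (simp add: w'_def)
      have sy: "star F y \<in> carrier F" "star F x \<in> carrier F" using y x by simp_all
      have "\<alpha> n \<otimes> y = \<ominus> ((\<alpha> n \<otimes> \<beta> n) \<otimes> e n \<otimes> x)"
        unfolding y_def using \<alpha>c bc en x by algebra
      then have "\<alpha> n \<otimes> y = \<ominus> (e n \<otimes> x)" using b en x by simp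
      then have e1: "star F y \<otimes> \<alpha> n \<otimes> y = \<ominus> (star F y \<otimes> e n \<otimes> x)"
        using sy y en x \<alpha>c by (simp add: m_assoc r_minus)
      have e2: "star F x \<otimes> e n \<otimes> y = \<ominus> (star F x \<otimes> (e n \<otimes> \<beta> n \<otimes> e n) \<otimes> x)"
        unfolding y_def using sy en bc x by algebra
      have "tridiag a' e (Suc n) w' = star F y \<otimes> \<alpha> n \<otimes> y \<oplus> star F x \<otimes> a' \<otimes> x
          \<oplus> (star F y \<otimes> e n \<otimes> x \<oplus> star F x \<otimes> e n \<otimes> y)"
        using w by (simp add: eq') (simp add: w'_def)
      also have "\<dots> = star F x \<otimes> \<alpha> (Suc n) \<otimes> x"
        unfolding e1 e2 \<alpha>S using sy en bc x a'c by algebra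
      finally show ?thesis using w x by (intro exI[of _ w']) (auto simp: w'_def)
    qed
    then show ?case unfolding P_def using a'c en bc by (simp add: \<alpha>S)
  qed
  have \<alpha>p: "\<alpha> n \<in> pos" for n
  proof -
    have "(\<alpha> n \<ominus> scal r) \<oplus> scal r = \<alpha> n"
      using P[of n] smult_closed[OF one_closed, of "complex_of_real r"] unfolding P_def by algebra
    then show ?thesis using pos_add[OF lower[OF P[of n]] scal_pos[of r]] r by simp
  qed
  have edge: "\<alpha> n \<ominus> \<alpha> (Suc n) \<oplus> a' \<oplus> (f \<oplus> f) \<in> pos"
    if f: "f \<in> carrier F" "star F f = f" "f \<otimes> \<beta> n \<otimes> f = e n \<otimes> \<beta> n \<otimes> e n" for f n
  proof -
    note b = inv[OF P[of n]]
    have bc: "\<beta> n \<in> carrier F" using b by simp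
    have \<alpha>c: "\<alpha> n \<in> carrier F" using \<alpha>p by simp
    have en: "e n \<in> carrier F" by (rule e)
    have "star F (\<one> \<oplus> \<beta> n \<otimes> f) = \<one> \<oplus> f \<otimes> \<beta> n"
      using b f by (simp add: star_add star_mult)
    then have "(\<one> \<oplus> f \<otimes> \<beta> n) \<otimes> \<alpha> n \<otimes> (\<one> \<oplus> \<beta> n \<otimes> f) \<in> pos"
      using conj_pos[OF \<alpha>p, of "\<one> \<oplus> \<beta> n \<otimes> f" n] bc f by simp
    also have "(\<one> \<oplus> f \<otimes> \<beta> n) \<otimes> \<alpha> n \<otimes> (\<one> \<oplus> \<beta> n \<otimes> f)
      = \<alpha> n \<oplus> (f \<otimes> (\<beta> n \<otimes> \<alpha> n) \<oplus> (\<alpha> n \<otimes> \<beta> n) \<otimes> f) \<oplus> f \<otimes> (\<beta> n \<otimes> \<alpha> n) \<otimes> \<beta> n \<otimes> f"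
      using \<alpha>c bc f(1) by algebra
    also have "\<dots> = \<alpha> n \<oplus> (f \<oplus> f) \<oplus> f \<otimes> \<beta> n \<otimes> f"
      using b f by simp
    also have "\<dots> = \<alpha> n \<ominus> \<alpha> (Suc n) \<oplus> a' \<oplus> (f \<oplus> f)"
      unfolding f(3) \<alpha>S using \<alpha>c bc f(1) en a'c by algebra
    finally show ?thesis .
  qed
  have "\<alpha> n \<ominus> \<alpha> (Suc n) \<oplus> a' \<ominus> (e n \<oplus> e n) \<in> pos" for n
  proof -
    have bc: "\<beta> n \<in> carrier F" using inv[OF P[of n]] by simp
    have en: "e n \<in> carrier F" by (rule e)
    have \<alpha>c: "\<alpha> n \<in> carrier F" "\<alpha> (Suc n) \<in> carrier F" using \<alpha>p by simp_all
    have "\<alpha> n \<ominus> \<alpha> (Suc n) \<oplus> a' \<oplus> (\<ominus> e n \<oplus> \<ominus> e n) \<in> pos"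
    proof (rule edge)
      show "\<ominus> e n \<otimes> \<beta> n \<otimes> \<ominus> e n = e n \<otimes> \<beta> n \<otimes> e n" using bc en by algebra
    qed (use e in \<open>simp_all add: star_minus\<close>)
    also have "\<alpha> n \<ominus> \<alpha> (Suc n) \<oplus> a' \<oplus> (\<ominus> e n \<oplus> \<ominus> e n) = \<alpha> n \<ominus> \<alpha> (Suc n) \<oplus> a' \<ominus> (e n \<oplus> e n)"
      using en \<alpha>c a'c by algebra
    finally show ?thesis .
  qed
  then show ?thesis
    using that[of \<alpha>] \<alpha>p \<alpha>0 edge[OF e refl] unfolding a'_def by blast
qed

text \<open>Averaging the edges of each kind along a long path makes the splitting independent of the
  position; the last pivot is the only boundary term and is killed by the division by \<open>2m\<close>.\<close>

lemma tridiag_split: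
  assumes b: "b \<in> carrier F" "star F b = b" and c: "c \<in> carrier F" "star F c = c"
    and a: "a \<in> carrier F"
    and p: "\<And>n w. (\<And>k. w k \<in> carrier F) \<Longrightarrow> tridiag a (\<lambda>n. if even n then b else c) n w \<in> pos"
    and \<delta>: "0 < \<delta>"
  obtains s t where "s \<in> carrier F" "t \<in> carrier F" "s \<oplus> t = a \<oplus> scal \<delta>"
    "s \<oplus> b \<in> pos" "s \<ominus> b \<in> pos" "t \<oplus> c \<in> pos" "t \<ominus> c \<in> pos"
proof -
  define a' where "a' = a \<oplus> scal (\<delta> / 2)"
  have a'c: "a' \<in> carrier F" using a by (simp add: a'_def)
  have "a \<in> pos" using p[of "\<lambda>_. \<one>" 0] a by simp
  then have a'p: "a' \<in> pos" using scal_pos[of "\<delta> / 2"] \<delta> by (auto simp: a'_def)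
  have e: "\<And>n::nat. (if even n then b else c) \<in> carrier F"
    "\<And>n::nat. star F (if even n then b else c) = (if even n then b else c)"
    using b c by simp_all
  have \<delta>2: "0 < \<delta> / 2" using \<delta> by simp
  obtain \<alpha> where \<alpha>: "\<And>n. \<alpha> n \<in> pos" and \<alpha>0: "\<alpha> 0 = a'"
    and plus: "\<And>n. \<alpha> n \<ominus> \<alpha> (Suc n) \<oplus> a' \<oplus> ((if even n then b else c) \<oplus> (if even n then b else c)) \<in> pos"
    and minus: "\<And>n. \<alpha> n \<ominus> \<alpha> (Suc n) \<oplus> a' \<ominus> ((if even n then b else c) \<oplus> (if even n then b else c)) \<in> pos"
    using pivots_exist[OF a e p \<delta>2] unfolding a'_def[symmetric] by blast
  have \<alpha>c: "\<alpha> n \<in> carrier F" for n using \<alpha> by simp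
  have "\<exists>S\<in>carrier F. \<exists>T\<in>carrier F. S \<oplus> T \<oplus> \<alpha> (2 * m) = of_nat (2 * m + 1) \<odot> a'
      \<and> S \<oplus> of_nat (2 * m) \<odot> b \<in> pos \<and> S \<ominus> of_nat (2 * m) \<odot> b \<in> pos
      \<and> T \<oplus> of_nat (2 * m) \<odot> c \<in> pos \<and> T \<ominus> of_nat (2 * m) \<odot> c \<in> pos" for m
  proof (induction m)
    case 0
    show ?case using a'c b c by (intro bexI[of _ \<zero>]) (simp_all add: \<alpha>0 minus_eq)
  next
    case (Suc m)
    then obtain S T where S: "S \<in> carrier F" and T: "T \<in> carrier F"
      and eq: "S \<oplus> T \<oplus> \<alpha> (2 * m) = of_nat (2 * m + 1) \<odot> a'"
      and ps: "S \<oplus> of_nat (2 * m) \<odot> b \<in> pos" "S \<ominus> of_nat (2 * m) \<odot> b \<in> pos"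
        "T \<oplus> of_nat (2 * m) \<odot> c \<in> pos" "T \<ominus> of_nat (2 * m) \<odot> c \<in> pos" by blast
    have sc: "of_nat (2 * Suc m) \<odot> x = of_nat (2 * m) \<odot> x \<oplus> (x \<oplus> x)"
      "of_nat (2 * Suc m + 1) \<odot> x = of_nat (2 * m + 1) \<odot> x \<oplus> (x \<oplus> x)" if "x \<in> carrier F" for x
    proof -
      have *: "of_nat (2 * Suc m) = of_nat (2 * m) + (2::complex)"
        "of_nat (2 * Suc m + 1) = of_nat (2 * m + 1) + (2::complex)" by simp_all
      show "of_nat (2 * Suc m) \<odot> x = of_nat (2 * m) \<odot> x \<oplus> (x \<oplus> x)"
        "of_nat (2 * Suc m + 1) \<odot> x = of_nat (2 * m + 1) \<odot> x \<oplus> (x \<oplus> x)"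
        unfolding * smult_add_left[OF that] smult_two[OF that] by simp_all
    qed
    let ?x = "\<alpha> (2 * m)" and ?y = "\<alpha> (Suc (2 * m))" and ?z = "\<alpha> (2 * Suc m)"
    define B where "B = of_nat (2 * m) \<odot> b"
    define C where "C = of_nat (2 * m) \<odot> c"
    have BC: "B \<in> carrier F" "C \<in> carrier F" using b c by (simp_all add: B_def C_def)
    note cl = S T \<alpha>c[of "2 * m"] \<alpha>c[of "Suc (2 * m)"] \<alpha>c[of "2 * Suc m"] a'c b(1) c(1) BC
    define S' where "S' = S \<oplus> (?x \<ominus> ?y \<oplus> a')"
    define T' where "T' = T \<oplus> (?y \<ominus> ?z \<oplus> a')"
    have ev: "?x \<ominus> ?y \<oplus> a' \<oplus> (b \<oplus> b) \<in> pos" "?x \<ominus> ?y \<oplus> a' \<ominus> (b \<oplus> b) \<in> pos"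
      using plus[of "2 * m"] minus[of "2 * m"] by simp_all
    have od: "?y \<ominus> ?z \<oplus> a' \<oplus> (c \<oplus> c) \<in> pos" "?y \<ominus> ?z \<oplus> a' \<ominus> (c \<oplus> c) \<in> pos"
      using plus[of "Suc (2 * m)"] minus[of "Suc (2 * m)"] by simp_all
    have "S' \<oplus> T' \<oplus> ?z = (S \<oplus> T \<oplus> ?x) \<oplus> (a' \<oplus> a')"
      unfolding S'_def T'_def using cl by algebra
    also have "\<dots> = of_nat (2 * Suc m + 1) \<odot> a'"
      unfolding eq sc(2)[OF a'c] ..
    finally have 1: "S' \<oplus> T' \<oplus> ?z = of_nat (2 * Suc m + 1) \<odot> a'" .
    have "S' \<oplus> of_nat (2 * Suc m) \<odot> b = (S \<oplus> B) \<oplus> (?x \<ominus> ?y \<oplus> a' \<oplus> (b \<oplus> b))"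
      unfolding S'_def sc(1)[OF b(1)] B_def[symmetric] using cl by algebra
    then have 2: "S' \<oplus> of_nat (2 * Suc m) \<odot> b \<in> pos"
      using pos_add[OF ps(1) ev(1)] by (simp only: B_def)
    have "S' \<ominus> of_nat (2 * Suc m) \<odot> b = (S \<ominus> B) \<oplus> (?x \<ominus> ?y \<oplus> a' \<ominus> (b \<oplus> b))"
      unfolding S'_def sc(1)[OF b(1)] B_def[symmetric] using cl by algebra
    then have 3: "S' \<ominus> of_nat (2 * Suc m) \<odot> b \<in> pos"
      using pos_add[OF ps(2) ev(2)] by (simp only: B_def)
    have "T' \<oplus> of_nat (2 * Suc m) \<odot> c = (T \<oplus> C) \<oplus> (?y \<ominus> ?z \<oplus> a' \<oplus> (c \<oplus> c))"
      unfolding T'_def sc(1)[OF c(1)] C_def[symmetric] using cl by algebra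
    then have 4: "T' \<oplus> of_nat (2 * Suc m) \<odot> c \<in> pos"
      using pos_add[OF ps(3) od(1)] by (simp only: C_def)
    have "T' \<ominus> of_nat (2 * Suc m) \<odot> c = (T \<ominus> C) \<oplus> (?y \<ominus> ?z \<oplus> a' \<ominus> (c \<oplus> c))"
      unfolding T'_def sc(1)[OF c(1)] C_def[symmetric] using cl by algebra
    then have 5: "T' \<ominus> of_nat (2 * Suc m) \<odot> c \<in> pos"
      using pos_add[OF ps(4) od(2)] by (simp only: C_def)
    have "S' \<in> carrier F" "T' \<in> carrier F" using cl by (simp_all add: S'_def T'_def)
    then show ?case using 1 2 3 4 5 by blast
  qed
  note ST = this
  obtain m0 :: nat where m0: "nrm F a' / \<delta> < real m0" using reals_Archimedean2 by blast
  define m where "m = Suc m0"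
  define r where "r = 1 / real (2 * m)"
  have r: "0 < r" by (simp add: r_def m_def)
  have small: "r * nrm F a' \<le> \<delta> / 2"
  proof -
    have "nrm F a' \<le> \<delta> * real m" using m0 \<delta> by (simp add: m_def field_simps)
    then show ?thesis by (simp add: r_def m_def field_simps)
  qed
  obtain S T where S: "S \<in> carrier F" and T: "T \<in> carrier F"
    and eq: "S \<oplus> T \<oplus> \<alpha> (2 * m) = of_nat (2 * m + 1) \<odot> a'"
    and ps: "S \<oplus> of_nat (2 * m) \<odot> b \<in> pos" "S \<ominus> of_nat (2 * m) \<odot> b \<in> pos"
      "T \<oplus> of_nat (2 * m) \<odot> c \<in> pos" "T \<ominus> of_nat (2 * m) \<odot> c \<in> pos" using ST by blast
  have rm: "complex_of_real r * of_nat (2 * m) = 1"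
  proof -
    have "complex_of_real r * of_nat (2 * m) = complex_of_real (r * real (2 * m))" by simp
    also have "r * real (2 * m) = 1" by (simp add: r_def m_def)
    finally show ?thesis by simp
  qed
  then have rx: "complex_of_real r \<odot> (of_nat (2 * m) \<odot> x) = x" if "x \<in> carrier F" for x
    using that by (simp only: smult_smult[symmetric] smult_1)
  define s where "s = complex_of_real r \<odot> S"
  define t0 where "t0 = complex_of_real r \<odot> T"
  define \<alpha>m where "\<alpha>m = complex_of_real r \<odot> \<alpha> (2 * m)"
  define ra where "ra = complex_of_real r \<odot> a'"
  have cl: "s \<in> carrier F" "t0 \<in> carrier F" "\<alpha>m \<in> carrier F" "ra \<in> carrier F"
    using S T \<alpha>c a'c by (simp_all add: s_def t0_def \<alpha>m_def ra_def)
  have sb: "s \<oplus> b \<in> pos" "s \<ominus> b \<in> pos" "t0 \<oplus> c \<in> pos" "t0 \<ominus> c \<in> pos"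
    using ps[THEN pos_smult, of r] r S T b c
    by (simp_all add: smult_add_right smult_diff_right rx s_def t0_def del: of_nat_mult)
  have "s \<oplus> t0 \<oplus> \<alpha>m = complex_of_real r \<odot> (S \<oplus> T \<oplus> \<alpha> (2 * m))"
    using S T \<alpha>c by (simp add: s_def t0_def \<alpha>m_def smult_add_right)
  also have "\<dots> = complex_of_real r \<odot> (of_nat (2 * m) \<odot> a' \<oplus> a')"
    unfolding eq using smult_add_left[OF a'c, of "of_nat (2 * m)" 1]
    by (simp only: of_nat_add of_nat_1 smult_1[OF a'c])
  also have "\<dots> = a' \<oplus> ra"
    using a'c by (simp add: smult_add_right rx ra_def del: of_nat_mult)
  finally have sum: "s \<oplus> t0 \<oplus> \<alpha>m = a' \<oplus> ra" .
  define q where "q = scal (\<delta> / 2 - r * nrm F a') \<oplus> (scal (r * nrm F a') \<ominus> ra) \<oplus> \<alpha>m"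
  have "scal (r * nrm F a') \<ominus> ra = complex_of_real r \<odot> (scal (nrm F a') \<ominus> a')"
    using a'c by (simp add: ra_def smult_diff_right smult_smult)
  then have qp: "q \<in> pos"
    unfolding q_def using small r scal_nrm_diff_pos[of a'] a'p \<alpha> 
    by (intro pos_add scal_pos) (simp_all add: pos_smult \<alpha>m_def)
  have qc: "q \<in> carrier F" using qp by simp
  have "scal (\<delta> / 2 - r * nrm F a') \<oplus> scal (r * nrm F a') = scal (\<delta> / 2)"
    using scal_add[of "\<delta> / 2 - r * nrm F a'" "r * nrm F a'"] by (simp only: diff_add_cancel)
  moreover have "q = (scal (\<delta> / 2 - r * nrm F a') \<oplus> scal (r * nrm F a')) \<ominus> ra \<oplus> \<alpha>m"
    unfolding q_def using cl smult_closed[OF one_closed, of "complex_of_real (\<delta> / 2 - r * nrm F a')"]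
      smult_closed[OF one_closed, of "complex_of_real (r * nrm F a')"] by algebra
  ultimately have q: "q = scal (\<delta> / 2) \<ominus> ra \<oplus> \<alpha>m" by simp
  have "scal \<delta> = scal (\<delta> / 2) \<oplus> scal (\<delta> / 2)"
    using scal_add[of "\<delta> / 2" "\<delta> / 2"] by (simp only: field_sum_of_halves)
  note d2 = this smult_closed[OF one_closed, of "complex_of_real (\<delta> / 2)"]
  have "s \<oplus> (t0 \<oplus> q) = (s \<oplus> t0 \<oplus> \<alpha>m) \<oplus> scal (\<delta> / 2) \<ominus> ra"
    unfolding q using cl d2(2) by algebra
  also have "\<dots> = a \<oplus> (scal (\<delta> / 2) \<oplus> scal (\<delta> / 2))"
    unfolding sum unfolding a'_def using cl d2(2) a by algebra
  finally have "s \<oplus> (t0 \<oplus> q) = a \<oplus> scal \<delta>" unfolding d2(1) .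
  moreover have "t0 \<oplus> q \<oplus> c = (t0 \<oplus> c) \<oplus> q" "t0 \<oplus> q \<ominus> c = (t0 \<ominus> c) \<oplus> q"
    using cl(2) c(1) qc by algebra+
  moreover note pos_add[OF sb(3) qp] pos_add[OF sb(4) qp]
  ultimately show ?thesis
    using that[of s "t0 \<oplus> q"] sb(1,2) cl qc by simp
qed

subsection \<open>Finite sums\<close>

lemma sum_closed [simp]: "(\<And>k. f k \<in> carrier F) \<Longrightarrow> (\<Oplus>k\<in>S. f k) \<in> carrier F"
  by (rule finsum_closed) blast

lemma sum_cong:
  "\<lbrakk>\<And>k. k \<in> S \<Longrightarrow> f k = g k; \<And>k. k \<in> S \<Longrightarrow> g k \<in> carrier F\<rbrakk> \<Longrightarrow> (\<Oplus>k\<in>S. f k) = (\<Oplus>k\<in>S. g k)"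
  by (rule finsum_cong') auto

lemma sum_insert:
  "\<lbrakk>finite S; k \<notin> S; \<And>k. f k \<in> carrier F\<rbrakk> \<Longrightarrow> (\<Oplus>k\<in>insert k S. f k) = f k \<oplus> (\<Oplus>k\<in>S. f k)"
  by (rule finsum_insert) auto

lemma sum_add:
  "\<lbrakk>\<And>k. f k \<in> carrier F; \<And>k. g k \<in> carrier F\<rbrakk>
    \<Longrightarrow> (\<Oplus>k\<in>S. f k \<oplus> g k) = (\<Oplus>k\<in>S. f k) \<oplus> (\<Oplus>k\<in>S. g k)"
  by (rule finsum_addf) auto

lemma sum_smult: "(\<And>k. f k \<in> carrier F) \<Longrightarrow> c \<odot> (\<Oplus>k\<in>S. f k) = (\<Oplus>k\<in>S. c \<odot> f k)"
  by (induction S rule: infinite_finite_induct) (simp_all add: finsum_infinite sum_insert smult_add_right)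

lemma sum_minus: "(\<And>k. f k \<in> carrier F) \<Longrightarrow> \<ominus> (\<Oplus>k\<in>S. f k) = (\<Oplus>k\<in>S. \<ominus> f k)"
  using sum_smult[of f "-1" S] by (simp add: smult_minus_one)

lemma sum_star: "(\<And>k. f k \<in> carrier F) \<Longrightarrow> star F (\<Oplus>k\<in>S. f k) = (\<Oplus>k\<in>S. star F (f k))"
  by (induction S rule: infinite_finite_induct) (simp_all add: finsum_infinite sum_insert star_add)

lemma sum_mult_left:
  "\<lbrakk>a \<in> carrier F; \<And>k. f k \<in> carrier F\<rbrakk> \<Longrightarrow> a \<otimes> (\<Oplus>k\<in>S. f k) = (\<Oplus>k\<in>S. a \<otimes> f k)"
  by (induction S rule: infinite_finite_induct) (simp_all add: finsum_infinite sum_insert r_distr)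

lemma sum_mult_right:
  "\<lbrakk>a \<in> carrier F; \<And>k. f k \<in> carrier F\<rbrakk> \<Longrightarrow> (\<Oplus>k\<in>S. f k) \<otimes> a = (\<Oplus>k\<in>S. f k \<otimes> a)"
  by (induction S rule: infinite_finite_induct) (simp_all add: finsum_infinite sum_insert l_distr)

lemma sum_zero [simp]: "(\<Oplus>k\<in>S. \<zero>) = \<zero>"
  by (rule finsum_zero)

lemma sum_swap:
  assumes "finite S" "finite T" "\<And>k l. f k l \<in> carrier F"
  shows "(\<Oplus>k\<in>S. \<Oplus>l\<in>T. f k l) = (\<Oplus>l\<in>T. \<Oplus>k\<in>S. f k l)"
  using assms(1) by (induction S) (simp_all add: assms sum_insert sum_add)

lemma sum_delta:
  assumes "finite S" "i \<in> S" "\<And>k. f k \<in> carrier F"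
  shows "(\<Oplus>k\<in>S. if k = i then f k else \<zero>) = f i"
proof -
  have "(\<Oplus>k\<in>S. if k = i then f k else \<zero>) = (\<Oplus>k\<in>insert i (S - {i}). if k = i then f k else \<zero>)"
    using assms by (simp add: insert_absorb)
  also have "\<dots> = f i \<oplus> (\<Oplus>k\<in>S - {i}. if k = i then f k else \<zero>)"
    using assms by (subst sum_insert) simp_all
  also have "(\<Oplus>k\<in>S - {i}. if k = i then f k else \<zero>) = (\<Oplus>k\<in>S - {i}. \<zero>)"
    by (rule sum_cong) auto
  finally show ?thesis using assms by simp
qed

lemma sum_pos: "\<lbrakk>\<And>k. k \<in> S \<Longrightarrow> f k \<in> pos; \<And>k. f k \<in> carrier F\<rbrakk> \<Longrightarrow> (\<Oplus>k\<in>S. f k) \<in> pos"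
  by (induction S rule: infinite_finite_induct) (auto simp: finsum_infinite sum_insert intro!: pos_add)

lemma sum_nrm: "(\<And>k. f k \<in> carrier F) \<Longrightarrow> nrm F (\<Oplus>k\<in>S. f k) \<le> (\<Sum>k\<in>S. nrm F (f k))"
proof (induction S rule: infinite_finite_induct)
  case (insert k S)
  then show ?case using nrm_add[of "f k" "\<Oplus>k\<in>S. f k"] by (simp add: sum_insert)
qed (simp_all add: finsum_infinite)

subsection \<open>Hilbert modules of finite rank\<close>

definition ip :: "'k set \<Rightarrow> ('k \<Rightarrow> 'a) \<Rightarrow> ('k \<Rightarrow> 'a) \<Rightarrow> 'a" where
  "ip S v w = (\<Oplus>k\<in>S. star F (v k) \<otimes> w k)"

definition vnorm :: "'k set \<Rightarrow> ('k \<Rightarrow> 'a) \<Rightarrow> real" where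
  "vnorm S v = sqrt (nrm F (ip S v v))"

abbreviation vec :: "('k \<Rightarrow> 'a) \<Rightarrow> bool" where "vec v \<equiv> \<forall>k. v k \<in> carrier F"

lemma ip_closed [simp]: "\<lbrakk>vec v; vec w\<rbrakk> \<Longrightarrow> ip S v w \<in> carrier F"
  by (simp add: ip_def)

lemma ip_cong:
  "\<lbrakk>\<And>k. k \<in> S \<Longrightarrow> v k = v' k; \<And>k. k \<in> S \<Longrightarrow> w k = w' k; vec v'; vec w'\<rbrakk> \<Longrightarrow> ip S v w = ip S v' w'"
  unfolding ip_def by (rule sum_cong) simp_all

lemma ip_add_right: "\<lbrakk>vec u; vec v; vec w\<rbrakk> \<Longrightarrow> ip S u (\<lambda>k. v k \<oplus> w k) = ip S u v \<oplus> ip S u w"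
  by (simp add: ip_def r_distr sum_add)

lemma ip_add_left: "\<lbrakk>vec u; vec v; vec w\<rbrakk> \<Longrightarrow> ip S (\<lambda>k. v k \<oplus> w k) u = ip S v u \<oplus> ip S w u"
  by (simp add: ip_def l_distr star_add sum_add)

lemma ip_mult_right: "\<lbrakk>vec v; vec w; a \<in> carrier F\<rbrakk> \<Longrightarrow> ip S v (\<lambda>k. w k \<otimes> a) = ip S v w \<otimes> a"
  by (simp add: ip_def sum_mult_right m_assoc)

lemma ip_mult_left: "\<lbrakk>vec v; vec w; a \<in> carrier F\<rbrakk> \<Longrightarrow> ip S (\<lambda>k. v k \<otimes> a) w = star F a \<otimes> ip S v w"
  by (simp add: ip_def sum_mult_left star_mult m_assoc)

lemma ip_star: "\<lbrakk>vec v; vec w\<rbrakk> \<Longrightarrow> star F (ip S v w) = ip S w v"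
  by (simp add: ip_def sum_star star_mult)

lemma ip_pos [simp]: "vec v \<Longrightarrow> ip S v v \<in> pos"
  unfolding ip_def by (rule sum_pos) simp_all

lemma vnorm_nonneg [simp]: "vec v \<Longrightarrow> 0 \<le> vnorm S v"
  by (simp add: vnorm_def nrm_nonneg)

lemma vnorm_square: "vec v \<Longrightarrow> (vnorm S v)\<^sup>2 = nrm F (ip S v v)"
  by (simp add: vnorm_def nrm_nonneg)

lemma vnorm_cong: "\<lbrakk>\<And>k. k \<in> S \<Longrightarrow> v k = v' k; vec v'\<rbrakk> \<Longrightarrow> vnorm S v = vnorm S v'"
  unfolding vnorm_def using ip_cong[of S v v' v v'] by simp

lemma Cauchy_Schwarz_scaled:
  assumes v: "vec v" and w: "vec w" and M: "0 < M" "nrm F (ip S v v) \<le> M"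
  shows "(nrm F (ip S v w))\<^sup>2 \<le> M * nrm F (ip S w w)"
proof -
  define a where "a = ip S v w"
  define r where "r = complex_of_real (1 / M)"
  define b where "b = (- r) \<odot> a"
  have ac: "a \<in> carrier F" using v w by (simp add: a_def)
  have bc: "b \<in> carrier F" using ac by (simp add: b_def)
  let ?u = "\<lambda>k. w k \<oplus> v k \<otimes> b"
  define p where "p = star F a \<otimes> a"
  have pc: "p \<in> carrier F" using ac by (simp add: p_def)
  define x where "x = star F b \<otimes> ip S v v \<otimes> b"
  have xc: "x \<in> carrier F" using bc v by (simp add: x_def)
  have sb: "star F b = (- r) \<odot> star F a" using ac by (simp add: b_def r_def star_smult)
  have bb: "star F b \<otimes> b = (r * r) \<odot> p"
    using ac by (simp add: sb p_def) (simp add: b_def smult_mult_left smult_mult_right flip: smult_smult)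
  have ab: "star F a \<otimes> b = \<ominus> (r \<odot> p)" "star F b \<otimes> a = \<ominus> (r \<odot> p)"
    unfolding sb using ac by (simp_all add: b_def p_def smult_mult_left smult_mult_right smult_minus_left l_minus r_minus)
  have wv: "ip S w v = star F a" using v w by (simp add: a_def ip_star)
  have "ip S ?u ?u = ip S w w \<oplus> ip S w v \<otimes> b \<oplus> (star F b \<otimes> ip S v w \<oplus> star F b \<otimes> ip S v v \<otimes> b)"
    using v w bc by (simp add: ip_add_left ip_add_right ip_mult_left ip_mult_right r_distr m_assoc)
  also have "\<dots> = ip S w w \<ominus> r \<odot> p \<oplus> (x \<ominus> r \<odot> p)"
    using ip_closed[OF w w] smult_closed[OF pc] xc unfolding wv x_def[symmetric] a_def[symmetric] ab 
    by (simp add: minus_eq a_ac)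
  finally have 1: "ip S ?u ?u = ip S w w \<ominus> r \<odot> p \<oplus> (x \<ominus> r \<odot> p)" .
  have rM: "complex_of_real M * (r * r) = r" using M by (simp add: r_def)
  have "complex_of_real M \<odot> (star F b \<otimes> b) \<ominus> x \<in> pos"
    unfolding x_def using conj_scal_diff_pos[OF _ M(2) bc] v by simp
  also have "complex_of_real M \<odot> (star F b \<otimes> b) = r \<odot> p"
    unfolding bb using pc by (simp only: smult_smult[symmetric] rM)
  finally have 2: "r \<odot> p \<ominus> x \<in> pos" .
  have "ip S ?u ?u \<in> pos" using v w bc by simp
  from pos_add[OF this 2] have "ip S w w \<ominus> r \<odot> p \<oplus> (x \<ominus> r \<odot> p) \<oplus> (r \<odot> p \<ominus> x) \<in> pos"
    unfolding 1 .
  also have "ip S w w \<ominus> r \<odot> p \<oplus> (x \<ominus> r \<odot> p) \<oplus> (r \<odot> p \<ominus> x) = ip S w w \<ominus> r \<odot> p"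
    using ip_closed[OF w w, of S] smult_closed[OF pc, of r] xc by algebra
  finally have 3: "ip S w w \<ominus> r \<odot> p \<in> pos" .
  have "r \<odot> p \<in> pos" unfolding r_def using ac M by (intro pos_smult) (simp_all add: p_def)
  from nrm_mono[OF this _ 3] have "nrm F (r \<odot> p) \<le> nrm F (ip S w w)" using w by simp
  moreover have "nrm F (r \<odot> p) = (nrm F a)\<^sup>2 / M"
    using pc M cstar_identity[OF ac] by (simp add: nrm_smult r_def norm_divide p_def)
  ultimately show ?thesis using M by (simp add: a_def field_simps)
qed

lemma Cauchy_Schwarz:
  assumes v: "vec v" and w: "vec w"
  shows "nrm F (ip S v w) \<le> vnorm S v * vnorm S w"
proof -
  have "(nrm F (ip S v w))\<^sup>2 \<le> (nrm F (ip S v v) + e) * nrm F (ip S w w)" if "0 < e" for e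
    using Cauchy_Schwarz_scaled[OF v w, of "nrm F (ip S v v) + e" S] that nrm_nonneg[of "ip S v v"] v by simp
  moreover have "((\<lambda>e. (nrm F (ip S v v) + e) * nrm F (ip S w w)) \<longlongrightarrow> (nrm F (ip S v v) + 0) * nrm F (ip S w w)) (at_right 0)"
    by (intro tendsto_intros)
  ultimately have "(nrm F (ip S v w))\<^sup>2 \<le> (nrm F (ip S v v) + 0) * nrm F (ip S w w)"
    by (intro tendsto_lowerbound[of _ _ "at_right 0"]) (auto simp: eventually_at_right_less intro!: eventually_at_rightI[of 0 1])
  then have "(nrm F (ip S v w))\<^sup>2 \<le> (vnorm S v * vnorm S w)\<^sup>2"
    using v w by (simp add: power_mult_distrib vnorm_square)
  then show ?thesis by (rule power2_le_imp_le) (use v w in simp)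
qed

lemma vnorm_add:
  assumes v: "vec v" and w: "vec w" shows "vnorm S (\<lambda>k. v k \<oplus> w k) \<le> vnorm S v + vnorm S w"
proof -
  have "(vnorm S (\<lambda>k. v k \<oplus> w k))\<^sup>2 = nrm F (ip S v v \<oplus> ip S v w \<oplus> (ip S w v \<oplus> ip S w w))"
    using v w by (simp add: vnorm_square ip_add_left ip_add_right)
  also have "\<dots> \<le> (nrm F (ip S v v) + nrm F (ip S v w)) + (nrm F (ip S w v) + nrm F (ip S w w))"
    using v w by (intro order_trans[OF nrm_add] add_mono nrm_add) simp_all
  also have "\<dots> \<le> ((vnorm S v)\<^sup>2 + vnorm S v * vnorm S w) + (vnorm S w * vnorm S v + (vnorm S w)\<^sup>2)"
    using v w by (intro add_mono Cauchy_Schwarz) (simp_all add: vnorm_square)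
  also have "\<dots> = (vnorm S v + vnorm S w)\<^sup>2" by (simp add: power2_sum)
  finally show ?thesis by (rule power2_le_imp_le) (use v w in simp)
qed

lemma vnorm_smult: "vec v \<Longrightarrow> vnorm S (\<lambda>k. c \<odot> v k) = cmod c * vnorm S v"
proof -
  assume v: "vec v"
  have "ip S (\<lambda>k. c \<odot> v k) (\<lambda>k. c \<odot> v k) = (cnj c * c) \<odot> ip S v v"
    using v by (simp add: ip_def sum_smult star_smult smult_mult_left smult_mult_right mult.commute flip: smult_smult)
  then show ?thesis
    using v by (simp add: vnorm_def nrm_smult real_sqrt_mult norm_mult)
qed

lemma nrm_le_vnorm: assumes "finite S" "k \<in> S" and v: "vec v" shows "nrm F (v k) \<le> vnorm S v"
proof -
  let ?f = "\<lambda>k. star F (v k) \<otimes> v k"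
  have "ip S v v = ?f k \<oplus> (\<Oplus>k\<in>S - {k}. ?f k)"
    using sum_insert[of "S - {k}" k ?f] assms by (simp add: ip_def insert_absorb)
  moreover have "?f k \<oplus> (\<Oplus>k\<in>S - {k}. ?f k) \<ominus> ?f k = (\<Oplus>k\<in>S - {k}. ?f k)"
  proof -
    have "x \<oplus> y \<ominus> x = y" if "x \<in> carrier F" "y \<in> carrier F" for x y
      using that by algebra
    then show ?thesis using v by simp
  qed
  moreover have "(\<Oplus>k\<in>S - {k}. ?f k) \<in> pos" using v by (intro sum_pos) simp_all
  ultimately have "nrm F (?f k) \<le> nrm F (ip S v v)"
    using v by (intro nrm_mono) simp_all
  then have "(nrm F (v k))\<^sup>2 \<le> (vnorm S v)\<^sup>2"
    using cstar_identity[of "v k"] v by (simp add: vnorm_square)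
  then show ?thesis by (rule power2_le_imp_le) (use v in simp)
qed

lemma vnorm_le_sum: assumes "finite S" and v: "vec v" shows "vnorm S v \<le> (\<Sum>k\<in>S. nrm F (v k))"
proof -
  note [simp] = nrm_nonneg
  have "(vnorm S v)\<^sup>2 \<le> (\<Sum>k\<in>S. nrm F (star F (v k) \<otimes> v k))"
    unfolding vnorm_square[OF v] unfolding ip_def using v by (intro sum_nrm) simp
  also have "\<dots> = (\<Sum>k\<in>S. nrm F (v k) * nrm F (v k))"
    using cstar_identity v by (simp add: power2_eq_square)
  also have "\<dots> \<le> (\<Sum>k\<in>S. nrm F (v k) * (\<Sum>k\<in>S. nrm F (v k)))"
    using v assms(1) by (intro sum_mono mult_left_mono member_le_sum) simp_all
  also have "\<dots> = (\<Sum>k\<in>S. nrm F (v k))\<^sup>2"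
    by (simp add: power2_eq_square sum_distrib_right)
  finally show ?thesis by (rule power2_le_imp_le) (use v in \<open>simp add: sum_nonneg\<close>)
qed

end

subsection \<open>C*-algebras of block diagonal matrices\<close>

text \<open>The index set is partitioned into finite blocks, \<open>K i\<close> being the block of \<open>i\<close>, or empty if
  \<open>i\<close> is not used as an index at all. The norm is the operator norm on the Hilbert modules
  belonging to the blocks. One finite block gives matrix algebras, infinitely many blocks give
  products of matrix algebras.\<close>

context cstar_algebra begin

definition act :: "('i \<Rightarrow> 'i set) \<Rightarrow> ('i \<Rightarrow> 'i \<Rightarrow> 'a) \<Rightarrow> ('i \<Rightarrow> 'a) \<Rightarrow> 'i \<Rightarrow> 'a" where
  "act K X v i = (\<Oplus>k\<in>K i. X i k \<otimes> v k)"

definition op_bound :: "('i \<Rightarrow> 'i set) \<Rightarrow> ('i \<Rightarrow> 'i \<Rightarrow> 'a) \<Rightarrow> real \<Rightarrow> bool" where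
  "op_bound K X M \<longleftrightarrow> 0 \<le> M \<and> (\<forall>i v. vec v \<longrightarrow> vnorm (K i) (act K X v) \<le> M * vnorm (K i) v)"

definition block_matrices :: "('i \<Rightarrow> 'i set) \<Rightarrow> ('i \<Rightarrow> 'i \<Rightarrow> 'a) cstar" where
  "block_matrices K =
    \<lparr>carrier = {X. (\<forall>i j. X i j \<in> carrier F) \<and> (\<forall>i j. j \<notin> K i \<longrightarrow> X i j = \<zero>) \<and> (\<exists>M. op_bound K X M)},
     mult = (\<lambda>X Y i j. act K X (\<lambda>k. Y k j) i),
     one = (\<lambda>i j. if j = i \<and> i \<in> K i then \<one> else \<zero>),
     zero = (\<lambda>_ _. \<zero>),
     add = (\<lambda>X Y i j. X i j \<oplus> Y i j),
     smult = (\<lambda>c X i j. c \<odot> X i j),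
     star = (\<lambda>X i j. star F (X j i)),
     nrm = (\<lambda>X. Inf {M. op_bound K X M})\<rparr>"

end

locale cstar_blocks = cstar_algebra F for F :: "'a cstar" (structure) +
  fixes K :: "'i \<Rightarrow> 'i set"
  assumes finite_block [simp]: "finite (K i)"
    and block_eq: "j \<in> K i \<Longrightarrow> K j = K i"
    and block_refl: "j \<in> K i \<Longrightarrow> i \<in> K i"
begin

lemma block_sym: "i \<in> K j \<Longrightarrow> j \<in> K i"
  using block_eq block_refl by blast

abbreviation BM :: "('i \<Rightarrow> 'i \<Rightarrow> 'a) cstar" where "BM \<equiv> block_matrices K"

abbreviation mat :: "('i \<Rightarrow> 'i \<Rightarrow> 'a) \<Rightarrow> bool" where "mat X \<equiv> \<forall>i j. X i j \<in> carrier F"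

abbreviation adj :: "('i \<Rightarrow> 'i \<Rightarrow> 'a) \<Rightarrow> 'i \<Rightarrow> 'i \<Rightarrow> 'a" where "adj X \<equiv> (\<lambda>i j. star F (X j i))"

lemma BM_sel [simp]:
  "mult BM X Y = (\<lambda>i j. act K X (\<lambda>k. Y k j) i)"
  "one BM = (\<lambda>i j. if j = i \<and> i \<in> K i then \<one> else \<zero>)"
  "zero BM = (\<lambda>_ _. \<zero>)"
  "add BM X Y = (\<lambda>i j. X i j \<oplus> Y i j)"
  "smult BM c X = (\<lambda>i j. c \<odot> X i j)"
  "star BM X = adj X"
  by (simp_all add: block_matrices_def)

lemma nrm_BM: "nrm BM X = Inf {M. op_bound K X M}"
  by (simp add: block_matrices_def)

lemma BM_carrier:
  "X \<in> carrier BM \<longleftrightarrow> mat X \<and> (\<forall>i j. j \<notin> K i \<longrightarrow> X i j = \<zero>) \<and> (\<exists>M. op_bound K X M)"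
  by (simp add: block_matrices_def)

lemma BM_mat [simp]: "X \<in> carrier BM \<Longrightarrow> X i j \<in> carrier F"
  by (simp add: BM_carrier)

lemma BM_outside: "X \<in> carrier BM \<Longrightarrow> j \<notin> K i \<Longrightarrow> X i j = \<zero>"
  by (simp add: BM_carrier)

lemma BM_carrierI:
  "\<lbrakk>mat X; \<And>i j. j \<notin> K i \<Longrightarrow> X i j = \<zero>; op_bound K X M\<rbrakk> \<Longrightarrow> X \<in> carrier BM"
  by (auto simp: BM_carrier)

lemma act_closed [simp]: "\<lbrakk>mat X; vec v\<rbrakk> \<Longrightarrow> act K X v i \<in> carrier F"
  by (simp add: act_def)

lemma act_add: "\<lbrakk>mat X; mat Y; vec v\<rbrakk> \<Longrightarrow> act K (\<lambda>i j. X i j \<oplus> Y i j) v = (\<lambda>i. act K X v i \<oplus> act K Y v i)"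
  by (simp add: act_def l_distr sum_add fun_eq_iff)

lemma act_smult: "\<lbrakk>mat X; vec v\<rbrakk> \<Longrightarrow> act K (\<lambda>i j. c \<odot> X i j) v = (\<lambda>i. c \<odot> act K X v i)"
  by (simp add: act_def smult_mult_left sum_smult fun_eq_iff)

lemma act_mult:
  assumes X: "mat X" and Y: "mat Y" and v: "vec v"
  shows "act K (\<lambda>i j. act K X (\<lambda>k. Y k j) i) v = act K X (act K Y v)"
proof
  fix i
  have "act K (\<lambda>i j. act K X (\<lambda>k. Y k j) i) v i = (\<Oplus>j\<in>K i. \<Oplus>k\<in>K i. X i k \<otimes> (Y k j \<otimes> v j))"
    using X Y v by (simp add: act_def sum_mult_right m_assoc)
  also have "\<dots> = (\<Oplus>k\<in>K i. \<Oplus>j\<in>K i. X i k \<otimes> (Y k j \<otimes> v j))"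
    using X Y v by (intro sum_swap) simp_all
  also have "\<dots> = (\<Oplus>k\<in>K i. X i k \<otimes> act K Y v k)"
    using X Y v by (intro sum_cong) (simp_all add: act_def sum_mult_left block_eq)
  finally show "act K (\<lambda>i j. act K X (\<lambda>k. Y k j) i) v i = act K X (act K Y v) i"
    by (simp add: act_def)
qed

lemma act_one: assumes "vec v" "i \<in> K i" shows "act K (\<one>\<^bsub>BM\<^esub>) v i = v i"
proof -
  have "act K (\<one>\<^bsub>BM\<^esub>) v i = (\<Oplus>k\<in>K i. if k = i then v k else \<zero>)"
    unfolding act_def using assms by (intro sum_cong) auto
  then show ?thesis using assms sum_delta[of "K i" i v] by simp
qed

lemma ip_act:
  assumes X: "mat X" and v: "vec v" and w: "vec w"
  shows "ip (K i) v (act K X w) = ip (K i) (act K (adj X) v) w"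
proof -
  have "ip (K i) v (act K X w) = (\<Oplus>k\<in>K i. \<Oplus>l\<in>K i. star F (v k) \<otimes> (X k l \<otimes> w l))"
    unfolding ip_def using assms by (intro sum_cong) (simp_all add: act_def sum_mult_left block_eq)
  also have "\<dots> = (\<Oplus>l\<in>K i. \<Oplus>k\<in>K i. star F (v k) \<otimes> (X k l \<otimes> w l))"
    using assms by (intro sum_swap) simp_all
  also have "\<dots> = ip (K i) (act K (adj X) v) w"
    unfolding ip_def using assms
    by (intro sum_cong) (simp_all add: act_def sum_mult_right sum_star star_mult block_eq m_assoc)
  finally show ?thesis .
qed

lemma op_boundD: "\<lbrakk>op_bound K X M; vec v\<rbrakk> \<Longrightarrow> vnorm (K i) (act K X v) \<le> M * vnorm (K i) v"
  and op_bound_nonneg: "op_bound K X M \<Longrightarrow> 0 \<le> M"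
  by (auto simp: op_bound_def)

lemma op_bound_add:
  assumes "mat X" "mat Y" "op_bound K X M" "op_bound K Y N"
  shows "op_bound K (\<lambda>i j. X i j \<oplus> Y i j) (M + N)"
  unfolding op_bound_def
proof (intro conjI allI impI)
  fix i v assume v: "vec (v :: 'i \<Rightarrow> 'a)"
  have "vnorm (K i) (act K (\<lambda>i j. X i j \<oplus> Y i j) v) \<le> vnorm (K i) (act K X v) + vnorm (K i) (act K Y v)"
    unfolding act_add[OF assms(1,2) v] using assms v by (intro vnorm_add) simp_all
  then show "vnorm (K i) (act K (\<lambda>i j. X i j \<oplus> Y i j) v) \<le> (M + N) * vnorm (K i) v"
    using op_boundD[OF assms(3) v, of i] op_boundD[OF assms(4) v, of i] by (simp add: distrib_right)
qed (use assms op_bound_nonneg in auto)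

lemma op_bound_smult:
  assumes "mat X" "op_bound K X M" shows "op_bound K (\<lambda>i j. c \<odot> X i j) (cmod c * M)"
  unfolding op_bound_def
proof (intro conjI allI impI)
  fix i v assume v: "vec (v :: 'i \<Rightarrow> 'a)"
  have "vnorm (K i) (act K (\<lambda>i j. c \<odot> X i j) v) = cmod c * vnorm (K i) (act K X v)"
    unfolding act_smult[OF assms(1) v] using assms v by (intro vnorm_smult) simp
  then show "vnorm (K i) (act K (\<lambda>i j. c \<odot> X i j) v) \<le> cmod c * M * vnorm (K i) v"
    using op_boundD[OF assms(2) v, of i] by (simp add: mult_left_mono mult.assoc)
qed (use assms op_bound_nonneg in auto)

lemma op_bound_mult:
  assumes "mat X" "mat Y" "op_bound K X M" "op_bound K Y N"
  shows "op_bound K (\<lambda>i j. act K X (\<lambda>k. Y k j) i) (M * N)"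
  unfolding op_bound_def
proof (intro conjI allI impI)
  fix i v assume v: "vec (v :: 'i \<Rightarrow> 'a)"
  have "vnorm (K i) (act K X (act K Y v)) \<le> M * vnorm (K i) (act K Y v)"
    using assms v by (intro op_boundD) simp_all
  also have "\<dots> \<le> M * (N * vnorm (K i) v)"
    using op_boundD[OF assms(4) v] op_bound_nonneg[OF assms(3)] by (rule mult_left_mono)
  finally show "vnorm (K i) (act K (\<lambda>i j. act K X (\<lambda>k. Y k j) i) v) \<le> M * N * vnorm (K i) v"
    by (simp add: act_mult assms v mult.assoc)
qed (use assms op_bound_nonneg in auto)

lemma op_bound_adj:
  assumes X: "mat X" and M: "op_bound K X M" shows "op_bound K (adj X) M"
  unfolding op_bound_def
proof (intro conjI allI impI)
  fix i v assume v: "vec (v :: 'i \<Rightarrow> 'a)"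
  let ?w = "act K (adj X) v"
  have w: "vec ?w" using X v by simp
  have "(vnorm (K i) ?w)\<^sup>2 = nrm F (ip (K i) v (act K X ?w))"
    using ip_act[OF X v w, of i] w by (simp add: vnorm_square)
  also have "\<dots> \<le> vnorm (K i) v * vnorm (K i) (act K X ?w)"
    using X v w by (intro Cauchy_Schwarz) simp_all
  also have "\<dots> \<le> vnorm (K i) v * (M * vnorm (K i) ?w)"
    using v w by (intro mult_left_mono op_boundD[OF M]) simp_all
  finally have "vnorm (K i) ?w * vnorm (K i) ?w \<le> M * vnorm (K i) v * vnorm (K i) ?w"
    by (simp add: power2_eq_square mult_ac)
  then show "vnorm (K i) ?w \<le> M * vnorm (K i) v"
    using vnorm_nonneg[OF w, of "K i"] vnorm_nonneg[OF v, of "K i"] op_bound_nonneg[OF M]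
    by (cases "vnorm (K i) ?w = 0") (simp_all add: mult_le_cancel_right)
qed (use M op_bound_nonneg in auto)

lemma op_bound_nrm: assumes X: "X \<in> carrier BM" shows "op_bound K X (nrm BM X)"
proof -
  obtain M where M: "op_bound K X M" using X by (auto simp: BM_carrier)
  have ne: "{M. op_bound K X M} \<noteq> {}" using M by auto
  have nonneg: "0 \<le> nrm BM X"
    unfolding nrm_BM using op_bound_nonneg by (intro cInf_greatest ne) auto
  show ?thesis unfolding op_bound_def
  proof (intro conjI allI impI nonneg)
    fix i v assume v: "vec (v :: 'i \<Rightarrow> 'a)"
    show "vnorm (K i) (act K X v) \<le> nrm BM X * vnorm (K i) v"
    proof (cases "vnorm (K i) v = 0")
      case True
      then show ?thesis using op_boundD[OF M v, of i] by simp
    next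
      case False
      then have pos: "0 < vnorm (K i) v" using vnorm_nonneg[OF v, of "K i"] by linarith
      have "vnorm (K i) (act K X v) / vnorm (K i) v \<le> nrm BM X"
        unfolding nrm_BM using pos op_boundD[OF _ v, of X _ i]
        by (intro cInf_greatest ne) (simp add: divide_le_eq)
      then show ?thesis using pos by (simp add: divide_le_eq)
    qed
  qed
qed

lemma nrm_BM_le: "op_bound K X M \<Longrightarrow> nrm BM X \<le> M"
  unfolding nrm_BM using op_bound_nonneg by (intro cInf_lower) (auto intro!: bdd_belowI[of _ 0])

lemma op_bound_entries:
  assumes X: "mat X" and M: "op_bound K X M" and j: "j \<in> K i" shows "nrm F (X i j) \<le> M"
proof -
  define e where "e = (\<lambda>k. if k = j then \<one> else \<zero>)"
  have e: "vec e" by (simp add: e_def)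
  have i: "i \<in> K i" using j by (rule block_refl)
  have "act K X e i = (\<Oplus>k\<in>K i. if k = j then X i k else \<zero>)"
    unfolding act_def using X by (intro sum_cong) (simp_all add: e_def)
  also have "\<dots> = X i j" using X j by (intro sum_delta) simp_all
  finally have le: "nrm F (X i j) \<le> M * vnorm (K i) e"
    using nrm_le_vnorm[of "K i" i "act K X e"] X e i op_boundD[OF M e, of i] by simp
  have "vnorm (K i) e \<le> 1"
  proof -
    have "ip (K i) e e = (\<Oplus>k\<in>K i. if k = j then \<one> else \<zero>)"
      unfolding ip_def by (intro sum_cong) (simp_all add: e_def)
    also have "\<dots> = \<one>" using j by (intro sum_delta) simp_all
    finally show ?thesis using nrm_one_le by (simp add: vnorm_def)
  qed
  from mult_left_mono[OF this op_bound_nonneg[OF M]] le show ?thesis by simp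
qed

lemma op_bound_zero: "op_bound K (\<lambda>_ _. \<zero>) 0"
  by (simp add: op_bound_def act_def vnorm_def ip_def)

lemma op_bound_one: "op_bound K (\<one>\<^bsub>BM\<^esub>) 1"
  unfolding op_bound_def
proof (intro conjI allI impI)
  fix i v assume v: "vec (v :: 'i \<Rightarrow> 'a)"
  have "vnorm (K i) (act K (\<one>\<^bsub>BM\<^esub>) v) = vnorm (K i) v"
    using v block_eq by (intro vnorm_cong act_one) auto
  then show "vnorm (K i) (act K (\<one>\<^bsub>BM\<^esub>) v) \<le> 1 * vnorm (K i) v" by simp
qed simp

lemma BM_add_closed: "\<lbrakk>X \<in> carrier BM; Y \<in> carrier BM\<rbrakk> \<Longrightarrow> X \<oplus>\<^bsub>BM\<^esub> Y \<in> carrier BM"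
  unfolding BM_sel by (rule BM_carrierI[OF _ _ op_bound_add[OF _ _ op_bound_nrm op_bound_nrm]]) (simp_all add: BM_outside)

lemma BM_smult_closed: "X \<in> carrier BM \<Longrightarrow> c \<odot>\<^bsub>BM\<^esub> X \<in> carrier BM"
  unfolding BM_sel by (rule BM_carrierI[OF _ _ op_bound_smult[OF _ op_bound_nrm]]) (simp_all add: BM_outside)

lemma BM_star_closed: assumes "X \<in> carrier BM" shows "star BM X \<in> carrier BM"
proof -
  have "X j i = \<zero>" if "j \<notin> K i" for i j
    using BM_outside[OF assms] block_sym that by blast
  then show ?thesis
    unfolding BM_sel using assms by (intro BM_carrierI[OF _ _ op_bound_adj[OF _ op_bound_nrm]]) simp_all
qed

lemma BM_mult_closed: assumes "X \<in> carrier BM" "Y \<in> carrier BM" shows "X \<otimes>\<^bsub>BM\<^esub> Y \<in> carrier BM"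
proof -
  have "act K X (\<lambda>k. Y k j) i = \<zero>" if "j \<notin> K i" for i j
  proof -
    have "act K X (\<lambda>k. Y k j) i = (\<Oplus>k\<in>K i. \<zero>)"
      unfolding act_def using assms that by (intro sum_cong) (simp_all add: BM_outside block_eq)
    then show ?thesis by simp
  qed
  then show ?thesis unfolding BM_sel using assms
    by (intro BM_carrierI[OF _ _ op_bound_mult[OF _ _ op_bound_nrm op_bound_nrm]]) simp_all
qed

lemma BM_one_closed: "\<one>\<^bsub>BM\<^esub> \<in> carrier BM"
  by (rule BM_carrierI[OF _ _ op_bound_one]) auto

lemma BM_zero_closed: "\<zero>\<^bsub>BM\<^esub> \<in> carrier BM"
  using op_bound_zero by (auto simp: BM_carrier)

lemma BM_ring: "ring BM"
proof (intro ringI abelian_groupI monoidI)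
  fix X assume X: "X \<in> carrier BM"
  show "\<exists>Y\<in>carrier BM. Y \<oplus>\<^bsub>BM\<^esub> X = \<zero>\<^bsub>BM\<^esub>"
    using X BM_smult_closed[OF X, of "-1"]
    by (intro bexI[of _ "(-1) \<odot>\<^bsub>BM\<^esub> X"]) (simp_all add: smult_minus_one l_neg fun_eq_iff)
  show "\<one>\<^bsub>BM\<^esub> \<otimes>\<^bsub>BM\<^esub> X = X"
  proof (intro ext)
    fix i j
    show "(\<one>\<^bsub>BM\<^esub> \<otimes>\<^bsub>BM\<^esub> X) i j = X i j"
    proof (cases "i \<in> K i")
      case True
      then show ?thesis using act_one[of "\<lambda>k. X k j" i] X by simp
    next
      case False
      then have "K i = {}" using block_refl by auto
      then show ?thesis using BM_outside[OF X, of j i] by (simp add: act_def)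
    qed
  qed
  show "X \<otimes>\<^bsub>BM\<^esub> \<one>\<^bsub>BM\<^esub> = X"
  proof (intro ext)
    fix i j
    have "(X \<otimes>\<^bsub>BM\<^esub> \<one>\<^bsub>BM\<^esub>) i j = (\<Oplus>k\<in>K i. if k = j then X i k else \<zero>)"
      using X block_eq by (auto simp: act_def intro!: sum_cong)
    also have "\<dots> = X i j"
    proof (cases "j \<in> K i")
      case True
      then show ?thesis using X by (intro sum_delta) simp_all
    next
      case False
      then have "(\<Oplus>k\<in>K i. if k = j then X i k else \<zero>) = (\<Oplus>k\<in>K i. \<zero>)"
        by (intro sum_cong) auto
      then show ?thesis using BM_outside[OF X False] by simp
    qed
    finally show "(X \<otimes>\<^bsub>BM\<^esub> \<one>\<^bsub>BM\<^esub>) i j = X i j" .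
  qed
next
  fix X Y Z assume X: "X \<in> carrier BM" and Y: "Y \<in> carrier BM" and Z: "Z \<in> carrier BM"
  show "X \<otimes>\<^bsub>BM\<^esub> Y \<otimes>\<^bsub>BM\<^esub> Z = X \<otimes>\<^bsub>BM\<^esub> (Y \<otimes>\<^bsub>BM\<^esub> Z)"
    using X Y Z by (simp add: act_mult)
  show "(X \<oplus>\<^bsub>BM\<^esub> Y) \<otimes>\<^bsub>BM\<^esub> Z = X \<otimes>\<^bsub>BM\<^esub> Z \<oplus>\<^bsub>BM\<^esub> Y \<otimes>\<^bsub>BM\<^esub> Z"
    using X Y Z by (simp add: act_add)
  show "Z \<otimes>\<^bsub>BM\<^esub> (X \<oplus>\<^bsub>BM\<^esub> Y) = Z \<otimes>\<^bsub>BM\<^esub> X \<oplus>\<^bsub>BM\<^esub> Z \<otimes>\<^bsub>BM\<^esub> Y"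
    using X Y Z by (simp add: act_def r_distr sum_add fun_eq_iff)
qed (use BM_add_closed BM_mult_closed BM_one_closed BM_zero_closed in \<open>simp_all add: a_ac\<close>)

lemma BM_a_minus:
  assumes "X \<in> carrier BM" "Y \<in> carrier BM" shows "X \<ominus>\<^bsub>BM\<^esub> Y = (\<lambda>i j. X i j \<ominus> Y i j)"
proof -
  interpret BM: ring BM by (rule BM_ring)
  have "\<ominus>\<^bsub>BM\<^esub> Y = (-1) \<odot>\<^bsub>BM\<^esub> Y"
    using assms(2) BM_smult_closed[OF assms(2), of "-1"]
    by (intro BM.minus_equality) (simp_all add: smult_minus_one l_neg)
  then show ?thesis
    using assms by (simp add: BM.minus_eq minus_eq smult_minus_one)
qed

lemma op_bound_limit:
  assumes D: "\<And>n. mat (D n)" and L: "mat L" and b: "\<And>n. N \<le> n \<Longrightarrow> op_bound K (D n) M"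
    and lim: "\<And>i j. (\<lambda>n. nrm F (L i j \<ominus> D n i j)) \<longlonglongrightarrow> 0"
  shows "op_bound K L M"
  unfolding op_bound_def
proof (intro conjI allI impI)
  fix i v assume v: "vec (v :: 'i \<Rightarrow> 'a)"
  have eq: "act K L v k = act K (D n) v k \<oplus> act K (\<lambda>i j. L i j \<ominus> D n i j) v k" for n k
  proof -
    have "x \<oplus> (y \<ominus> x) = y" if "x \<in> carrier F" "y \<in> carrier F" for x y
      using that by algebra
    then have "L = (\<lambda>i j. D n i j \<oplus> (L i j \<ominus> D n i j))"
      using D L by (simp add: fun_eq_iff)
    then have "act K L v = act K (\<lambda>i j. D n i j \<oplus> (L i j \<ominus> D n i j)) v" by simp
    then show ?thesis using act_add[OF D _ v, of "\<lambda>i j. L i j \<ominus> D n i j" n] D L by simp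
  qed
  let ?r = "\<lambda>n. \<Sum>k\<in>K i. \<Sum>l\<in>K k. nrm F (L k l \<ominus> D n k l) * nrm F (v l)"
  have "vnorm (K i) (act K L v) \<le> M * vnorm (K i) v + ?r n" if n: "N \<le> n" for n
  proof -
    let ?R = "\<lambda>i j. L i j \<ominus> D n i j"
    have R: "mat ?R" using D L by simp
    have "vnorm (K i) (act K L v) \<le> vnorm (K i) (act K (D n) v) + vnorm (K i) (act K ?R v)"
      using vnorm_add[of "act K (D n) v" "act K ?R v" "K i"] D R v by (simp add: eq[of _ n, abs_def, symmetric])
    moreover have "vnorm (K i) (act K ?R v) \<le> ?r n"
    proof -
      have "vnorm (K i) (act K ?R v) \<le> (\<Sum>k\<in>K i. nrm F (act K ?R v k))"
        using R v by (intro vnorm_le_sum) simp_all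
      also have "\<dots> \<le> (\<Sum>k\<in>K i. \<Sum>l\<in>K k. nrm F (?R k l \<otimes> v l))"
        unfolding act_def using R v by (intro sum_mono sum_nrm) simp
      also have "\<dots> \<le> ?r n" using R v by (intro sum_mono nrm_mult) simp_all
      finally show ?thesis .
    qed
    ultimately show ?thesis using op_boundD[OF b[OF n] v, of i] by simp
  qed
  moreover have "(\<lambda>n. M * vnorm (K i) v + ?r n) \<longlonglongrightarrow> M * vnorm (K i) v + (\<Sum>k\<in>K i. \<Sum>l\<in>K k. 0 * nrm F (v l))"
    by (intro tendsto_intros lim)
  ultimately show "vnorm (K i) (act K L v) \<le> M * vnorm (K i) v"
    using LIMSEQ_le_const[of "\<lambda>n. M * vnorm (K i) v + ?r n"] by simp blast
qed (use b op_bound_nonneg in blast)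

lemma BM_complete:
  assumes X: "\<And>n. X n \<in> carrier BM"
    and Cauchy: "\<forall>e>0. \<exists>N. \<forall>m\<ge>N. \<forall>n\<ge>N. nrm BM (X m \<ominus>\<^bsub>BM\<^esub> X n) < e"
  shows "\<exists>L\<in>carrier BM. (\<lambda>n. nrm BM (X n \<ominus>\<^bsub>BM\<^esub> L)) \<longlonglongrightarrow> 0"
proof -
  interpret BM: ring BM by (rule BM_ring)
  have Xm: "mat (X n)" for n using X by simp
  have diff: "op_bound K (\<lambda>i j. X m i j \<ominus> X n i j) (nrm BM (X m \<ominus>\<^bsub>BM\<^esub> X n))" for m n
    using op_bound_nrm[of "X m \<ominus>\<^bsub>BM\<^esub> X n"] X BM.minus_closed by (simp add: BM_a_minus)
  have "\<exists>l\<in>carrier F. (\<lambda>n. nrm F (X n i j \<ominus> l)) \<longlonglongrightarrow> 0 \<and> (j \<notin> K i \<longrightarrow> l = \<zero>)" for i j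
  proof (cases "j \<in> K i")
    case True
    have "\<forall>e>0. \<exists>N. \<forall>m\<ge>N. \<forall>n\<ge>N. nrm F (X m i j \<ominus> X n i j) < e"
    proof (intro allI impI)
      fix e :: real assume "e > 0"
      then obtain N where "\<forall>m\<ge>N. \<forall>n\<ge>N. nrm BM (X m \<ominus>\<^bsub>BM\<^esub> X n) < e" using Cauchy by blast
      moreover have "nrm F (X m i j \<ominus> X n i j) \<le> nrm BM (X m \<ominus>\<^bsub>BM\<^esub> X n)" for m n
        using op_bound_entries[OF _ diff True] X by simp
      ultimately show "\<exists>N. \<forall>m\<ge>N. \<forall>n\<ge>N. nrm F (X m i j \<ominus> X n i j) < e"
        by (meson order_le_less_trans)
    qed
    then show ?thesis using complete[of "\<lambda>n. X n i j"] X True by simp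
  next
    case False
    then show ?thesis using X by (intro bexI[of _ \<zero>]) (simp_all add: BM_outside minus_eq)
  qed
  then obtain L where L: "mat L" and lim: "\<And>i j. (\<lambda>n. nrm F (X n i j \<ominus> L i j)) \<longlonglongrightarrow> 0"
    and out: "\<And>i j. j \<notin> K i \<Longrightarrow> L i j = \<zero>"
    by metis
  have tail: "op_bound K (\<lambda>i j. X m i j \<ominus> L i j) e"
    if N: "\<forall>m\<ge>N. \<forall>n\<ge>N. nrm BM (X m \<ominus>\<^bsub>BM\<^esub> X n) < e" and m: "N \<le> m" and e: "0 < e" for N m e
  proof (rule op_bound_limit[where D = "\<lambda>n i j. X m i j \<ominus> X n i j" and N = N])
    fix n assume "N \<le> n"
    then show "op_bound K (\<lambda>i j. X m i j \<ominus> X n i j) e"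
      using diff[of m n] N m e unfolding op_bound_def
      by (meson less_imp_le mult_right_mono order_trans vnorm_nonneg)
  next
    fix i j
    have "(x \<ominus> l) \<ominus> (x \<ominus> y) = y \<ominus> l" if "x \<in> carrier F" "y \<in> carrier F" "l \<in> carrier F" for x y l
      using that by algebra
    then show "(\<lambda>n. nrm F (X m i j \<ominus> L i j \<ominus> (X m i j \<ominus> X n i j))) \<longlonglongrightarrow> 0"
      using lim[of i j] Xm L by simp
  qed (use X L in simp_all)
  obtain N where N: "\<forall>m\<ge>N. \<forall>n\<ge>N. nrm BM (X m \<ominus>\<^bsub>BM\<^esub> X n) < 1"
    using Cauchy zero_less_one by blast
  have Lc: "L \<in> carrier BM"
  proof (rule BM_carrierI[OF L out])
    have "op_bound K (\<lambda>i j. X N i j \<oplus> (-1) \<odot> (X N i j \<ominus> L i j)) (nrm BM (X N) + cmod (-1) * 1)"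
      using X L tail[OF N] by (intro op_bound_add op_bound_smult op_bound_nrm) simp_all
    moreover have "x \<oplus> (-1) \<odot> (x \<ominus> l) = l" if "x \<in> carrier F" "l \<in> carrier F" for x l
    proof -
      have "x \<ominus> (x \<ominus> l) = l" using that by algebra
      then show ?thesis using that by (simp add: smult_minus_one minus_eq)
    qed
    ultimately show "op_bound K L (nrm BM (X N) + cmod (-1) * 1)" using Xm L by simp
  qed
  have "(\<lambda>n. nrm BM (X n \<ominus>\<^bsub>BM\<^esub> L)) \<longlonglongrightarrow> 0"
  proof (rule LIMSEQ_I)
    fix e :: real assume e: "e > 0"
    then obtain N where N: "\<forall>m\<ge>N. \<forall>n\<ge>N. nrm BM (X m \<ominus>\<^bsub>BM\<^esub> X n) < e / 2"
      using Cauchy half_gt_zero by blast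
    have "norm (nrm BM (X n \<ominus>\<^bsub>BM\<^esub> L) - 0) < e" if "N \<le> n" for n
    proof -
      have "nrm BM (X n \<ominus>\<^bsub>BM\<^esub> L) \<le> e / 2"
        using nrm_BM_le[OF tail[OF N that]] e X Lc by (simp add: BM_a_minus)
      moreover have "0 \<le> nrm BM (X n \<ominus>\<^bsub>BM\<^esub> L)"
        using op_bound_nonneg[OF op_bound_nrm[of "X n \<ominus>\<^bsub>BM\<^esub> L"]] X Lc by simp
      ultimately show ?thesis using e by simp
    qed
    then show "\<exists>N. \<forall>n\<ge>N. norm (nrm BM (X n \<ominus>\<^bsub>BM\<^esub> L) - 0) < e" by blast
  qed
  then show ?thesis using Lc by blast
qed

theorem BM_cstar: "cstar_algebra BM"
proof (intro cstar_algebra.intro BM_ring cstar_algebra_axioms.intro)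
  fix X assume X: "X \<in> carrier BM"
  note nonneg = op_bound_nonneg[OF op_bound_nrm]
  show "0 \<le> nrm BM X" by (rule nonneg[OF X])
  show "nrm BM X = 0 \<longleftrightarrow> X = \<zero>\<^bsub>BM\<^esub>"
  proof
    assume "nrm BM X = 0"
    then have "nrm F (X i j) \<le> 0" if "j \<in> K i" for i j
      using op_bound_entries[OF _ op_bound_nrm[OF X] that] X by simp
    then have "X i j = \<zero>" for i j
      using BM_outside[OF X, of j i] nrm_eq_0[of "X i j"] nrm_nonneg[of "X i j"] X
      by (cases "j \<in> K i") (simp_all add: antisym)
    then show "X = \<zero>\<^bsub>BM\<^esub>" by (simp add: fun_eq_iff)
  next
    assume "X = \<zero>\<^bsub>BM\<^esub>"
    then show "nrm BM X = 0" using nrm_BM_le[OF op_bound_zero] nonneg[OF X] by simp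
  qed
  show sm: "nrm BM (c \<odot>\<^bsub>BM\<^esub> X) = cmod c * nrm BM X" for c
  proof -
    have le: "nrm BM (c \<odot>\<^bsub>BM\<^esub> X) \<le> cmod c * nrm BM X" if "X \<in> carrier BM" for c X
      using nrm_BM_le[OF op_bound_smult[OF _ op_bound_nrm]] that by simp
    show ?thesis
    proof (cases "c = 0")
      case True
      then show ?thesis using le[OF X, of 0] nonneg[OF BM_smult_closed[OF X, of 0]] by simp
    next
      case False
      have "inverse c \<odot>\<^bsub>BM\<^esub> (c \<odot>\<^bsub>BM\<^esub> X) = X"
        using X False by (simp add: smult_smult[symmetric] fun_eq_iff)
      then have "nrm BM X \<le> inverse (cmod c) * nrm BM (c \<odot>\<^bsub>BM\<^esub> X)"
        using le[OF BM_smult_closed[OF X, of c], of "inverse c"] by (simp add: norm_inverse)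
      then have "cmod c * nrm BM X \<le> nrm BM (c \<odot>\<^bsub>BM\<^esub> X)"
        using False by (simp add: field_simps)
      then show ?thesis using le[OF X, of c] by simp
    qed
  qed
  show "nrm BM (star BM X \<otimes>\<^bsub>BM\<^esub> X) = (nrm BM X)\<^sup>2"
  proof (rule antisym)
    have "op_bound K (star BM X) (nrm BM X)"
      using op_bound_adj[OF _ op_bound_nrm[OF X]] X by simp
    then show "nrm BM (star BM X \<otimes>\<^bsub>BM\<^esub> X) \<le> (nrm BM X)\<^sup>2"
      using nrm_BM_le[OF op_bound_mult[OF _ _ _ op_bound_nrm[OF X]]] X by (simp add: power2_eq_square)
    let ?N = "nrm BM (star BM X \<otimes>\<^bsub>BM\<^esub> X)"
    have c: "star BM X \<otimes>\<^bsub>BM\<^esub> X \<in> carrier BM"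
      using X by (intro BM_mult_closed BM_star_closed)
    have "op_bound K X (sqrt ?N)" unfolding op_bound_def
    proof (intro conjI allI impI)
      fix i v assume v: "vec (v :: 'i \<Rightarrow> 'a)"
      have Xm: "mat X" using X by simp
      have w: "vec (act K X v)" using Xm v by simp
      have eq: "act K (adj X) (act K X v) = act K (star BM X \<otimes>\<^bsub>BM\<^esub> X) v"
        using act_mult[of "adj X" X v] Xm v by simp
      have "(vnorm (K i) (act K X v))\<^sup>2 = nrm F (ip (K i) (act K (adj X) (act K X v)) v)"
        unfolding vnorm_square[OF w] ip_act[OF Xm w v] ..
      also have "\<dots> \<le> vnorm (K i) (act K (adj X) (act K X v)) * vnorm (K i) v"
        using Xm v w by (intro Cauchy_Schwarz) simp_all
      also have "\<dots> \<le> (?N * vnorm (K i) v) * vnorm (K i) v"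
        unfolding eq using v by (intro mult_right_mono op_boundD[OF op_bound_nrm[OF c]]) simp_all
      also have "\<dots> = (sqrt ?N * vnorm (K i) v)\<^sup>2"
        using nonneg[OF c] by (simp add: power_mult_distrib power2_eq_square)
      finally show "vnorm (K i) (act K X v) \<le> sqrt ?N * vnorm (K i) v"
        by (rule power2_le_imp_le) (use v nonneg[OF c] in simp)
    qed (use nonneg[OF c] in simp)
    then have "nrm BM X \<le> sqrt ?N" by (rule nrm_BM_le)
    then show "(nrm BM X)\<^sup>2 \<le> ?N"
      using nonneg[OF X] nonneg[OF c] real_le_rsqrt sqrt_le_D
      by (metis power_mono real_sqrt_pow2)
  qed
next
  fix X Y assume X: "X \<in> carrier BM" and Y: "Y \<in> carrier BM"
  show "nrm BM (X \<oplus>\<^bsub>BM\<^esub> Y) \<le> nrm BM X + nrm BM Y"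
    using nrm_BM_le[OF op_bound_add[OF _ _ op_bound_nrm[OF X] op_bound_nrm[OF Y]]] X Y by simp
  show "nrm BM (X \<otimes>\<^bsub>BM\<^esub> Y) \<le> nrm BM X * nrm BM Y"
    using nrm_BM_le[OF op_bound_mult[OF _ _ op_bound_nrm[OF X] op_bound_nrm[OF Y]]] X Y by simp
  show "star BM (X \<otimes>\<^bsub>BM\<^esub> Y) = star BM Y \<otimes>\<^bsub>BM\<^esub> star BM X"
  proof (intro ext)
    fix i j
    show "star BM (X \<otimes>\<^bsub>BM\<^esub> Y) i j = (star BM Y \<otimes>\<^bsub>BM\<^esub> star BM X) i j"
    proof (cases "j \<in> K i")
      case True
      then show ?thesis using X Y block_eq[OF True] by (simp add: act_def sum_star star_mult)
    next
      case False
      have "i \<notin> K j" using False block_eq block_refl by blast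
      then have "(X \<otimes>\<^bsub>BM\<^esub> Y) j i = \<zero>" using BM_outside[OF BM_mult_closed[OF X Y]] by simp
      moreover have "(star BM Y \<otimes>\<^bsub>BM\<^esub> star BM X) i j = \<zero>"
        using False BM_outside[OF BM_mult_closed[OF BM_star_closed[OF Y] BM_star_closed[OF X]]] by simp
      ultimately show ?thesis by simp
    qed
  qed
qed (use BM_smult_closed BM_star_closed BM_complete in
  \<open>simp_all add: smult_add_left smult_add_right smult_smult star_add star_smult
    act_smult act_def smult_mult_left smult_mult_right sum_smult fun_eq_iff\<close>)

end

context cstar_blocks begin

lemma ip_sum_right:
  assumes "finite T" "vec v" "\<And>j. vec (w j)"
  shows "ip S v (\<lambda>k. \<Oplus>j\<in>T. w j k) = (\<Oplus>j\<in>T. ip S v (w j))"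
  using assms(1)
proof (induction T)
  case empty
  show ?case using assms by (simp add: ip_def)
next
  case (insert j T)
  then show ?case using assms ip_add_right[of v "w j" "\<lambda>k. \<Oplus>j\<in>T. w j k" S] by (simp add: sum_insert)
qed

lemma ip_sum_left:
  assumes "finite T" "vec v" "\<And>j. vec (w j)"
  shows "ip S (\<lambda>k. \<Oplus>j\<in>T. w j k) v = (\<Oplus>j\<in>T. ip S (w j) v)"
  using assms(1)
proof (induction T)
  case empty
  show ?case using assms by (simp add: ip_def)
next
  case (insert j T)
  then show ?case using assms ip_add_left[of v "w j" "\<lambda>k. \<Oplus>j\<in>T. w j k" S] by (simp add: sum_insert)
qed

lemma BM_pos_form:
  assumes "Z \<in> cstar_pos BM" "vec v" shows "ip (K i) v (act K Z v) \<in> pos"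
proof -
  interpret BM: cstar_algebra BM by (rule BM_cstar)
  obtain R where R: "R \<in> cstar_pos BM" "R \<otimes>\<^bsub>BM\<^esub> R = Z" using BM.pos_sqrt[OF assms(1)] by blast
  have Rm: "mat R" "adj R = R" using BM.pos_closed[OF R(1)] BM.pos_star[OF R(1)] by simp_all
  have "act K Z v = act K R (act K R v)"
    using act_mult[OF Rm(1) Rm(1) assms(2)] R(2) by simp
  then have "ip (K i) v (act K Z v) = ip (K i) (act K R v) (act K R v)"
    using ip_act[OF Rm(1) assms(2), of "act K R v" i] Rm assms(2) by simp
  then show ?thesis using Rm assms(2) by simp
qed

lemma BM_pos_formI:
  assumes Z: "Z \<in> carrier BM" "star BM Z = Z"
    and form: "\<And>i v. vec v \<Longrightarrow> ip (K i) v (act K Z v) \<in> pos"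
  shows "Z \<in> cstar_pos BM"
proof -
  interpret BM: cstar_algebra BM by (rule BM_cstar)
  obtain U where U: "U \<in> carrier BM" "star BM U = U" and U3: "U \<otimes>\<^bsub>BM\<^esub> U \<otimes>\<^bsub>BM\<^esub> U \<in> cstar_pos BM"
    and UZU: "U \<otimes>\<^bsub>BM\<^esub> Z \<otimes>\<^bsub>BM\<^esub> U \<oplus>\<^bsub>BM\<^esub> U \<otimes>\<^bsub>BM\<^esub> Z \<otimes>\<^bsub>BM\<^esub> U = \<ominus>\<^bsub>BM\<^esub> (U \<otimes>\<^bsub>BM\<^esub> U \<otimes>\<^bsub>BM\<^esub> U)"
    and Uz: "U = \<zero>\<^bsub>BM\<^esub> \<Longrightarrow> Z \<in> cstar_pos BM"
    using BM.sa_neg_part[OF Z] by blast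
  define V where "V = U \<otimes>\<^bsub>BM\<^esub> U \<otimes>\<^bsub>BM\<^esub> U"
  define W where "W = U \<otimes>\<^bsub>BM\<^esub> Z \<otimes>\<^bsub>BM\<^esub> U"
  have VW: "V \<in> carrier BM" "W \<in> carrier BM" using U Z by (simp_all only: V_def W_def BM.m_closed)
  have "W \<oplus>\<^bsub>BM\<^esub> W \<oplus>\<^bsub>BM\<^esub> V = \<zero>\<^bsub>BM\<^esub>"
    using UZU BM.l_neg[OF VW(1)] by (simp only: V_def W_def)
  then have WWV: "W i j \<oplus> W i j \<oplus> V i j = \<zero>" for i j
    by (simp add: fun_eq_iff)
  have Um: "mat U" "adj U = U" using U by simp_all
  have Zm: "mat Z" using Z by simp
  have V0: "ip (K i) v (act K V v) = \<zero>" if v: "vec v" for i v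
  proof -
    have "W = (\<lambda>i j. act K (\<lambda>i j. act K U (\<lambda>k. Z k j) i) (\<lambda>k. U k j) i)" by (simp add: W_def)
    then have "act K W v = act K U (act K Z (act K U v))"
      using act_mult[of "\<lambda>i j. act K U (\<lambda>k. Z k j) i" U v] act_mult[of U Z "act K U v"] Um Zm v by simp
    then have "ip (K i) v (act K W v) = ip (K i) (act K U v) (act K Z (act K U v))"
      using ip_act[OF Um(1) v, of "act K Z (act K U v)" i] Um Zm v by simp
    then have Wp: "ip (K i) v (act K W v) \<in> pos" using form[of "act K U v" i] Um v by simp
    have Vp: "ip (K i) v (act K V v) \<in> pos" using BM_pos_form[OF U3 v] by (simp add: V_def)
    have "act K W v k \<oplus> act K W v k \<oplus> act K V v k = \<zero>" for k
    proof -
      have "act K (\<lambda>i j. W i j \<oplus> W i j \<oplus> V i j) v k = act K W v k \<oplus> act K W v k \<oplus> act K V v k"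
        using VW v by (simp add: act_add)
      then show ?thesis using v by (simp add: WWV) (simp add: act_def)
    qed
    then have "ip (K i) v (\<lambda>k. act K W v k \<oplus> act K W v k \<oplus> act K V v k) = \<zero>"
      using v by (simp add: ip_def)
    then have "ip (K i) v (act K W v) \<oplus> ip (K i) v (act K W v) \<oplus> ip (K i) v (act K V v) = \<zero>"
      using VW v by (simp add: ip_add_right)
    then have "\<ominus> ip (K i) v (act K V v) = ip (K i) v (act K W v) \<oplus> ip (K i) v (act K W v)"
      using VW v by (intro minus_equality) simp_all
    then show ?thesis using pos_antisym[OF Vp] pos_add[OF Wp Wp] by simp
  qed
  obtain R where R: "R \<in> cstar_pos BM" and RR: "R \<otimes>\<^bsub>BM\<^esub> R = V"
    using BM.pos_sqrt[OF U3] unfolding V_def by blast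
  have Rm: "mat R" "adj R = R" using BM.pos_closed[OF R] BM.pos_star[OF R] by simp_all
  have "op_bound K R 0" unfolding op_bound_def
  proof (intro conjI allI impI)
    fix i v assume v: "vec (v :: 'i \<Rightarrow> 'a)"
    have "act K V v = act K R (act K R v)"
      using act_mult[OF Rm(1) Rm(1) v] RR by simp
    then have "ip (K i) (act K R v) (act K R v) = \<zero>"
      using ip_act[OF Rm(1) v, of "act K R v" i] Rm v V0[OF v, of i] by simp
    then show "vnorm (K i) (act K R v) \<le> 0 * vnorm (K i) v" by (simp add: vnorm_def)
  qed simp
  then have "nrm BM R \<le> 0" by (rule nrm_BM_le)
  then have "R = \<zero>\<^bsub>BM\<^esub>"
    using BM.nrm_nonneg[OF BM.pos_closed[OF R]] BM.nrm_eq_0[OF BM.pos_closed[OF R]] by simp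
  then have "V = \<zero>\<^bsub>BM\<^esub>" using RR BM.r_null[OF BM.zero_closed] by metis
  then have "U = \<zero>\<^bsub>BM\<^esub>" using BM.sa_nilpotent[OF U] unfolding V_def by blast
  then show ?thesis by (rule Uz)
qed

lemma BM_finsum:
  assumes "finite T" "\<And>j. X j \<in> carrier BM"
  shows "finsum BM X T = (\<lambda>p q. \<Oplus>j\<in>T. X j p q)"
  using assms(1)
proof (induction T)
  case empty
  interpret BM: cstar_algebra BM by (rule BM_cstar)
  show ?case by (simp add: BM.finsum_empty finsum_empty)
next
  case (insert j T)
  interpret BM: cstar_algebra BM by (rule BM_cstar)
  show ?case using insert assms BM.sum_insert[of T j X] by (simp add: sum_insert)
qed

lemma act_sum:
  assumes "finite T" "\<And>j. mat (X j)" "vec v"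
  shows "act K (\<lambda>p q. \<Oplus>j\<in>T. X j p q) v = (\<lambda>p. \<Oplus>j\<in>T. act K (X j) v p)"
  using assms(1)
proof (induction T)
  case empty
  show ?case using assms by (simp add: act_def finsum_empty)
next
  case (insert j T)
  then show ?case using assms act_add[of "X j" "\<lambda>p q. \<Oplus>j\<in>T. X j p q" v] by (simp add: sum_insert)
qed

lemma mat_pos_BM_form:
  assumes X: "mat_pos BM n X" and \<xi>: "\<And>j. vec (\<xi> j)"
  shows "(\<Oplus>i\<in>{..<n}. \<Oplus>j\<in>{..<n}. ip (K p) (\<xi> i) (act K (X i j) (\<xi> j))) \<in> pos"
proof -
  interpret BM: cstar_algebra BM by (rule BM_cstar)
  obtain Y0 where Y0: "\<forall>i<n. \<forall>j<n. Y0 i j \<in> carrier BM"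
    and X0: "\<forall>i<n. \<forall>j<n. X i j = (\<Oplus>\<^bsub>BM\<^esub>k\<in>{..<n}. star BM (Y0 k i) \<otimes>\<^bsub>BM\<^esub> Y0 k j)"
    using X unfolding mat_pos_def by blast
  define Y where "Y i j = (if i < n \<and> j < n then Y0 i j else \<zero>\<^bsub>BM\<^esub>)" for i j
  have Y: "Y i j \<in> carrier BM" for i j using Y0 BM.zero_closed by (auto simp: Y_def)
  have Ym: "mat (Y i j)" for i j using Y by simp
  have XY: "X i j = (\<lambda>p q. \<Oplus>k\<in>{..<n}. (star BM (Y k i) \<otimes>\<^bsub>BM\<^esub> Y k j) p q)" if "i < n" "j < n" for i j
  proof -
    have "X i j = (\<Oplus>\<^bsub>BM\<^esub>k\<in>{..<n}. star BM (Y k i) \<otimes>\<^bsub>BM\<^esub> Y k j)"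
    proof -
      have "X i j = (\<Oplus>\<^bsub>BM\<^esub>k\<in>{..<n}. star BM (Y0 k i) \<otimes>\<^bsub>BM\<^esub> Y0 k j)"
        using X0 that by blast
      also have "\<dots> = (\<Oplus>\<^bsub>BM\<^esub>k\<in>{..<n}. star BM (Y k i) \<otimes>\<^bsub>BM\<^esub> Y k j)"
      proof (rule BM.sum_cong)
        show "star BM (Y k i) \<otimes>\<^bsub>BM\<^esub> Y k j \<in> carrier BM" for k
          by (intro BM.m_closed BM.star_closed Y)
      qed (use that in \<open>simp add: Y_def\<close>)
      finally show ?thesis .
    qed
    also have "\<dots> = (\<lambda>p q. \<Oplus>k\<in>{..<n}. (star BM (Y k i) \<otimes>\<^bsub>BM\<^esub> Y k j) p q)"
      using Y by (intro BM_finsum BM.m_closed BM.star_closed) simp_all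
    finally show ?thesis .
  qed
  define a where "a k j = act K (Y k j) (\<xi> j)" for k j
  have a: "vec (a k j)" for k j using Ym \<xi> by (simp add: a_def)
  have e: "ip (K p) (\<xi> i) (act K (X i j) (\<xi> j)) = (\<Oplus>k\<in>{..<n}. ip (K p) (a k i) (a k j))"
    if "i < n" "j < n" for i j
  proof -
    have "act K (X i j) (\<xi> j) = (\<lambda>p. \<Oplus>k\<in>{..<n}. act K (adj (Y k i)) (a k j) p)"
      unfolding XY[OF that] a_def using Ym \<xi> by (subst act_sum) (simp_all add: act_mult)
    then have "ip (K p) (\<xi> i) (act K (X i j) (\<xi> j)) = (\<Oplus>k\<in>{..<n}. ip (K p) (\<xi> i) (act K (adj (Y k i)) (a k j)))"
      using Ym a \<xi> by (simp add: ip_sum_right)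
    also have "\<dots> = (\<Oplus>k\<in>{..<n}. ip (K p) (a k i) (a k j))"
      using Ym a \<xi> ip_act[of "adj (Y _ i)" "\<xi> i" "a _ j" p] by (intro sum_cong) (simp_all add: a_def)
    finally show ?thesis .
  qed
  have "(\<Oplus>i\<in>{..<n}. \<Oplus>j\<in>{..<n}. ip (K p) (\<xi> i) (act K (X i j) (\<xi> j)))
      = (\<Oplus>i\<in>{..<n}. \<Oplus>j\<in>{..<n}. \<Oplus>k\<in>{..<n}. ip (K p) (a k i) (a k j))"
    using a e by (intro sum_cong) simp_all
  also have "\<dots> = (\<Oplus>i\<in>{..<n}. \<Oplus>k\<in>{..<n}. \<Oplus>j\<in>{..<n}. ip (K p) (a k i) (a k j))"
    using a by (intro sum_cong sum_swap) simp_all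
  also have "\<dots> = (\<Oplus>k\<in>{..<n}. \<Oplus>i\<in>{..<n}. \<Oplus>j\<in>{..<n}. ip (K p) (a k i) (a k j))"
    using a by (intro sum_swap) simp_all
  also have "\<dots> = (\<Oplus>k\<in>{..<n}. ip (K p) (\<lambda>q. \<Oplus>i\<in>{..<n}. a k i q) (\<lambda>q. \<Oplus>j\<in>{..<n}. a k j q))"
    using a by (simp add: ip_sum_left ip_sum_right)
  also have "\<dots> \<in> pos" using a by (intro sum_pos) simp_all
  finally show ?thesis .
qed

end

subsection \<open>Matrix algebras\<close>

definition fin_block :: "nat \<Rightarrow> nat \<Rightarrow> nat set" where
  "fin_block n i = (if i < n then {..<n} else {})"

lemma mem_fin_block: "j \<in> fin_block n i \<longleftrightarrow> i < n \<and> j < n"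
  by (simp add: fin_block_def)

definition restr :: "'a cstar \<Rightarrow> nat \<Rightarrow> (nat \<Rightarrow> nat \<Rightarrow> 'a) \<Rightarrow> nat \<Rightarrow> nat \<Rightarrow> 'a" where
  "restr F n X = (\<lambda>i j. if i < n \<and> j < n then X i j else \<zero>\<^bsub>F\<^esub>)"

context cstar_algebra begin

abbreviation Mat :: "nat \<Rightarrow> (nat \<Rightarrow> nat \<Rightarrow> 'a) cstar" where "Mat n \<equiv> block_matrices (fin_block n)"

lemma fin_block_blocks: "cstar_blocks F (fin_block n)"
  by unfold_locales (auto simp: fin_block_def split: if_splits)

lemma Mat_carrier:
  "X \<in> carrier (Mat n) \<longleftrightarrow> (\<forall>i j. X i j \<in> carrier F) \<and> (\<forall>i j. \<not> (i < n \<and> j < n) \<longrightarrow> X i j = \<zero>)"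
proof -
  interpret M: cstar_blocks F "fin_block n" by (rule fin_block_blocks)
  have "op_bound (fin_block n) X (\<Sum>k<n. \<Sum>l<n. nrm F (X k l))" if X: "\<forall>i j. X i j \<in> carrier F"
    unfolding op_bound_def
  proof (intro conjI allI impI)
    fix i v assume v: "vec (v :: nat \<Rightarrow> 'a)"
    show "vnorm (fin_block n i) (act (fin_block n) X v) \<le> (\<Sum>k<n. \<Sum>l<n. nrm F (X k l)) * vnorm (fin_block n i) v"
    proof (cases "i < n")
      case True
      have "vnorm {..<n} (act (fin_block n) X v) \<le> (\<Sum>k<n. nrm F (act (fin_block n) X v k))"
        using X v by (intro vnorm_le_sum) simp_all
      also have "\<dots> \<le> (\<Sum>k<n. \<Sum>l<n. nrm F (X k l) * vnorm {..<n} v)"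
      proof (rule sum_mono)
        fix k assume "k \<in> {..<n}"
        then have "nrm F (act (fin_block n) X v k) \<le> (\<Sum>l<n. nrm F (X k l \<otimes> v l))"
          unfolding act_def fin_block_def using X v by (simp add: sum_nrm)
        also have "\<dots> \<le> (\<Sum>l<n. nrm F (X k l) * vnorm {..<n} v)"
          using X v nrm_le_vnorm[of "{..<n}" _ v]
          by (intro sum_mono order_trans[OF nrm_mult] mult_left_mono) (simp_all add: nrm_nonneg)
        finally show "nrm F (act (fin_block n) X v k) \<le> (\<Sum>l<n. nrm F (X k l) * vnorm {..<n} v)" .
      qed
      finally show ?thesis using True by (simp add: fin_block_def sum_distrib_right)
    qed (simp add: fin_block_def vnorm_def ip_def finsum_empty)
  qed (use X in \<open>simp add: sum_nonneg nrm_nonneg\<close>)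
  then show ?thesis
    unfolding M.BM_carrier mem_fin_block by blast
qed

lemma restr_carrier: "(\<And>i j. \<lbrakk>i < n; j < n\<rbrakk> \<Longrightarrow> X i j \<in> carrier F) \<Longrightarrow> restr F n X \<in> carrier (Mat n)"
  by (auto simp: Mat_carrier restr_def)

lemma restr_Mat: "X \<in> carrier (Mat n) \<Longrightarrow> restr F n X = X"
  by (auto simp: Mat_carrier restr_def fun_eq_iff)

lemma mat_pos_iff: "mat_pos F n X \<longleftrightarrow> restr F n X \<in> cstar_pos (Mat n)"
proof -
  interpret M: cstar_blocks F "fin_block n" by (rule fin_block_blocks)
  interpret Mn: cstar_algebra "Mat n" by (rule M.BM_cstar)
  have entry: "(star (Mat n) Y \<otimes>\<^bsub>Mat n\<^esub> Y) i j = (\<Oplus>k\<in>{..<n}. star F (Y k i) \<otimes> Y k j)" if "i < n" for Y i j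
    using that by (simp add: act_def fin_block_def)
  show ?thesis
  proof
    assume "mat_pos F n X"
    then obtain Y where Y: "\<forall>i<n. \<forall>j<n. Y i j \<in> carrier F"
      and X: "\<forall>i<n. \<forall>j<n. X i j = (\<Oplus>k\<in>{..<n}. star F (Y k i) \<otimes> Y k j)"
      unfolding mat_pos_def by blast
    have rY: "restr F n Y \<in> carrier (Mat n)" using Y by (intro restr_carrier) simp
    have "restr F n X = star (Mat n) (restr F n Y) \<otimes>\<^bsub>Mat n\<^esub> restr F n Y" (is "?l = ?r")
    proof (intro ext)
      fix i j
      have r: "?r \<in> carrier (Mat n)" by (intro Mn.m_closed Mn.star_closed rY)
      show "?l i j = ?r i j"
      proof (cases "i < n \<and> j < n")
        case True
        then have "?l i j = (\<Oplus>k\<in>{..<n}. star F (Y k i) \<otimes> Y k j)" using X by (simp add: restr_def)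
        also have "\<dots> = (\<Oplus>k\<in>{..<n}. star F (restr F n Y k i) \<otimes> restr F n Y k j)"
          using True Y by (intro sum_cong) (auto simp: restr_def)
        also have "\<dots> = ?r i j" by (rule entry[symmetric]) (use True in simp)
        finally show ?thesis .
      next
        case False
        then have "?r i j = \<zero>" using r unfolding Mat_carrier by blast
        then show ?thesis using False by (auto simp: restr_def)
      qed
    qed
    then show "restr F n X \<in> cstar_pos (Mat n)" using Mn.star_mult_pos[OF rY] by (simp only:)
  next
    assume "restr F n X \<in> cstar_pos (Mat n)"
    then obtain b where b: "b \<in> cstar_pos (Mat n)" "b \<otimes>\<^bsub>Mat n\<^esub> b = restr F n X"
      using Mn.pos_sqrt by blast
    have "X i j = (\<Oplus>k\<in>{..<n}. star F (b k i) \<otimes> b k j)" if "i < n" "j < n" for i j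
    proof -
      have "X i j = (star (Mat n) b \<otimes>\<^bsub>Mat n\<^esub> b) i j"
        using that unfolding Mn.pos_star[OF b(1)] b(2) by (simp add: restr_def)
      also have "\<dots> = (\<Oplus>k\<in>{..<n}. star F (b k i) \<otimes> b k j)" by (rule entry[OF that(1)])
      finally show ?thesis .
    qed
    then show "mat_pos F n X"
      unfolding mat_pos_def using Mn.pos_closed[OF b(1)] by (intro exI[of _ b]) (auto simp: Mat_carrier)
  qed
qed

lemma pos_archimedean:
  assumes Z: "Z \<in> carrier F" and W: "W \<in> carrier F"
    and p: "\<And>\<delta>. 0 < \<delta> \<Longrightarrow> Z \<oplus> complex_of_real \<delta> \<odot> W \<in> pos"
  shows "Z \<in> pos"
proof (rule pos_limit)
  show "converges (\<lambda>n. Z \<oplus> complex_of_real (1 / Suc n) \<odot> W) Z"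
  proof (rule convergesI)
    fix n
    have "Z \<oplus> x \<ominus> Z = x" if "x \<in> carrier F" for x using Z that by algebra
    then show "nrm F (Z \<oplus> complex_of_real (1 / Suc n) \<odot> W \<ominus> Z) \<le> 1 / Suc n * nrm F W"
      using Z W by (simp add: nrm_smult norm_divide del: of_nat_Suc)
    show "(\<lambda>n. 1 / Suc n * nrm F W) \<longlonglongrightarrow> 0"
      using tendsto_mult_left_zero[OF lim_1_over_n[THEN LIMSEQ_Suc], of "nrm F W"] by simp
  qed (use Z W in simp_all)
qed (use p[of "1 / Suc _"] in simp)

subsection \<open>Subalgebras\<close>

context
  fixes A assumes A: "cstar_subalgebra A F"
begin

abbreviation sub :: "'a cstar" where "sub \<equiv> F\<lparr>carrier := A\<rparr>"

lemma sub_subring: "subring A F"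
  using A unfolding cstar_subalgebra_def by (rule conjunct1)

lemma sub_carrier: "x \<in> A \<Longrightarrow> x \<in> carrier F"
  using subringE(1)[OF sub_subring] by (rule subsetD)

lemma sub_ring: "ring sub"
  by (rule subring_is_ring[OF sub_subring])

lemma sub_closed:
  "x \<in> A \<Longrightarrow> c \<odot> x \<in> A" "x \<in> A \<Longrightarrow> star F x \<in> A" "\<lbrakk>x \<in> A; y \<in> A\<rbrakk> \<Longrightarrow> x \<oplus> y \<in> A"
  "\<lbrakk>x \<in> A; y \<in> A\<rbrakk> \<Longrightarrow> x \<otimes> y \<in> A" "\<one> \<in> A" "\<zero> \<in> A" "x \<in> A \<Longrightarrow> \<ominus> x \<in> A"
  using A subringE(2,3,5-7)[OF sub_subring] by (simp_all add: cstar_subalgebra_def)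

lemma sub_a_minus: assumes "x \<in> A" "y \<in> A" shows "x \<ominus>\<^bsub>sub\<^esub> y = x \<ominus> y"
proof -
  interpret S: ring sub by (rule sub_ring)
  have "\<ominus>\<^bsub>sub\<^esub> y = \<ominus> y"
    using assms sub_carrier by (intro S.minus_equality) (simp_all add: l_neg sub_closed)
  then show ?thesis by (simp add: a_minus_def)
qed

lemma sub_cstar: "cstar_algebra sub"
proof (intro cstar_algebra.intro sub_ring cstar_algebra_axioms.intro)
  interpret S: ring sub by (rule sub_ring)
  fix X :: "nat \<Rightarrow> 'a"
  assume X: "\<And>n. X n \<in> carrier sub"
    and C: "\<forall>e>0. \<exists>N. \<forall>m\<ge>N. \<forall>n\<ge>N. nrm sub (X m \<ominus>\<^bsub>sub\<^esub> X n) < e"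
  have XA: "X n \<in> A" for n using X by simp
  have "\<exists>l\<in>carrier F. (\<lambda>n. nrm F (X n \<ominus> l)) \<longlonglongrightarrow> 0"
    using C XA sub_carrier by (intro complete) (simp_all add: sub_a_minus)
  then obtain l where l: "l \<in> carrier F" "(\<lambda>n. nrm F (X n \<ominus> l)) \<longlonglongrightarrow> 0" by blast
  then have "l \<in> A" using A XA unfolding cstar_subalgebra_def by meson
  then show "\<exists>l\<in>carrier sub. (\<lambda>n. nrm sub (X n \<ominus>\<^bsub>sub\<^esub> l)) \<longlonglongrightarrow> 0"
    using l XA by (intro bexI[of _ l]) (simp_all add: sub_a_minus)
qed (use sub_carrier in \<open>simp_all add: sub_closed smult_add_left smult_add_right smult_smult
  smult_mult_left smult_mult_right star_add star_smult star_mult nrm_nonneg nrm_eq_0 nrm_smult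
  nrm_add nrm_mult cstar_identity\<close>)

lemma sub_pos: "cstar_pos sub = pos \<inter> A"
proof -
  have "scal t \<in> A" for t by (simp add: sub_closed)
  then have "x \<in> cstar_pos sub \<longleftrightarrow> x \<in> pos" if "x \<in> A" for x
    unfolding cstar_pos_def using that sub_carrier[OF that] sub_a_minus[OF _ that] by simp
  moreover have "x \<in> A" if "x \<in> cstar_pos sub" for x
    using that unfolding cstar_pos_def by simp
  ultimately show ?thesis by blast
qed

lemma sub_finsum:
  assumes "finite T" "\<And>j. f j \<in> A" shows "finsum sub f T = finsum F f T"
  using assms(1)
proof (induction T)
  interpret S: cstar_algebra sub by (rule sub_cstar)
  case empty
  show ?case by (simp add: S.finsum_empty finsum_empty)
next
  interpret S: cstar_algebra sub by (rule sub_cstar)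
  case (insert j T)
  then show ?case using assms sub_carrier S.sum_insert[of T j f] sum_insert[of T j f] by simp
qed

end

end

subsection \<open>Path representations of the infinite dihedral group\<close>

text \<open>Block \<open>N\<close> is the path with vertices \<open>0, \<dots>, 2N + 1\<close>. The involutions \<open>path_u\<close> and \<open>path_v\<close>
  swap the ends of its edges of even and of odd position, and fix the vertices that are left over.\<close>

definition path_u :: "nat \<times> nat \<Rightarrow> nat \<times> nat" where
  "path_u = (\<lambda>(N, g). if g < 2 * N + 2 then (N, if even g then g + 1 else g - 1) else (N, g))"

definition path_v :: "nat \<times> nat \<Rightarrow> nat \<times> nat" where
  "path_v = (\<lambda>(N, g). if 1 \<le> g \<and> g < 2 * N + 1 then (N, if odd g then g + 1 else g - 1) else (N, g))"

definition path_block :: "nat \<times> nat \<Rightarrow> (nat \<times> nat) set" where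
  "path_block = (\<lambda>(N, g). if g < 2 * N + 2 then {N} \<times> {..<2 * N + 2} else {(N, g)})"

lemma path_u_u [simp]: "path_u (path_u p) = p"
  by (cases p) (auto simp: path_u_def elim!: evenE oddE, (arith+)?)

lemma path_v_v [simp]: "path_v (path_v p) = p"
  by (cases p) (auto simp: path_v_def elim!: evenE oddE, (arith+)?)

lemma path_block_self [simp]: "p \<in> path_block p"
  by (cases p) (auto simp: path_block_def)

lemma path_u_block [simp]: "path_u p \<in> path_block p"
  by (cases p) (auto simp: path_block_def path_u_def elim!: evenE oddE, (arith+)?)

lemma path_v_block [simp]: "path_v p \<in> path_block p"
  by (cases p) (auto simp: path_block_def path_v_def elim!: evenE oddE, (arith+)?)

context cstar_algebra begin

lemma path_blocks: "cstar_blocks F path_block"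
  by unfold_locales (auto simp: path_block_def split: if_splits)

text \<open>\<open>emb a b c\<close> is the matrix of \<open>a + b u + c v\<close>.\<close>

definition emb :: "'a \<Rightarrow> 'a \<Rightarrow> 'a \<Rightarrow> nat \<times> nat \<Rightarrow> nat \<times> nat \<Rightarrow> 'a" where
  "emb a b c = (\<lambda>p q. (if q = p then a else \<zero>) \<oplus> (if q = path_u p then b else \<zero>)
     \<oplus> (if q = path_v p then c else \<zero>))"

abbreviation Path :: "(nat \<times> nat \<Rightarrow> nat \<times> nat \<Rightarrow> 'a) cstar" where "Path \<equiv> block_matrices path_block"

definition perm_mat :: "('i \<Rightarrow> 'i) \<Rightarrow> 'a \<Rightarrow> 'i \<Rightarrow> 'i \<Rightarrow> 'a" where
  "perm_mat \<sigma> b = (\<lambda>p q. if q = \<sigma> p then b else \<zero>)"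

end

context cstar_blocks begin

lemma act_perm_mat:
  assumes "b \<in> carrier F" "vec \<xi>" "\<sigma> p \<in> K p"
  shows "act K (perm_mat \<sigma> b) \<xi> p = b \<otimes> \<xi> (\<sigma> p)"
proof -
  have "act K (perm_mat \<sigma> b) \<xi> p = (\<Oplus>q\<in>K p. if q = \<sigma> p then b \<otimes> \<xi> q else \<zero>)"
    unfolding act_def perm_mat_def using assms by (intro sum_cong) auto
  then show ?thesis using assms sum_delta[of "K p" "\<sigma> p" "\<lambda>q. b \<otimes> \<xi> q"] by simp
qed

lemma op_bound_perm_mat:
  assumes b: "b \<in> carrier F" and \<sigma>: "\<And>p. \<sigma> p \<in> K p" "\<And>p. \<sigma> (\<sigma> p) = p"
  shows "op_bound K (perm_mat \<sigma> b) (nrm F b)"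
  unfolding op_bound_def
proof (intro conjI allI impI)
  fix i v assume v: "vec (v :: 'i \<Rightarrow> 'a)"
  let ?w = "\<lambda>q. b \<otimes> v (\<sigma> q)"
  let ?f = "\<lambda>q. star F (v q) \<otimes> (star F b \<otimes> b) \<otimes> v q"
  have w: "vec ?w" using b v by simp
  have bij: "\<sigma> ` K i = K i"
  proof
    show "\<sigma> ` K i \<subseteq> K i" using \<sigma>(1) block_eq by blast
    then show "K i \<subseteq> \<sigma> ` K i" using \<sigma>(2) by (metis imageI image_subset_iff subsetI)
  qed
  have "ip (K i) ?w ?w = (\<Oplus>q\<in>K i. ?f (\<sigma> q))"
    unfolding ip_def using b v by (intro sum_cong) (simp_all add: star_mult m_assoc)
  also have "\<dots> = (\<Oplus>q\<in>\<sigma> ` K i. ?f q)"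
  proof (rule finsum_reindex[symmetric])
    show "inj_on \<sigma> (K i)" using \<sigma>(2) by (metis inj_onI)
  qed (use b v in auto)
  also have "\<dots> = (\<Oplus>q\<in>K i. ?f q)" unfolding bij ..
  finally have eq: "ip (K i) ?w ?w = (\<Oplus>q\<in>K i. ?f q)" .
  have "(\<Oplus>q\<in>K i. complex_of_real ((nrm F b)\<^sup>2) \<odot> (star F (v q) \<otimes> v q) \<ominus> ?f q) \<in> pos"
    using b v cstar_identity[OF b] by (intro sum_pos conj_scal_diff_pos) simp_all
  moreover have "(\<Oplus>q\<in>K i. complex_of_real ((nrm F b)\<^sup>2) \<odot> (star F (v q) \<otimes> v q) \<ominus> ?f q)
      = complex_of_real ((nrm F b)\<^sup>2) \<odot> ip (K i) v v \<ominus> ip (K i) ?w ?w"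
    unfolding eq using b v by (simp add: minus_eq sum_add sum_smult sum_minus ip_def)
  ultimately have "nrm F (ip (K i) ?w ?w) \<le> nrm F (complex_of_real ((nrm F b)\<^sup>2) \<odot> ip (K i) v v)"
    using v w by (intro nrm_mono) simp_all
  then have "(vnorm (K i) ?w)\<^sup>2 \<le> (nrm F b * vnorm (K i) v)\<^sup>2"
    using v by (simp add: vnorm_square[OF w] nrm_smult power_mult_distrib vnorm_square norm_power)
  then have "vnorm (K i) ?w \<le> nrm F b * vnorm (K i) v"
    by (rule power2_le_imp_le) (use b v nrm_nonneg in simp)
  moreover have "act K (perm_mat \<sigma> b) v = ?w"
    using act_perm_mat b v \<sigma>(1) by (simp add: fun_eq_iff)
  ultimately show "vnorm (K i) (act K (perm_mat \<sigma> b) v) \<le> nrm F b * vnorm (K i) v" by simp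
qed (use b nrm_nonneg in simp)

lemma perm_mat_carrier:
  assumes b: "b \<in> carrier F" and \<sigma>: "\<And>p. \<sigma> p \<in> K p" "\<And>p. \<sigma> (\<sigma> p) = p"
  shows "perm_mat \<sigma> b \<in> carrier BM"
  by (rule BM_carrierI[OF _ _ op_bound_perm_mat[OF b \<sigma>]]) (use b \<sigma>(1) in \<open>auto simp: perm_mat_def\<close>)

end

context cstar_algebra begin

lemma emb_eq: "emb a b c = perm_mat id a \<oplus>\<^bsub>Path\<^esub> perm_mat path_u b \<oplus>\<^bsub>Path\<^esub> perm_mat path_v c"
proof -
  interpret P: cstar_blocks F path_block by (rule path_blocks)
  show ?thesis by (simp add: emb_def perm_mat_def)
qed

lemma emb_carrier [simp]:
  assumes "a \<in> carrier F" "b \<in> carrier F" "c \<in> carrier F" shows "emb a b c \<in> carrier Path"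
proof -
  interpret P: cstar_blocks F path_block by (rule path_blocks)
  show ?thesis unfolding emb_eq using assms
    by (intro P.BM_add_closed P.perm_mat_carrier) simp_all
qed

lemma act_emb:
  assumes "a \<in> carrier F" "b \<in> carrier F" "c \<in> carrier F" "vec \<xi>"
  shows "act path_block (emb a b c) \<xi> p = a \<otimes> \<xi> p \<oplus> b \<otimes> \<xi> (path_u p) \<oplus> c \<otimes> \<xi> (path_v p)"
proof -
  interpret P: cstar_blocks F path_block by (rule path_blocks)
  have m: "P.mat (perm_mat id a)" "P.mat (perm_mat path_u b)" "P.mat (perm_mat path_v c)"
    using assms by (simp_all add: perm_mat_def)
  have "act path_block (emb a b c) \<xi> p = act path_block (perm_mat id a) \<xi> p
      \<oplus> act path_block (perm_mat path_u b) \<xi> p \<oplus> act path_block (perm_mat path_v c) \<xi> p"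
    unfolding emb_eq P.BM_sel using m assms by (simp add: P.act_add)
  then show ?thesis using assms by (simp add: P.act_perm_mat)
qed

lemma emb_add:
  assumes "a \<in> carrier F" "b \<in> carrier F" "c \<in> carrier F" "a' \<in> carrier F" "b' \<in> carrier F" "c' \<in> carrier F"
  shows "emb a b c \<oplus>\<^bsub>Path\<^esub> emb a' b' c' = emb (a \<oplus> a') (b \<oplus> b') (c \<oplus> c')"
proof -
  interpret P: cstar_blocks F path_block by (rule path_blocks)
  have "(if P then a else \<zero>) \<oplus> (if Q then b else \<zero>) \<oplus> (if R then c else \<zero>)
      \<oplus> ((if P then a' else \<zero>) \<oplus> (if Q then b' else \<zero>) \<oplus> (if R then c' else \<zero>))
    = (if P then a \<oplus> a' else \<zero>) \<oplus> (if Q then b \<oplus> b' else \<zero>) \<oplus> (if R then c \<oplus> c' else \<zero>)" for P Q R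
    using assms by (cases P; cases Q; cases R) (simp_all add: a_ac)
  then show ?thesis by (simp only: P.BM_sel emb_def)
qed

lemma emb_smult:
  assumes "a \<in> carrier F" "b \<in> carrier F" "c \<in> carrier F"
  shows "r \<odot>\<^bsub>Path\<^esub> emb a b c = emb (r \<odot> a) (r \<odot> b) (r \<odot> c)"
proof -
  interpret P: cstar_blocks F path_block by (rule path_blocks)
  have "r \<odot> ((if P then a else \<zero>) \<oplus> (if Q then b else \<zero>) \<oplus> (if R then c else \<zero>))
    = (if P then r \<odot> a else \<zero>) \<oplus> (if Q then r \<odot> b else \<zero>) \<oplus> (if R then r \<odot> c else \<zero>)" for P Q R
    using assms by (cases P; cases Q; cases R) (simp_all add: smult_add_right)
  then show ?thesis by (simp only: P.BM_sel emb_def)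
qed

lemma emb_star:
  assumes "a \<in> carrier F" "b \<in> carrier F" "c \<in> carrier F"
  shows "star Path (emb a b c) = emb (star F a) (star F b) (star F c)"
proof -
  interpret P: cstar_blocks F path_block by (rule path_blocks)
  have sym: "p = path_u q \<longleftrightarrow> q = path_u p" "p = path_v q \<longleftrightarrow> q = path_v p" "p = q \<longleftrightarrow> q = p" for p q
    by (metis path_u_u, metis path_v_v, rule eq_commute)
  have "star F ((if P then a else \<zero>) \<oplus> (if Q then b else \<zero>) \<oplus> (if R then c else \<zero>))
    = (if P then star F a else \<zero>) \<oplus> (if Q then star F b else \<zero>) \<oplus> (if R then star F c else \<zero>)" for P Q R
    using assms by (cases P; cases Q; cases R) (simp_all add: star_add)
  then show ?thesis
    unfolding P.BM_sel emb_def by (subst (1 2 3) sym) simp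
qed

lemma emb_one: "emb \<one> \<zero> \<zero> = \<one>\<^bsub>Path\<^esub>"
proof -
  interpret P: cstar_blocks F path_block by (rule path_blocks)
  show ?thesis by (simp add: emb_def fun_eq_iff)
qed

text \<open>At the vertex 1 of the block \<open>{0, \<dots>, 3}\<close> the three matrices \<open>1\<close>, \<open>u\<close> and \<open>v\<close> have disjoint supports.\<close>

lemma emb_coords:
  assumes "a \<in> carrier F" "b \<in> carrier F" "c \<in> carrier F"
  shows "emb a b c (1, 1) (1, 1) = a" "emb a b c (1, 1) (1, 0) = b" "emb a b c (1, 1) (1, 2) = c"
    "emb a b c (1, 0) (1, 1) = b" "emb a b c (1, 2) (1, 1) = c"
  using assms by (simp_all add: emb_def path_u_def path_v_def)

definition emb_set :: "'a set \<Rightarrow> (nat \<times> nat \<Rightarrow> nat \<times> nat \<Rightarrow> 'a) set" where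
  "emb_set A = {emb a b c | a b c. a \<in> A \<and> b \<in> A \<and> c \<in> A}"

lemma emb_set_operator_system: assumes A: "cstar_subalgebra A F" shows "operator_system (emb_set A) Path"
  unfolding operator_system_def
proof (intro conjI ballI allI)
  note cl = sub_closed[OF A]
  have sub: "a \<in> carrier F" if "a \<in> A" for a using sub_carrier[OF A that] .
  show "emb_set A \<subseteq> carrier Path" by (auto simp: emb_set_def sub)
  show "\<one>\<^bsub>Path\<^esub> \<in> emb_set A" unfolding emb_set_def emb_one[symmetric] using cl by blast
  fix x assume "x \<in> emb_set A"
  then obtain a b c where x: "x = emb a b c" "a \<in> A" "b \<in> A" "c \<in> A" unfolding emb_set_def by blast
  show "star Path x \<in> emb_set A"
    unfolding x(1) emb_star[OF x(2-4)[THEN sub]] emb_set_def using x cl by blast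
  show "r \<odot>\<^bsub>Path\<^esub> x \<in> emb_set A" for r
    unfolding x(1) emb_smult[OF x(2-4)[THEN sub]] emb_set_def using x cl by blast
  fix y assume "y \<in> emb_set A"
  then obtain a' b' c' where y: "y = emb a' b' c'" "a' \<in> A" "b' \<in> A" "c' \<in> A" unfolding emb_set_def by blast
  show "x \<oplus>\<^bsub>Path\<^esub> y \<in> emb_set A"
    unfolding x(1) y(1) emb_add[OF x(2-4)[THEN sub] y(2-4)[THEN sub]] emb_set_def using x y cl by blast
qed

subsection \<open>Tridiagonal forms on vectors\<close>

text \<open>\<open>vform\<close> is \<open>tridiag\<close> with its arguments applied to vectors.\<close>

primrec vform :: "nat \<Rightarrow> (nat \<Rightarrow> nat \<Rightarrow> 'a) \<Rightarrow> (nat \<Rightarrow> nat \<Rightarrow> nat \<Rightarrow> 'a) \<Rightarrow> nat \<Rightarrow> (nat \<Rightarrow> nat \<Rightarrow> 'a) \<Rightarrow> 'a" where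
  "vform n a e 0 z = ip {..<n} (z 0) (act (fin_block n) a (z 0))"
| "vform n a e (Suc m) z = vform n a e m z \<oplus> ip {..<n} (z (Suc m)) (act (fin_block n) a (z (Suc m)))
     \<oplus> (ip {..<n} (z m) (act (fin_block n) (e m) (z (Suc m)))
        \<oplus> ip {..<n} (z (Suc m)) (act (fin_block n) (e m) (z m)))"

lemma Mat_act_closed [simp]:
  "\<lbrakk>\<And>i j. a i j \<in> carrier F; \<And>i. v i \<in> carrier F\<rbrakk> \<Longrightarrow> act (fin_block n) a v k \<in> carrier F"
  by (simp add: act_def)

lemma vform_closed [simp]:
  assumes "\<And>i j. a i j \<in> carrier F" "\<And>k i j. e k i j \<in> carrier F" "\<And>k i. z k i \<in> carrier F"
  shows "vform n a e m z \<in> carrier F"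
  using assms by (induction m) simp_all

lemma tridiag_star:
  assumes "a \<in> carrier F" "\<And>n. e n \<in> carrier F" "\<And>k. w k \<in> carrier F"
    "star F a = a" "\<And>n. star F (e n) = e n"
  shows "star F (tridiag a e n w) = tridiag a e n w"
proof (induction n)
  case (Suc n)
  then show ?case using assms
    by (simp add: star_add star_mult m_assoc a_comm[of "star F (w (Suc n)) \<otimes> (e n \<otimes> w n)"])
qed (use assms in \<open>simp add: star_mult m_assoc\<close>)

lemma form_tridiag:
  assumes a: "a \<in> carrier (Mat n)" and e: "\<And>k. e k \<in> carrier (Mat n)"
    and w: "\<And>k. w k \<in> carrier (Mat n)" and v: "vec v"
  shows "ip {..<n} v (act (fin_block n) (cstar_algebra.tridiag (Mat n) a e m w) v)
    = vform n a e m (\<lambda>k. act (fin_block n) (w k) v)"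
proof -
  interpret M: cstar_blocks F "fin_block n" by (rule fin_block_blocks)
  interpret Mn: cstar_algebra "Mat n" by (rule M.BM_cstar)
  have mats: "M.mat x" if "x \<in> carrier (Mat n)" for x using that by simp
  have ip_act': "ip {..<n} y (act (fin_block n) x z) = ip {..<n} (act (fin_block n) (star (Mat n) x) y) z"
    if "M.mat x" "vec y" "vec z" for x y z
  proof (cases "n = 0")
    case False
    then have "fin_block n 0 = {..<n}" by (simp add: fin_block_def)
    then show ?thesis using M.ip_act[OF that, of 0] by simp
  qed (simp add: ip_def finsum_empty)
  have conj: "ip {..<n} v (act (fin_block n) (star (Mat n) x \<otimes>\<^bsub>Mat n\<^esub> y \<otimes>\<^bsub>Mat n\<^esub> z) v)
      = ip {..<n} (act (fin_block n) x v) (act (fin_block n) y (act (fin_block n) z v))"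
    if "x \<in> carrier (Mat n)" "y \<in> carrier (Mat n)" "z \<in> carrier (Mat n)" for x y z
  proof -
    have sx: "M.mat (star (Mat n) x)" using that(1) by simp
    have sxy: "M.mat (star (Mat n) x \<otimes>\<^bsub>Mat n\<^esub> y)" using sx mats[OF that(2)] by simp
    have "act (fin_block n) (star (Mat n) x \<otimes>\<^bsub>Mat n\<^esub> y \<otimes>\<^bsub>Mat n\<^esub> z) v
        = act (fin_block n) (star (Mat n) x) (act (fin_block n) y (act (fin_block n) z v))"
      using M.act_mult[OF sxy mats[OF that(3)] v] M.act_mult[OF sx mats[OF that(2)], of "act (fin_block n) z v"]
        mats[OF that(3)] v by simp
    then show ?thesis
      using ip_act'[OF sx v, of "act (fin_block n) y (act (fin_block n) z v)"] mats[OF that(1)] mats[OF that(2)] mats[OF that(3)] v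
      by simp
  qed
  have add: "ip {..<n} v (act (fin_block n) (x \<oplus>\<^bsub>Mat n\<^esub> y) v)
      = ip {..<n} v (act (fin_block n) x v) \<oplus> ip {..<n} v (act (fin_block n) y v)"
    if "x \<in> carrier (Mat n)" "y \<in> carrier (Mat n)" for x y
    using that v by (simp add: M.act_add ip_add_right)
  note closed = Mn.a_closed Mn.m_closed Mn.star_closed Mn.tridiag_closed
  show ?thesis
  proof (induction m)
    case 0
    show ?case unfolding Mn.tridiag.simps vform.simps by (rule conj[OF w a w])
  next
    case (Suc m)
    show ?case unfolding Mn.tridiag.simps vform.simps Suc[symmetric]
      by (simp only: add conj closed a e w)
  qed
qed

lemma form_path:
  assumes a: "\<And>i j. a i j \<in> carrier F" and e: "\<And>k i j. e k i j \<in> carrier F" and z: "\<And>k i. z k i \<in> carrier F"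
  shows "(\<Oplus>g\<in>{1..Suc m}. ip {..<n} (z g) (act (fin_block n) a (z g))
      \<oplus> (ip {..<n} (z g) (act (fin_block n) (e g) (z (Suc g)))
         \<oplus> ip {..<n} (z g) (act (fin_block n) (e (g - 1)) (z (g - 1)))))
    = vform n a (\<lambda>k. e (Suc k)) m (\<lambda>k. z (Suc k))
      \<oplus> ip {..<n} (z 1) (act (fin_block n) (e 0) (z 0))
      \<oplus> ip {..<n} (z (Suc m)) (act (fin_block n) (e (Suc m)) (z (Suc (Suc m))))"
proof (induction m)
  case 0
  have c: "\<And>k l. ip {..<n} (z k) (act (fin_block n) a (z l)) \<in> carrier F"
    "\<And>k l m. ip {..<n} (z k) (act (fin_block n) (e m) (z l)) \<in> carrier F"
    using a e z by simp_all
  show ?case using c by (simp add: finsum_singleton a_ac)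
next
  case (Suc m)
  have c: "\<And>k l. ip {..<n} (z k) (act (fin_block n) a (z l)) \<in> carrier F"
    "\<And>k l m. ip {..<n} (z k) (act (fin_block n) (e m) (z l)) \<in> carrier F"
    "vform n a (\<lambda>k. e (Suc k)) m (\<lambda>k. z (Suc k)) \<in> carrier F"
    using a e z by simp_all
  have "{1..Suc (Suc m)} = insert (Suc (Suc m)) {1..Suc m}" by auto
  then show ?case using c Suc by (simp add: sum_insert a_ac del: One_nat_def)
qed

lemma sum_mono_neutral:
  assumes "finite S" "T \<subseteq> S" "\<And>k. f k \<in> carrier F" "\<And>k. k \<in> S - T \<Longrightarrow> f k = \<zero>"
  shows "(\<Oplus>k\<in>S. f k) = (\<Oplus>k\<in>T. f k)"
proof -
  have "(\<Oplus>k\<in>T \<union> (S - T). f k) = (\<Oplus>k\<in>T. f k) \<oplus> (\<Oplus>k\<in>S - T. f k)"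
    using assms finite_subset[of T S] by (intro finsum_Un_disjoint) auto
  moreover have "(\<Oplus>k\<in>S - T. f k) = (\<Oplus>k\<in>S - T. \<zero>)"
    using assms by (intro sum_cong) simp_all
  moreover have "T \<union> (S - T) = S" using assms by blast
  ultimately show ?thesis using assms by simp
qed

lemma vform_cong: "(\<And>k. k \<le> m \<Longrightarrow> z k = z' k) \<Longrightarrow> vform n a e m z = vform n a e m z'"
  by (induction m) simp_all

lemma ip_act_double:
  assumes "\<And>i j. a i j \<in> carrier F" "vec x" "vec y"
  shows "ip {..<n} x (act (fin_block n) a y) = (\<Oplus>i\<in>{..<n}. \<Oplus>j\<in>{..<n}. star F (x i) \<otimes> (a i j \<otimes> y j))"
  unfolding ip_def using assms by (intro sum_cong) (simp_all add: act_def fin_block_def sum_mult_left)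

lemma ip_zero_left: "\<lbrakk>vec w; \<And>k. v k = \<zero>\<rbrakk> \<Longrightarrow> ip S v w = \<zero>"
  by (simp add: ip_def)

lemma ip_zero_right: "\<lbrakk>vec w; \<And>k. v k = \<zero>\<rbrakk> \<Longrightarrow> ip S w v = \<zero>"
  by (simp add: ip_def)

text \<open>A path of length \<open>m\<close> sits inside block \<open>m + 1\<close>, away from the ends.\<close>

lemma vform_pos:
  assumes X: "mat_pos Path n X"
    and Xe: "\<And>i j. \<lbrakk>i < n; j < n\<rbrakk> \<Longrightarrow> X i j = emb (a i j) (b i j) (c i j)"
    and a: "\<And>i j. a i j \<in> carrier F" and b: "\<And>i j. b i j \<in> carrier F" and c: "\<And>i j. c i j \<in> carrier F"
    and z: "\<And>k i. z k i \<in> carrier F"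
  shows "vform n a (\<lambda>k. if even k then c else b) m z \<in> pos"
proof -
  interpret P: cstar_blocks F path_block by (rule path_blocks)
  define N where "N = Suc m"
  define L where "L = 2 * N + 2"
  define z' where "z' k = (if 1 \<le> k \<and> k \<le> Suc m then z (k - 1) else (\<lambda>_. \<zero>))" for k
  have z'0: "z' 0 k = \<zero>" "z' (Suc (Suc m)) k = \<zero>" for k by (simp_all add: z'_def)
  define \<xi> where "\<xi> i p = z' (snd p) i" for i and p :: "nat \<times> nat"
  have z': "z' k i \<in> carrier F" for k i using z by (simp add: z'_def)
  have \<xi>: "vec (\<xi> i)" for i using z' by (simp add: \<xi>_def)
  define E where "E k = (if even k then b else c)" for k :: nat
  have E: "E k i j \<in> carrier F" for k i j using b c by (simp add: E_def)
  define y where "y g j = \<xi> j (path_u (N, g))" for g j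
  define y' where "y' g j = \<xi> j (path_v (N, g))" for g j
  have y: "y g j \<in> carrier F" "y' g j \<in> carrier F" for g j using z' by (simp_all add: y_def y'_def \<xi>_def)
  have blk: "path_block (N, 0) = Pair N ` {..<L}" by (auto simp: path_block_def L_def)
  have inner: "ip (path_block (N, 0)) (\<xi> i) (act path_block (X i j) (\<xi> j))
      = (\<Oplus>g\<in>{..<L}. star F (z' g i) \<otimes> (a i j \<otimes> z' g j) \<oplus> star F (z' g i) \<otimes> (b i j \<otimes> y g j)
          \<oplus> star F (z' g i) \<otimes> (c i j \<otimes> y' g j))" if "i < n" "j < n" for i j
  proof -
    have "ip (path_block (N, 0)) (\<xi> i) (act path_block (X i j) (\<xi> j))
      = (\<Oplus>p\<in>Pair N ` {..<L}. star F (\<xi> i p) \<otimes> (a i j \<otimes> \<xi> j p \<oplus> b i j \<otimes> \<xi> j (path_u p) \<oplus> c i j \<otimes> \<xi> j (path_v p)))"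
      unfolding ip_def blk Xe[OF that] act_emb[OF a b c \<xi>] ..
    also have "\<dots> = (\<Oplus>g\<in>{..<L}. star F (\<xi> i (N, g)) \<otimes> (a i j \<otimes> \<xi> j (N, g) \<oplus> b i j \<otimes> \<xi> j (path_u (N, g)) \<oplus> c i j \<otimes> \<xi> j (path_v (N, g))))"
    proof (rule finsum_reindex)
      have "\<xi> i p \<in> carrier F" for i p using \<xi> by blast
      then show "(\<lambda>p. star F (\<xi> i p) \<otimes> (a i j \<otimes> \<xi> j p \<oplus> b i j \<otimes> \<xi> j (path_u p) \<oplus> c i j \<otimes> \<xi> j (path_v p)))
        \<in> Pair N ` {..<L} \<rightarrow> carrier F" using a b c by simp
    qed (simp add: inj_on_def)
    also have "\<dots> = (\<Oplus>g\<in>{..<L}. star F (z' g i) \<otimes> (a i j \<otimes> z' g j) \<oplus> star F (z' g i) \<otimes> (b i j \<otimes> y g j)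
          \<oplus> star F (z' g i) \<otimes> (c i j \<otimes> y' g j))"
    proof -
      have "\<xi> i (N, g) = z' g i" for i g by (simp add: \<xi>_def)
      then show ?thesis
        using a b c y z' by (intro sum_cong) (simp_all add: y_def[symmetric] y'_def[symmetric] r_distr)
    qed
    finally show ?thesis .
  qed
  let ?t = "\<lambda>g i j. star F (z' g i) \<otimes> (a i j \<otimes> z' g j) \<oplus> star F (z' g i) \<otimes> (b i j \<otimes> y g j)
          \<oplus> star F (z' g i) \<otimes> (c i j \<otimes> y' g j)"
  let ?q = "\<lambda>g. ip {..<n} (z' g) (act (fin_block n) a (z' g)) \<oplus> ip {..<n} (z' g) (act (fin_block n) b (y g))
      \<oplus> ip {..<n} (z' g) (act (fin_block n) c (y' g))"
  have t: "?t g i j \<in> carrier F" for g i j using a b c y z' by simp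
  have q: "?q g \<in> carrier F" for g using a b c y z' by simp
  have tq: "(\<Oplus>i\<in>{..<n}. \<Oplus>j\<in>{..<n}. ?t g i j) = ?q g" for g
    using a b c y z' by (simp add: ip_act_double sum_add)
  have "(\<Oplus>i\<in>{..<n}. \<Oplus>j\<in>{..<n}. ip (path_block (N, 0)) (\<xi> i) (act path_block (X i j) (\<xi> j))) \<in> pos"
    by (rule P.mat_pos_BM_form[OF X \<xi>])
  also have "(\<Oplus>i\<in>{..<n}. \<Oplus>j\<in>{..<n}. ip (path_block (N, 0)) (\<xi> i) (act path_block (X i j) (\<xi> j)))
      = (\<Oplus>i\<in>{..<n}. \<Oplus>j\<in>{..<n}. \<Oplus>g\<in>{..<L}. ?t g i j)"
  proof (intro sum_cong)
    show "ip (path_block (N, 0)) (\<xi> i) (act path_block (X i j) (\<xi> j)) = (\<Oplus>g\<in>{..<L}. ?t g i j)"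
      if "i \<in> {..<n}" "j \<in> {..<n}" for i j using inner that by simp
  qed (use t in simp_all)
  also have "\<dots> = (\<Oplus>i\<in>{..<n}. \<Oplus>g\<in>{..<L}. \<Oplus>j\<in>{..<n}. ?t g i j)"
    using t by (intro sum_cong sum_swap) simp_all
  also have "\<dots> = (\<Oplus>g\<in>{..<L}. \<Oplus>i\<in>{..<n}. \<Oplus>j\<in>{..<n}. ?t g i j)"
    using t by (intro sum_swap) simp_all
  also have "\<dots> = (\<Oplus>g\<in>{..<L}. ?q g)" by (simp only: tq)
  also have "\<dots> = (\<Oplus>g\<in>{1..Suc m}. ?q g)"
  proof (rule sum_mono_neutral)
    fix g assume "g \<in> {..<L} - {1..Suc m}"
    then have "z' g = (\<lambda>_. \<zero>)" by (auto simp: z'_def)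
    then show "?q g = \<zero>" using a b c y by (simp add: ip_zero_left)
  qed (use q in \<open>auto simp: L_def N_def\<close>)
  also have "\<dots> = (\<Oplus>g\<in>{1..Suc m}. ip {..<n} (z' g) (act (fin_block n) a (z' g))
      \<oplus> (ip {..<n} (z' g) (act (fin_block n) (E g) (z' (Suc g)))
         \<oplus> ip {..<n} (z' g) (act (fin_block n) (E (g - 1)) (z' (g - 1)))))"
  proof (rule sum_cong)
    fix g assume g: "g \<in> {1..Suc m}"
    have c1: "ip {..<n} (z' g) (act (fin_block n) M (z' h)) \<in> carrier F" if "\<And>i j. M i j \<in> carrier F" for M h
      using that z' by simp
    show "?q g = ip {..<n} (z' g) (act (fin_block n) a (z' g))
      \<oplus> (ip {..<n} (z' g) (act (fin_block n) (E g) (z' (Suc g)))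
         \<oplus> ip {..<n} (z' g) (act (fin_block n) (E (g - 1)) (z' (g - 1))))"
    proof (cases "even g")
      case True
      then have "y g = z' (Suc g)" "y' g = z' (g - 1)" "E g = b" "E (g - 1) = c"
        using g by (auto simp: y_def y'_def \<xi>_def path_u_def path_v_def N_def E_def fun_eq_iff)
      then show ?thesis using c1[OF a] c1[OF b] c1[OF c] by (simp add: a_assoc)
    next
      case False
      then have "y g = z' (g - 1)" "y' g = z' (Suc g)" "E g = c" "E (g - 1) = b"
        using g by (auto simp: y_def y'_def \<xi>_def path_u_def path_v_def N_def E_def fun_eq_iff)
      then show ?thesis using c1[OF a] c1[OF b] c1[OF c] by (simp add: a_ac)
    qed
  qed (use a E z' in simp)
  also have "\<dots> = vform n a (\<lambda>k. E (Suc k)) m (\<lambda>k. z' (Suc k))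
      \<oplus> ip {..<n} (z' 1) (act (fin_block n) (E 0) (z' 0))
      \<oplus> ip {..<n} (z' (Suc m)) (act (fin_block n) (E (Suc m)) (z' (Suc (Suc m))))"
    by (rule form_path[OF a E z'])
  also have "ip {..<n} (z' 1) (act (fin_block n) (E 0) (z' 0)) = \<zero>"
    using z' E by (intro ip_zero_right) (simp_all add: act_def z'0)
  also have "ip {..<n} (z' (Suc m)) (act (fin_block n) (E (Suc m)) (z' (Suc (Suc m)))) = \<zero>"
    using z' E by (intro ip_zero_right) (simp_all add: act_def z'0)
  also have "vform n a (\<lambda>k. E (Suc k)) m (\<lambda>k. z' (Suc k)) = vform n a (\<lambda>k. E (Suc k)) m z"
    by (rule vform_cong) (simp add: z'_def)
  also have "(\<lambda>k. E (Suc k)) = (\<lambda>k. if even k then c else b)"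
    by (auto simp: E_def)
  finally show ?thesis using a b c z by simp
qed

subsection \<open>Splitting positive elements\<close>

context
  fixes A assumes A: "cstar_subalgebra A F"
begin

lemma sub_ip:
  assumes "finite T" "\<And>k. v k \<in> A" "\<And>k. w k \<in> A"
  shows "cstar_algebra.ip (F\<lparr>carrier := A\<rparr>) T v w = ip T v w"
proof -
  interpret S: cstar_algebra "F\<lparr>carrier := A\<rparr>" by (rule sub_cstar[OF A])
  show ?thesis unfolding S.ip_def ip_def
    using sub_finsum[OF A assms(1), of "\<lambda>k. star F (v k) \<otimes> w k"] assms by (simp add: sub_closed[OF A])
qed

lemma sub_act:
  assumes "\<And>i j. X i j \<in> A" "\<And>k. v k \<in> A"
  shows "cstar_algebra.act (F\<lparr>carrier := A\<rparr>) (fin_block n) X v = act (fin_block n) X v"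
proof
  interpret S: cstar_algebra "F\<lparr>carrier := A\<rparr>" by (rule sub_cstar[OF A])
  fix i
  have "finite (fin_block n i)" by (simp add: fin_block_def)
  then show "S.act (fin_block n) X v i = act (fin_block n) X v i"
    unfolding S.act_def act_def
    using sub_finsum[OF A, of "fin_block n i" "\<lambda>k. X i k \<otimes> v k"] assms by (simp add: sub_closed[OF A])
qed

lemma sub_act_closed:
  assumes "\<And>i j. X i j \<in> A" "\<And>k. v k \<in> A" shows "act (fin_block n) X v i \<in> A"
proof -
  interpret S: cstar_algebra "F\<lparr>carrier := A\<rparr>" by (rule sub_cstar[OF A])
  have "S.act (fin_block n) X v i \<in> A" using S.Mat_act_closed[of X v n i] assms by simp
  then show ?thesis using sub_act[OF assms] by simp
qed

lemma sub_vform: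
  assumes "\<And>i j. a i j \<in> A" "\<And>k i j. e k i j \<in> A" "\<And>k i. z k i \<in> A"
  shows "cstar_algebra.vform (F\<lparr>carrier := A\<rparr>) n a e m z = vform n a e m z"
proof -
  interpret S: cstar_algebra "F\<lparr>carrier := A\<rparr>" by (rule sub_cstar[OF A])
  show ?thesis by (induction m) (simp_all add: sub_act sub_ip sub_act_closed assms)
qed

lemma path_pos_split:
  assumes X: "mat_pos Path n X"
    and Xe: "\<And>i j. \<lbrakk>i < n; j < n\<rbrakk> \<Longrightarrow> X i j = emb (a i j) (b i j) (c i j)"
    and abc: "a \<in> carrier (cstar_algebra.block_matrices (F\<lparr>carrier := A\<rparr>) (fin_block n))"
      "b \<in> carrier (cstar_algebra.block_matrices (F\<lparr>carrier := A\<rparr>) (fin_block n))"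
      "c \<in> carrier (cstar_algebra.block_matrices (F\<lparr>carrier := A\<rparr>) (fin_block n))"
    and \<delta>: "0 < \<delta>"
    and M: "M = cstar_algebra.block_matrices (F\<lparr>carrier := A\<rparr>) (fin_block n)"
  obtains s t where "s \<in> carrier M" "t \<in> carrier M"
    "s \<oplus>\<^bsub>M\<^esub> t = a \<oplus>\<^bsub>M\<^esub> complex_of_real \<delta> \<odot>\<^bsub>M\<^esub> \<one>\<^bsub>M\<^esub>"
    "s \<oplus>\<^bsub>M\<^esub> b \<in> cstar_pos M" "s \<ominus>\<^bsub>M\<^esub> b \<in> cstar_pos M"
    "t \<oplus>\<^bsub>M\<^esub> c \<in> cstar_pos M" "t \<ominus>\<^bsub>M\<^esub> c \<in> cstar_pos M"
proof -
  interpret S: cstar_algebra "F\<lparr>carrier := A\<rparr>" by (rule sub_cstar[OF A])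
  interpret SB: cstar_blocks "F\<lparr>carrier := A\<rparr>" "fin_block n" by (rule S.fin_block_blocks)
  interpret SM: cstar_algebra "S.Mat n" by (rule SB.BM_cstar)
  interpret P: cstar_blocks F path_block by (rule path_blocks)
  interpret PA: cstar_algebra Path by (rule P.BM_cstar)
  interpret PB: cstar_blocks Path "fin_block n" by (rule PA.fin_block_blocks)
  interpret PM: cstar_algebra "PA.Mat n" by (rule PB.BM_cstar)
  have mem: "a i j \<in> A" "b i j \<in> A" "c i j \<in> A" for i j
    using abc S.Mat_carrier by simp_all
  have memF: "a i j \<in> carrier F" "b i j \<in> carrier F" "c i j \<in> carrier F" for i j
    using mem sub_carrier[OF A] by blast+
  have out: "a i j = \<zero>" "b i j = \<zero>" "c i j = \<zero>" if "\<not> (i < n \<and> j < n)" for i j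
    using abc that S.Mat_carrier by simp_all
  have adj: "star F (a j i) = a i j \<and> star F (b j i) = b i j \<and> star F (c j i) = c i j" for i j
  proof (cases "i < n \<and> j < n")
    case True
    have "star (PA.Mat n) (restr Path n X) = restr Path n X"
      using X unfolding PA.mat_pos_iff by (rule PM.pos_star)
    then have "star (PA.Mat n) (restr Path n X) i j = restr Path n X i j" by (simp only:)
    then have "star Path (restr Path n X j i) = restr Path n X i j" unfolding PB.BM_sel .
    then have "star Path (X j i) = X i j" using True by (simp only: restr_def simp_thms if_True)
    then have eq: "emb (star F (a j i)) (star F (b j i)) (star F (c j i)) = emb (a i j) (b i j) (c i j)"
      using True Xe memF by (simp add: emb_star del: P.BM_sel)
    show ?thesis
      using arg_cong[OF eq, of "\<lambda>f. f (1, 1) (1, 1)"] arg_cong[OF eq, of "\<lambda>f. f (1, 1) (1, 0)"]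
        arg_cong[OF eq, of "\<lambda>f. f (1, 1) (1, 2)"] memF by (simp only: emb_coords star_closed)
  next
    case False
    then show ?thesis using out[of i j] out[of j i] by auto
  qed
  have sa: "star (S.Mat n) a = a" "star (S.Mat n) b = b" "star (S.Mat n) c = c"
    using adj by (simp_all add: fun_eq_iff)
  define e where "e = (\<lambda>k::nat. if even k then c else b)"
  have e: "e k \<in> carrier (S.Mat n)" "star (S.Mat n) (e k) = e k" for k
    using abc sa by (simp_all add: e_def)
  have eA: "e k i j \<in> A" for k i j using mem by (simp add: e_def)
  have tri: "SM.tridiag a e m w \<in> cstar_pos (S.Mat n)" if w: "\<And>k. w k \<in> carrier (S.Mat n)" for m w
  proof (rule SB.BM_pos_formI)
    show "SM.tridiag a e m w \<in> carrier (S.Mat n)"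
      by (rule SM.tridiag_closed[OF abc(1) e(1) w])
    show "star (S.Mat n) (SM.tridiag a e m w) = SM.tridiag a e m w"
      by (rule SM.tridiag_star[OF abc(1) e(1) w sa(1) e(2)])
    fix i v assume v: "S.vec (v :: nat \<Rightarrow> 'a)"
    have vA: "v k \<in> A" for k using v by simp
    have wA: "w k i j \<in> A" for k i j using w[of k] S.Mat_carrier by simp
    have zA: "act (fin_block n) (w k) v i \<in> A" for k i by (rule sub_act_closed[OF wA vA])
    show "S.ip (fin_block n i) v (S.act (fin_block n) (SM.tridiag a e m w) v) \<in> S.pos"
    proof (cases "i < n")
      case True
      have "S.ip {..<n} v (S.act (fin_block n) (SM.tridiag a e m w) v)
          = S.vform n a e m (\<lambda>k. S.act (fin_block n) (w k) v)"
        by (rule S.form_tridiag[OF abc(1) e(1) w v])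
      also have "\<dots> = vform n a e m (\<lambda>k. act (fin_block n) (w k) v)"
        using sub_vform[OF mem(1) eA zA] sub_act[OF wA vA] by simp
      finally have eq: "S.ip {..<n} v (S.act (fin_block n) (SM.tridiag a e m w) v)
          = vform n a e m (\<lambda>k. act (fin_block n) (w k) v)" .
      have "vform n a e m (\<lambda>k. act (fin_block n) (w k) v) \<in> pos"
        unfolding e_def by (rule vform_pos[OF X Xe memF sub_carrier[OF A zA]])
      moreover have "vform n a e m (\<lambda>k. act (fin_block n) (w k) v) \<in> A"
        using S.vform_closed[of a e "\<lambda>k. act (fin_block n) (w k) v" n m] sub_vform[OF mem(1) eA zA] mem eA zA
        by simp
      ultimately show ?thesis using True eq sub_pos[OF A] by (simp add: fin_block_def)
    qed (use S.zero_pos in \<open>simp add: fin_block_def S.ip_def\<close>)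
  qed
  obtain t s where "t \<in> carrier (S.Mat n)" "s \<in> carrier (S.Mat n)"
    "t \<oplus>\<^bsub>S.Mat n\<^esub> s = a \<oplus>\<^bsub>S.Mat n\<^esub> complex_of_real \<delta> \<odot>\<^bsub>S.Mat n\<^esub> \<one>\<^bsub>S.Mat n\<^esub>"
    "t \<oplus>\<^bsub>S.Mat n\<^esub> c \<in> cstar_pos (S.Mat n)" "t \<ominus>\<^bsub>S.Mat n\<^esub> c \<in> cstar_pos (S.Mat n)"
    "s \<oplus>\<^bsub>S.Mat n\<^esub> b \<in> cstar_pos (S.Mat n)" "s \<ominus>\<^bsub>S.Mat n\<^esub> b \<in> cstar_pos (S.Mat n)"
    using SM.tridiag_split[OF abc(3) sa(3) abc(2) sa(2) abc(1) tri[unfolded e_def] \<delta>] by blast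
  then show ?thesis using that[of s t] SM.a_comm[of t s] unfolding M by metis
qed

end

end

subsection \<open>Completely positive maps\<close>

lemma mat_pos_cong:
  "(\<And>i j. \<lbrakk>i < n; j < n\<rbrakk> \<Longrightarrow> X i j = X' i j) \<Longrightarrow> mat_pos D n X \<longleftrightarrow> mat_pos D n X'"
  unfolding mat_pos_def by (intro ex_cong1) auto

lemma cp_onD:
  assumes "cp_on E D C \<phi>"
  shows "x \<in> E \<Longrightarrow> \<phi> x \<in> carrier C"
    and "\<lbrakk>x \<in> E; y \<in> E\<rbrakk> \<Longrightarrow> \<phi> (x \<oplus>\<^bsub>D\<^esub> y) = \<phi> x \<oplus>\<^bsub>C\<^esub> \<phi> y"
    and "x \<in> E \<Longrightarrow> \<phi> (c \<odot>\<^bsub>D\<^esub> x) = c \<odot>\<^bsub>C\<^esub> \<phi> x"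
    and "\<lbrakk>\<And>i j. \<lbrakk>i < n; j < n\<rbrakk> \<Longrightarrow> X i j \<in> E; mat_pos D n X\<rbrakk> \<Longrightarrow> mat_pos C n (\<lambda>i j. \<phi> (X i j))"
  using assms unfolding cp_on_def by blast+

lemma cp_onI:
  assumes "\<And>x. x \<in> E \<Longrightarrow> \<phi> x \<in> carrier C"
    and "\<And>x y. \<lbrakk>x \<in> E; y \<in> E\<rbrakk> \<Longrightarrow> \<phi> (x \<oplus>\<^bsub>D\<^esub> y) = \<phi> x \<oplus>\<^bsub>C\<^esub> \<phi> y"
    and "\<And>c x. x \<in> E \<Longrightarrow> \<phi> (c \<odot>\<^bsub>D\<^esub> x) = c \<odot>\<^bsub>C\<^esub> \<phi> x"
    and "\<And>n X. \<lbrakk>\<And>i j. \<lbrakk>i < n; j < n\<rbrakk> \<Longrightarrow> X i j \<in> E; mat_pos D n X\<rbrakk> \<Longrightarrow> mat_pos C n (\<lambda>i j. \<phi> (X i j))"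
  shows "cp_on E D C \<phi>"
  unfolding cp_on_def using assms by auto

lemma cp_on_cong:
  assumes "cp_on E D C \<phi>" and E: "operator_system E D" and eq: "\<And>x. x \<in> E \<Longrightarrow> \<psi> x = \<phi> x"
  shows "cp_on E D C \<psi>"
proof (rule cp_onI)
  fix n X assume X: "\<And>i j. \<lbrakk>i < n; j < n\<rbrakk> \<Longrightarrow> X i j \<in> E" "mat_pos D n X"
  have "mat_pos C n (\<lambda>i j. \<phi> (X i j))" by (rule cp_onD(4)[OF assms(1) X])
  then show "mat_pos C n (\<lambda>i j. \<psi> (X i j))"
    by (subst mat_pos_cong[of n _ "\<lambda>i j. \<phi> (X i j)"]) (simp_all add: X(1) eq)
qed (use E cp_onD(1-3)[OF assms(1)] in \<open>simp_all add: operator_system_def eq\<close>)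

context cstar_algebra begin

lemma carrier_cstar_subalgebra: "cstar_subalgebra (carrier F) F"
  unfolding cstar_subalgebra_def using carrier_is_subring by auto

lemma carrier_operator_system: "operator_system (carrier F) F"
  unfolding operator_system_def by simp

lemma mat_pos_add:
  assumes "mat_pos F n X" "mat_pos F n Y" shows "mat_pos F n (\<lambda>i j. X i j \<oplus> Y i j)"
proof -
  interpret M: cstar_blocks F "fin_block n" by (rule fin_block_blocks)
  interpret Mn: cstar_algebra "Mat n" by (rule M.BM_cstar)
  have "restr F n X \<oplus>\<^bsub>Mat n\<^esub> restr F n Y \<in> Mn.pos"
    using assms unfolding mat_pos_iff by (rule Mn.pos_add)
  also have "restr F n X \<oplus>\<^bsub>Mat n\<^esub> restr F n Y = restr F n (\<lambda>i j. X i j \<oplus> Y i j)"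
    by (simp add: restr_def fun_eq_iff)
  finally show ?thesis unfolding mat_pos_iff .
qed

lemma cp_on_add:
  assumes D: "operator_system E D" and \<phi>: "cp_on E D F \<phi>" and \<psi>: "cp_on E D F \<psi>"
  shows "cp_on E D F (\<lambda>x. \<phi> x \<oplus> \<psi> x)"
proof (rule cp_onI)
  note c = cp_onD(1)[OF \<phi>] cp_onD(1)[OF \<psi>]
  show "\<phi> x \<oplus> \<psi> x \<in> carrier F" if "x \<in> E" for x using c that by simp
  show "\<phi> (x \<oplus>\<^bsub>D\<^esub> y) \<oplus> \<psi> (x \<oplus>\<^bsub>D\<^esub> y) = \<phi> x \<oplus> \<psi> x \<oplus> (\<phi> y \<oplus> \<psi> y)" if "x \<in> E" "y \<in> E" for x y
    using c that by (simp add: cp_onD(2)[OF \<phi>] cp_onD(2)[OF \<psi>] a_ac)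
  show "\<phi> (r \<odot>\<^bsub>D\<^esub> x) \<oplus> \<psi> (r \<odot>\<^bsub>D\<^esub> x) = r \<odot> (\<phi> x \<oplus> \<psi> x)" if "x \<in> E" for r x
    using c that by (simp add: cp_onD(3)[OF \<phi>] cp_onD(3)[OF \<psi>] smult_add_right)
  show "mat_pos F n (\<lambda>i j. \<phi> (X i j) \<oplus> \<psi> (X i j))"
    if "\<And>i j. \<lbrakk>i < n; j < n\<rbrakk> \<Longrightarrow> X i j \<in> E" "mat_pos D n X" for n X
    by (intro mat_pos_add cp_onD(4)[OF \<phi>] cp_onD(4)[OF \<psi>] that)
qed

definition path_functional :: "('d \<Rightarrow> 'a) \<Rightarrow> ('d \<Rightarrow> 'a) \<Rightarrow> ('d \<Rightarrow> 'a) \<Rightarrow> ('d \<Rightarrow> 'a)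
    \<Rightarrow> (nat \<times> nat \<Rightarrow> nat \<times> nat \<Rightarrow> 'd) \<Rightarrow> 'a" where
  "path_functional \<phi>1 \<phi>2 \<phi>3 \<phi>4 Y = \<phi>1 (Y (1, 1) (1, 1)) \<oplus> \<phi>2 (Y (1, 1) (1, 1))
     \<oplus> (\<phi>1 (Y (1, 1) (1, 0)) \<ominus> \<phi>2 (Y (1, 1) (1, 0)))
     \<oplus> (\<phi>3 (Y (1, 1) (1, 2)) \<ominus> \<phi>4 (Y (1, 1) (1, 2)))"

end

lemma cp_diff:
  assumes "cstar_algebra S" "cstar_algebra C" "completely_positive S C \<phi>" "x \<in> carrier S" "y \<in> carrier S"
  shows "\<phi> (x \<ominus>\<^bsub>S\<^esub> y) = \<phi> x \<ominus>\<^bsub>C\<^esub> \<phi> y"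
proof -
  interpret S: cstar_algebra S by fact
  interpret C: cstar_algebra C by fact
  note cp = assms(3)[unfolded completely_positive_def]
  have "\<phi> (x \<ominus>\<^bsub>S\<^esub> y) = \<phi> x \<oplus>\<^bsub>C\<^esub> (-1) \<odot>\<^bsub>C\<^esub> \<phi> y"
    using assms(4,5) cp_onD(2)[OF cp, of x "(-1) \<odot>\<^bsub>S\<^esub> y"] cp_onD(3)[OF cp, of y "-1"]
    by (simp add: a_minus_def S.smult_minus_one)
  then show ?thesis using cp_onD(1)[OF cp assms(5)] by (simp add: a_minus_def C.smult_minus_one)
qed

lemma cp_zero:
  assumes "cstar_algebra S" "cstar_algebra C" "completely_positive S C \<phi>" shows "\<phi> \<zero>\<^bsub>S\<^esub> = \<zero>\<^bsub>C\<^esub>"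
proof -
  interpret S: cstar_algebra S by fact
  interpret C: cstar_algebra C by fact
  note cp = assms(3)[unfolded completely_positive_def]
  show ?thesis using cp_onD(3)[OF cp S.zero_closed, of 0] cp_onD(1)[OF cp S.zero_closed] by simp
qed

lemma path_functional_cp:
  assumes B: "cstar_algebra B" and A: "cstar_subalgebra A B" and C: "cstar_algebra C"
    and S: "S = B\<lparr>carrier := A\<rparr>"
    and cp: "completely_positive S C \<phi>1" "completely_positive S C \<phi>2"
      "completely_positive S C \<phi>3" "completely_positive S C \<phi>4"
    and eq: "\<And>a. a \<in> A \<Longrightarrow> \<phi>1 a \<oplus>\<^bsub>C\<^esub> \<phi>2 a = \<phi>3 a \<oplus>\<^bsub>C\<^esub> \<phi>4 a"
  shows "cp_on (cstar_algebra.emb_set B A) (cstar_algebra.block_matrices B path_block) C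
    (cstar_algebra.path_functional C \<phi>1 \<phi>2 \<phi>3 \<phi>4)"
proof -
  interpret B: cstar_algebra B by fact
  interpret C: cstar_algebra C by fact
  interpret S: cstar_algebra S unfolding S by (rule B.sub_cstar[OF A])
  interpret PB: cstar_blocks B path_block by (rule B.path_blocks)
  have Sc: "carrier S = A" by (simp add: S)
  have AB: "a \<in> carrier B" if "a \<in> A" for a by (rule B.sub_carrier[OF A that])
  note on = cp[unfolded completely_positive_def Sc]
  note cl = on[THEN cp_onD(1)]
  have add: "add S = add B" "smult S = smult B" by (simp_all add: S)
  note ad = on[THEN cp_onD(2), unfolded add] and sm = on[THEN cp_onD(3), unfolded add]
  let ?\<Phi> = "C.path_functional \<phi>1 \<phi>2 \<phi>3 \<phi>4"
  have \<Phi>: "?\<Phi> (B.emb a b c) = \<phi>1 a \<oplus>\<^bsub>C\<^esub> \<phi>2 a \<oplus>\<^bsub>C\<^esub> (\<phi>1 b \<ominus>\<^bsub>C\<^esub> \<phi>2 b) \<oplus>\<^bsub>C\<^esub> (\<phi>3 c \<ominus>\<^bsub>C\<^esub> \<phi>4 c)"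
    if "a \<in> A" "b \<in> A" "c \<in> A" for a b c
    unfolding C.path_functional_def using B.emb_coords(1-3)[OF that[THEN AB]] by (simp only:)
  show ?thesis
  proof (rule cp_onI)
    fix x assume "x \<in> B.emb_set A"
    then obtain a b c where x: "x = B.emb a b c" "a \<in> A" "b \<in> A" "c \<in> A" unfolding B.emb_set_def by blast
    show "?\<Phi> x \<in> carrier C" unfolding x(1) \<Phi>[OF x(2-4)] using x cl by simp
    show "?\<Phi> (r \<odot>\<^bsub>B.Path\<^esub> x) = r \<odot>\<^bsub>C\<^esub> ?\<Phi> x" for r
      unfolding x(1) \<Phi>[OF x(2-4)] B.emb_smult[OF x(2-4)[THEN AB]]
      using x cl by (subst \<Phi>) (simp_all add: B.sub_closed[OF A] sm C.smult_add_right C.smult_diff_right)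
    fix y assume "y \<in> B.emb_set A"
    then obtain a' b' c' where y: "y = B.emb a' b' c'" "a' \<in> A" "b' \<in> A" "c' \<in> A"
      unfolding B.emb_set_def by blast
    have "?\<Phi> (x \<oplus>\<^bsub>B.Path\<^esub> y) = \<phi>1 a \<oplus>\<^bsub>C\<^esub> \<phi>1 a' \<oplus>\<^bsub>C\<^esub> (\<phi>2 a \<oplus>\<^bsub>C\<^esub> \<phi>2 a')
        \<oplus>\<^bsub>C\<^esub> (\<phi>1 b \<oplus>\<^bsub>C\<^esub> \<phi>1 b' \<ominus>\<^bsub>C\<^esub> (\<phi>2 b \<oplus>\<^bsub>C\<^esub> \<phi>2 b')) \<oplus>\<^bsub>C\<^esub> (\<phi>3 c \<oplus>\<^bsub>C\<^esub> \<phi>3 c' \<ominus>\<^bsub>C\<^esub> (\<phi>4 c \<oplus>\<^bsub>C\<^esub> \<phi>4 c'))"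
      unfolding x(1) y(1) B.emb_add[OF x(2-4)[THEN AB] y(2-4)[THEN AB]]
      using x y by (subst \<Phi>) (simp_all add: B.sub_closed[OF A] ad)
    also have "\<dots> = ?\<Phi> x \<oplus>\<^bsub>C\<^esub> ?\<Phi> y"
      unfolding x(1) y(1) \<Phi>[OF x(2-4)] \<Phi>[OF y(2-4)]
      using cl(1)[OF x(2)] cl(2)[OF x(2)] cl(1)[OF y(2)] cl(2)[OF y(2)] cl(1)[OF x(3)] cl(2)[OF x(3)]
        cl(1)[OF y(3)] cl(2)[OF y(3)] cl(3)[OF x(4)] cl(4)[OF x(4)] cl(3)[OF y(4)] cl(4)[OF y(4)]
      by (simp add: C.minus_eq C.minus_add C.a_ac)
    finally show "?\<Phi> (x \<oplus>\<^bsub>B.Path\<^esub> y) = ?\<Phi> x \<oplus>\<^bsub>C\<^esub> ?\<Phi> y" .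
  next
    fix n X assume XE: "\<And>i j. \<lbrakk>i < n; j < n\<rbrakk> \<Longrightarrow> X i j \<in> B.emb_set A" and X: "mat_pos B.Path n X"
    interpret SB: cstar_blocks S "fin_block n" by (rule S.fin_block_blocks)
    interpret SM: cstar_algebra "S.Mat n" by (rule SB.BM_cstar)
    interpret CB: cstar_blocks C "fin_block n" by (rule C.fin_block_blocks)
    interpret CM: cstar_algebra "C.Mat n" by (rule CB.BM_cstar)
    define a where "a = restr S n (\<lambda>i j. X i j (1, 1) (1, 1))"
    define b where "b = restr S n (\<lambda>i j. X i j (1, 1) (1, 0))"
    define c where "c = restr S n (\<lambda>i j. X i j (1, 1) (1, 2))"
    have ent: "X i j = B.emb (a i j) (b i j) (c i j) \<and> a i j \<in> A \<and> b i j \<in> A \<and> c i j \<in> A"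
      if ij: "i < n" "j < n" for i j
    proof -
      obtain a' b' c' where "X i j = B.emb a' b' c'" "a' \<in> A" "b' \<in> A" "c' \<in> A"
        using XE[OF ij] unfolding B.emb_set_def by blast
      then show ?thesis using ij B.emb_coords(1-3)[of a' b' c'] AB by (simp add: a_def b_def c_def restr_def)
    qed
    have in_A: "X i j (1, 1) (1, 1) \<in> A" "X i j (1, 1) (1, 0) \<in> A" "X i j (1, 1) (1, 2) \<in> A"
      if "i < n" "j < n" for i j
      using ent[OF that] that by (simp_all add: a_def b_def c_def restr_def)
    have abc: "a \<in> carrier (S.Mat n)" "b \<in> carrier (S.Mat n)" "c \<in> carrier (S.Mat n)"
      unfolding a_def b_def c_def by (rule S.restr_carrier, unfold Sc, erule (1) in_A)+
    have cpM: "restr C n (\<lambda>i j. \<phi> (x i j)) \<in> CM.pos"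
      if "cp_on A S C \<phi>" "x \<in> SM.pos" for \<phi> x
    proof -
      have xc: "x \<in> carrier (S.Mat n)" using that(2) by simp
      have "mat_pos S n x" using that(2) S.restr_Mat[OF xc] by (simp add: S.mat_pos_iff)
      moreover have "x i j \<in> A" for i j using xc Sc S.Mat_carrier by auto
      ultimately show ?thesis using cp_onD(4)[OF that(1)] unfolding C.mat_pos_iff by blast
    qed
    define Z where "Z = restr C n (\<lambda>i j. ?\<Phi> (X i j))"
    define I where "I = \<one>\<^bsub>S.Mat n\<^esub>"
    define W where "W = restr C n (\<lambda>i j. \<phi>1 (I i j) \<oplus>\<^bsub>C\<^esub> \<phi>2 (I i j))"
    have IA: "I i j \<in> A" for i j using S.one_closed S.zero_closed by (auto simp: I_def Sc)
    have Zc: "Z \<in> carrier (C.Mat n)" unfolding Z_def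
      using ent \<Phi> cl by (intro C.restr_carrier) simp
    have Wc: "W \<in> carrier (C.Mat n)" unfolding W_def
      using IA cl by (intro C.restr_carrier) simp
    have "Z \<in> CM.pos"
    proof (rule CM.pos_archimedean[OF Zc Wc])
      fix \<delta> :: real assume "0 < \<delta>"
      then obtain s t where s: "s \<in> carrier (S.Mat n)" and t: "t \<in> carrier (S.Mat n)"
        and st: "s \<oplus>\<^bsub>S.Mat n\<^esub> t = a \<oplus>\<^bsub>S.Mat n\<^esub> complex_of_real \<delta> \<odot>\<^bsub>S.Mat n\<^esub> I"
        and p: "s \<oplus>\<^bsub>S.Mat n\<^esub> b \<in> SM.pos" "s \<ominus>\<^bsub>S.Mat n\<^esub> b \<in> SM.pos"
          "t \<oplus>\<^bsub>S.Mat n\<^esub> c \<in> SM.pos" "t \<ominus>\<^bsub>S.Mat n\<^esub> c \<in> SM.pos"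
        using B.path_pos_split[OF A X _ abc[unfolded S] _ refl, of \<delta>] ent unfolding I_def S by blast
      have mem: "s i j \<in> A" "t i j \<in> A" "a i j \<in> A" "b i j \<in> A" "c i j \<in> A" for i j
        using s t abc S.Mat_carrier Sc by simp_all
      let ?P1 = "restr C n (\<lambda>i j. \<phi>1 ((s \<oplus>\<^bsub>S.Mat n\<^esub> b) i j))"
      let ?P2 = "restr C n (\<lambda>i j. \<phi>2 ((s \<ominus>\<^bsub>S.Mat n\<^esub> b) i j))"
      let ?P3 = "restr C n (\<lambda>i j. \<phi>3 ((t \<oplus>\<^bsub>S.Mat n\<^esub> c) i j))"
      let ?P4 = "restr C n (\<lambda>i j. \<phi>4 ((t \<ominus>\<^bsub>S.Mat n\<^esub> c) i j))"
      have "Z \<oplus>\<^bsub>C.Mat n\<^esub> complex_of_real \<delta> \<odot>\<^bsub>C.Mat n\<^esub> W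
          = ?P1 \<oplus>\<^bsub>C.Mat n\<^esub> ?P2 \<oplus>\<^bsub>C.Mat n\<^esub> (?P3 \<oplus>\<^bsub>C.Mat n\<^esub> ?P4)"
      proof (intro ext)
        fix i j
        show "(Z \<oplus>\<^bsub>C.Mat n\<^esub> complex_of_real \<delta> \<odot>\<^bsub>C.Mat n\<^esub> W) i j
          = (?P1 \<oplus>\<^bsub>C.Mat n\<^esub> ?P2 \<oplus>\<^bsub>C.Mat n\<^esub> (?P3 \<oplus>\<^bsub>C.Mat n\<^esub> ?P4)) i j"
        proof (cases "i < n \<and> j < n")
          case False
          then show ?thesis by (auto simp: Z_def W_def restr_def)
        next
          case True
          let ?s = "s i j" and ?t = "t i j" and ?a = "a i j" and ?b = "b i j" and ?c = "c i j"
          note m = mem[of i j]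
          have "(s \<oplus>\<^bsub>S.Mat n\<^esub> t) i j = (a \<oplus>\<^bsub>S.Mat n\<^esub> complex_of_real \<delta> \<odot>\<^bsub>S.Mat n\<^esub> I) i j"
            unfolding st ..
          then have st': "?s \<oplus>\<^bsub>B\<^esub> ?t = ?a \<oplus>\<^bsub>B\<^esub> complex_of_real \<delta> \<odot>\<^bsub>B\<^esub> I i j"
            by (simp add: add)
          have st1: "\<phi> ?s \<oplus>\<^bsub>C\<^esub> \<phi> ?t = \<phi> ?a \<oplus>\<^bsub>C\<^esub> complex_of_real \<delta> \<odot>\<^bsub>C\<^esub> \<phi> (I i j)"
            if "cp_on A S C \<phi>" for \<phi>
          proof -
            have "\<phi> (?s \<oplus>\<^bsub>B\<^esub> ?t) = \<phi> ?s \<oplus>\<^bsub>C\<^esub> \<phi> ?t"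
              by (rule cp_onD(2)[OF that, unfolded add, OF m(1,2)])
            moreover have "\<phi> (?a \<oplus>\<^bsub>B\<^esub> complex_of_real \<delta> \<odot>\<^bsub>B\<^esub> I i j) = \<phi> ?a \<oplus>\<^bsub>C\<^esub> complex_of_real \<delta> \<odot>\<^bsub>C\<^esub> \<phi> (I i j)"
              using cp_onD(2,3)[OF that, unfolded add] m(3) IA B.sub_closed(1)[OF A] by simp
            ultimately show ?thesis using st' by simp
          qed
          note cc = cl(1)[OF m(1)] cl(2)[OF m(1)] cl(1)[OF m(2)] cl(2)[OF m(2)] cl(3)[OF m(2)] cl(4)[OF m(2)]
            cl(1)[OF m(3)] cl(2)[OF m(3)] cl(1)[OF m(4)] cl(2)[OF m(4)] cl(3)[OF m(5)] cl(4)[OF m(5)]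
          have ic: "complex_of_real \<delta> \<odot>\<^bsub>C\<^esub> \<phi>1 (I i j) \<in> carrier C" "complex_of_real \<delta> \<odot>\<^bsub>C\<^esub> \<phi>2 (I i j) \<in> carrier C"
            using cl(1,2)[OF IA] by simp_all
          have "(?P1 \<oplus>\<^bsub>C.Mat n\<^esub> ?P2 \<oplus>\<^bsub>C.Mat n\<^esub> (?P3 \<oplus>\<^bsub>C.Mat n\<^esub> ?P4)) i j
              = \<phi>1 (?s \<oplus>\<^bsub>B\<^esub> ?b) \<oplus>\<^bsub>C\<^esub> \<phi>2 (?s \<ominus>\<^bsub>S\<^esub> ?b) \<oplus>\<^bsub>C\<^esub> (\<phi>3 (?t \<oplus>\<^bsub>B\<^esub> ?c) \<oplus>\<^bsub>C\<^esub> \<phi>4 (?t \<ominus>\<^bsub>S\<^esub> ?c))"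
            using True s t abc by (simp add: restr_def SB.BM_a_minus add)
          also have "\<dots> = (\<phi>1 ?s \<oplus>\<^bsub>C\<^esub> \<phi>1 ?b) \<oplus>\<^bsub>C\<^esub> (\<phi>2 ?s \<ominus>\<^bsub>C\<^esub> \<phi>2 ?b)
              \<oplus>\<^bsub>C\<^esub> ((\<phi>3 ?t \<oplus>\<^bsub>C\<^esub> \<phi>3 ?c) \<oplus>\<^bsub>C\<^esub> (\<phi>4 ?t \<ominus>\<^bsub>C\<^esub> \<phi>4 ?c))"
            using m ad cp_diff[OF S.cstar_algebra_axioms C cp(2)] cp_diff[OF S.cstar_algebra_axioms C cp(4)]
            by (simp add: Sc)
          also have "\<dots> = \<phi>1 ?s \<oplus>\<^bsub>C\<^esub> \<phi>2 ?s \<oplus>\<^bsub>C\<^esub> (\<phi>3 ?t \<oplus>\<^bsub>C\<^esub> \<phi>4 ?t)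
              \<oplus>\<^bsub>C\<^esub> (\<phi>1 ?b \<ominus>\<^bsub>C\<^esub> \<phi>2 ?b) \<oplus>\<^bsub>C\<^esub> (\<phi>3 ?c \<ominus>\<^bsub>C\<^esub> \<phi>4 ?c)"
            using cc by (simp add: C.minus_eq C.a_ac)
          also have "\<phi>3 ?t \<oplus>\<^bsub>C\<^esub> \<phi>4 ?t = \<phi>1 ?t \<oplus>\<^bsub>C\<^esub> \<phi>2 ?t"
            by (rule eq[OF m(2), symmetric])
          also have "\<phi>1 ?s \<oplus>\<^bsub>C\<^esub> \<phi>2 ?s \<oplus>\<^bsub>C\<^esub> (\<phi>1 ?t \<oplus>\<^bsub>C\<^esub> \<phi>2 ?t)
              = (\<phi>1 ?s \<oplus>\<^bsub>C\<^esub> \<phi>1 ?t) \<oplus>\<^bsub>C\<^esub> (\<phi>2 ?s \<oplus>\<^bsub>C\<^esub> \<phi>2 ?t)"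
            using cc by (simp add: C.a_ac)
          also have "\<dots> = (\<phi>1 ?a \<oplus>\<^bsub>C\<^esub> complex_of_real \<delta> \<odot>\<^bsub>C\<^esub> \<phi>1 (I i j))
              \<oplus>\<^bsub>C\<^esub> (\<phi>2 ?a \<oplus>\<^bsub>C\<^esub> complex_of_real \<delta> \<odot>\<^bsub>C\<^esub> \<phi>2 (I i j))"
            unfolding st1[OF on(1)] st1[OF on(2)] ..
          also have "\<dots> \<oplus>\<^bsub>C\<^esub> (\<phi>1 ?b \<ominus>\<^bsub>C\<^esub> \<phi>2 ?b) \<oplus>\<^bsub>C\<^esub> (\<phi>3 ?c \<ominus>\<^bsub>C\<^esub> \<phi>4 ?c)
              = (\<phi>1 ?a \<oplus>\<^bsub>C\<^esub> \<phi>2 ?a \<oplus>\<^bsub>C\<^esub> (\<phi>1 ?b \<ominus>\<^bsub>C\<^esub> \<phi>2 ?b) \<oplus>\<^bsub>C\<^esub> (\<phi>3 ?c \<ominus>\<^bsub>C\<^esub> \<phi>4 ?c))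
              \<oplus>\<^bsub>C\<^esub> (complex_of_real \<delta> \<odot>\<^bsub>C\<^esub> \<phi>1 (I i j) \<oplus>\<^bsub>C\<^esub> complex_of_real \<delta> \<odot>\<^bsub>C\<^esub> \<phi>2 (I i j))"
            using cc ic by (simp add: C.minus_eq C.a_ac)
          also have "\<dots> = ?\<Phi> (X i j) \<oplus>\<^bsub>C\<^esub> complex_of_real \<delta> \<odot>\<^bsub>C\<^esub> (\<phi>1 (I i j) \<oplus>\<^bsub>C\<^esub> \<phi>2 (I i j))"
          proof -
            have "X i j = B.emb ?a ?b ?c" using ent True by blast
            then show ?thesis using \<Phi>[OF m(3-5)] cl(1,2)[OF IA] by (simp add: C.smult_add_right)
          qed
          also have "\<dots> = (Z \<oplus>\<^bsub>C.Mat n\<^esub> complex_of_real \<delta> \<odot>\<^bsub>C.Mat n\<^esub> W) i j"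
            using True by (simp add: Z_def W_def restr_def)
          finally show ?thesis by (rule sym)
        qed
      qed
      also have "\<dots> \<in> CM.pos"
        by (intro CM.pos_add cpM on p)
      finally show "Z \<oplus>\<^bsub>C.Mat n\<^esub> complex_of_real \<delta> \<odot>\<^bsub>C.Mat n\<^esub> W \<in> CM.pos" .
    qed
    then show "mat_pos C n (\<lambda>i j. ?\<Phi> (X i j))" unfolding C.mat_pos_iff Z_def .
  qed
qed

context cstar_algebra begin

text \<open>\<open>x \<otimes> (1 + e \<sigma>) / 2\<close>, where \<open>(1 + e \<sigma>) / 2\<close> is a projection if \<open>e\<^sup>2 = 1\<close>.\<close>

definition refl_proj :: "('i \<Rightarrow> 'i) \<Rightarrow> real \<Rightarrow> 'a \<Rightarrow> 'i \<Rightarrow> 'i \<Rightarrow> 'a" where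
  "refl_proj \<sigma> e x = (\<lambda>p q. (if q = p then (1/2) \<odot> x else \<zero>)
     \<oplus> (if q = \<sigma> p then (complex_of_real e / 2) \<odot> x else \<zero>))"

lemma refl_proj_closed [simp]: "x \<in> carrier F \<Longrightarrow> refl_proj \<sigma> e x p q \<in> carrier F"
  by (simp add: refl_proj_def)

lemma refl_proj_emb:
  assumes "x \<in> carrier F"
  shows "refl_proj path_u e x = emb ((1/2) \<odot> x) ((complex_of_real e / 2) \<odot> x) \<zero>"
    and "refl_proj path_v e x = emb ((1/2) \<odot> x) \<zero> ((complex_of_real e / 2) \<odot> x)"
  using assms by (simp_all add: refl_proj_def emb_def fun_eq_iff)

end

context cstar_blocks begin

lemma refl_proj_carrier:
  assumes x: "x \<in> carrier F" and \<sigma>: "\<And>p. \<sigma> p \<in> K p" "\<And>p. \<sigma> (\<sigma> p) = p"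
  shows "refl_proj \<sigma> e x \<in> carrier BM"
proof -
  have "p \<in> K p" for p using block_refl[OF \<sigma>(1)] .
  then have "perm_mat id ((1/2) \<odot> x) \<oplus>\<^bsub>BM\<^esub> perm_mat \<sigma> ((complex_of_real e / 2) \<odot> x) \<in> carrier BM"
    using x \<sigma> by (intro BM_add_closed perm_mat_carrier) simp_all
  then show ?thesis by (simp add: refl_proj_def perm_mat_def)
qed

lemma act_refl_proj:
  assumes x: "x \<in> carrier F" and \<xi>: "vec \<xi>" and \<sigma>: "\<sigma> p \<in> K p"
  shows "act K (refl_proj \<sigma> e x) \<xi> p = (1/2) \<odot> (x \<otimes> \<xi> p) \<oplus> (complex_of_real e / 2) \<odot> (x \<otimes> \<xi> (\<sigma> p))"
proof -
  have "p \<in> K p" using block_refl[OF \<sigma>] .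
  have "act K (refl_proj \<sigma> e x) \<xi> p = act K (perm_mat id ((1/2) \<odot> x)) \<xi> p
      \<oplus> act K (perm_mat \<sigma> ((complex_of_real e / 2) \<odot> x)) \<xi> p"
    using act_add[of "perm_mat id ((1/2) \<odot> x)" "perm_mat \<sigma> ((complex_of_real e / 2) \<odot> x)" \<xi>] x \<xi>
    by (simp add: perm_mat_def refl_proj_def)
  then show ?thesis
    using x \<xi> \<sigma> \<open>p \<in> K p\<close> by (simp add: act_perm_mat smult_mult_left)
qed

lemma refl_proj_star_mult:
  assumes x: "x \<in> carrier F" and y: "y \<in> carrier F" and \<sigma>: "\<And>p. \<sigma> p \<in> K p" "\<And>p. \<sigma> (\<sigma> p) = p"
    and e: "e * e = 1"
  shows "star BM (refl_proj \<sigma> e x) \<otimes>\<^bsub>BM\<^esub> refl_proj \<sigma> e y = refl_proj \<sigma> e (star F x \<otimes> y)"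
proof (intro ext)
  fix p q :: 'i
  have sym: "p = \<sigma> q \<longleftrightarrow> q = \<sigma> p" "p = q \<longleftrightarrow> q = p" for p q using \<sigma>(2) by metis+
  have "star F ((if P then (1/2) \<odot> x else \<zero>) \<oplus> (if Q then (complex_of_real e / 2) \<odot> x else \<zero>))
    = (if P then (1/2) \<odot> star F x else \<zero>) \<oplus> (if Q then (complex_of_real e / 2) \<odot> star F x else \<zero>)" for P Q
    using x by (cases P; cases Q) (simp_all add: star_add star_smult)
  then have st: "star BM (refl_proj \<sigma> e x) = refl_proj \<sigma> e (star F x)"
    unfolding BM_sel refl_proj_def by (subst (1 2) sym) simp
  define w where "w = star F x \<otimes> y"
  have w: "w \<in> carrier F" using x y by (simp add: w_def)
  define h where "h = (1/2::complex)"
  define k where "k = (complex_of_real e / 2)"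
  have "k * k = complex_of_real (e * e) / 4" by (simp add: k_def)
  also have "\<dots> = 1 / 4" by (simp only: e of_real_1)
  finally have kk: "k * k = 1 / 4" .
  have hk: "h * h + k * k = h" "h * k + k * h = k" unfolding kk by (simp_all add: h_def)
  define \<alpha> where "\<alpha> = (if q = p then w else \<zero>)"
  define \<beta> where "\<beta> = (if q = \<sigma> p then w else \<zero>)"
  have c: "\<alpha> \<in> carrier F" "\<beta> \<in> carrier F" using w by (simp_all add: \<alpha>_def \<beta>_def)
  have m: "star F x \<otimes> ((if P then h \<odot> y else \<zero>) \<oplus> (if Q then k \<odot> y else \<zero>))
    = h \<odot> (if P then w else \<zero>) \<oplus> k \<odot> (if Q then w else \<zero>)" for P Q
    using x y by (cases P; cases Q) (simp_all add: w_def r_distr smult_mult_right)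
  have "(star BM (refl_proj \<sigma> e x) \<otimes>\<^bsub>BM\<^esub> refl_proj \<sigma> e y) p q
      = h \<odot> (star F x \<otimes> refl_proj \<sigma> e y p q) \<oplus> k \<odot> (star F x \<otimes> refl_proj \<sigma> e y (\<sigma> p) q)"
    unfolding st BM_sel(1) using x y \<sigma>(1) by (subst act_refl_proj) (simp_all add: h_def k_def)
  also have "star F x \<otimes> refl_proj \<sigma> e y p q = h \<odot> \<alpha> \<oplus> k \<odot> \<beta>"
    unfolding refl_proj_def h_def[symmetric] k_def[symmetric] m \<alpha>_def \<beta>_def ..
  also have "star F x \<otimes> refl_proj \<sigma> e y (\<sigma> p) q = h \<odot> \<beta> \<oplus> k \<odot> \<alpha>"
    unfolding refl_proj_def h_def[symmetric] k_def[symmetric] m \<alpha>_def \<beta>_def \<sigma>(2) ..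
  also have "h \<odot> (h \<odot> \<alpha> \<oplus> k \<odot> \<beta>) \<oplus> k \<odot> (h \<odot> \<beta> \<oplus> k \<odot> \<alpha>)
      = ((h * h) \<odot> \<alpha> \<oplus> (k * k) \<odot> \<alpha>) \<oplus> ((h * k) \<odot> \<beta> \<oplus> (k * h) \<odot> \<beta>)"
    using c by (simp add: smult_add_right smult_smult a_ac)
  also have "\<dots> = h \<odot> \<alpha> \<oplus> k \<odot> \<beta>"
    using c by (simp only: smult_add_left[symmetric] hk)
  also have "\<dots> = refl_proj \<sigma> e w p q"
    using w by (simp add: refl_proj_def \<alpha>_def \<beta>_def h_def k_def)
  finally show "(star BM (refl_proj \<sigma> e x) \<otimes>\<^bsub>BM\<^esub> refl_proj \<sigma> e y) p q = refl_proj \<sigma> e (star F x \<otimes> y) p q"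
    by (simp only: w_def)
qed

lemma refl_proj_mat_pos:
  assumes X: "mat_pos F n X" and \<sigma>: "\<And>p. \<sigma> p \<in> K p" "\<And>p. \<sigma> (\<sigma> p) = p" and e: "e * e = 1"
  shows "mat_pos BM n (\<lambda>i j. refl_proj \<sigma> e (X i j))"
proof -
  interpret BM: cstar_algebra BM by (rule BM_cstar)
  obtain Y0 where Y0: "\<forall>i<n. \<forall>j<n. Y0 i j \<in> carrier F"
    and X0: "\<forall>i<n. \<forall>j<n. X i j = (\<Oplus>k\<in>{..<n}. star F (Y0 k i) \<otimes> Y0 k j)"
    using X unfolding mat_pos_def by blast
  define Y where "Y = restr F n Y0"
  have Y: "Y i j \<in> carrier F" for i j using Y0 by (simp add: Y_def restr_def)
  have XY: "X i j = (\<Oplus>k\<in>{..<n}. star F (Y k i) \<otimes> Y k j)" if "i < n" "j < n" for i j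
  proof -
    have "X i j = (\<Oplus>k\<in>{..<n}. star F (Y0 k i) \<otimes> Y0 k j)" using X0 that by blast
    also have "\<dots> = (\<Oplus>k\<in>{..<n}. star F (Y k i) \<otimes> Y k j)"
      using Y0 that by (intro sum_cong) (simp_all add: Y_def restr_def)
    finally show ?thesis .
  qed
  have sum: "refl_proj \<sigma> e (\<Oplus>k\<in>{..<n}. f k) = (\<Oplus>\<^bsub>BM\<^esub>k\<in>{..<n}. refl_proj \<sigma> e (f k))"
    if f: "\<And>k. f k \<in> carrier F" for f :: "nat \<Rightarrow> 'a"
  proof -
    have "(if P then (1/2) \<odot> (\<Oplus>k\<in>{..<n}. f k) else \<zero>)
        \<oplus> (if Q then (complex_of_real e / 2) \<odot> (\<Oplus>k\<in>{..<n}. f k) else \<zero>)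
      = (\<Oplus>k\<in>{..<n}. (if P then (1/2) \<odot> f k else \<zero>) \<oplus> (if Q then (complex_of_real e / 2) \<odot> f k else \<zero>))" for P Q
      using f by (cases P; cases Q) (simp_all add: sum_smult sum_add)
    then have "refl_proj \<sigma> e (\<Oplus>k\<in>{..<n}. f k) = (\<lambda>p q. \<Oplus>k\<in>{..<n}. refl_proj \<sigma> e (f k) p q)"
      unfolding refl_proj_def by simp
    also have "\<dots> = (\<Oplus>\<^bsub>BM\<^esub>k\<in>{..<n}. refl_proj \<sigma> e (f k))"
      using refl_proj_carrier[OF f \<sigma>] by (intro BM_finsum[symmetric]) simp_all
    finally show ?thesis .
  qed
  show ?thesis unfolding mat_pos_def
  proof (intro exI[of _ "\<lambda>i j. refl_proj \<sigma> e (Y i j)"] conjI allI impI)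
    show "refl_proj \<sigma> e (Y i j) \<in> carrier BM" for i j by (rule refl_proj_carrier[OF Y \<sigma>])
    fix i j assume ij: "i < n" "j < n"
    have "refl_proj \<sigma> e (X i j) = (\<Oplus>\<^bsub>BM\<^esub>k\<in>{..<n}. refl_proj \<sigma> e (star F (Y k i) \<otimes> Y k j))"
      unfolding XY[OF ij] using Y by (intro sum) simp
    also have "\<dots> = (\<Oplus>\<^bsub>BM\<^esub>k\<in>{..<n}. star BM (refl_proj \<sigma> e (Y k i)) \<otimes>\<^bsub>BM\<^esub> refl_proj \<sigma> e (Y k j))"
      unfolding refl_proj_star_mult[OF Y Y \<sigma> e] ..
    finally show "refl_proj \<sigma> e (X i j)
      = (\<Oplus>\<^bsub>BM\<^esub>k\<in>{..<n}. star BM (refl_proj \<sigma> e (Y k i)) \<otimes>\<^bsub>BM\<^esub> refl_proj \<sigma> e (Y k j))" .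
  qed
qed

end

context cstar_algebra begin

lemma cp_refl_proj:
  assumes \<Psi>: "cp_on (emb_set (carrier F)) Path C \<Psi>" and \<sigma>: "\<sigma> = path_u \<or> \<sigma> = path_v" and e: "e * e = 1"
  shows "completely_positive F C (\<lambda>x. \<Psi> (refl_proj \<sigma> e x))"
  unfolding completely_positive_def
proof (rule cp_onI)
  interpret P: cstar_blocks F path_block by (rule path_blocks)
  have mem: "refl_proj \<sigma> e x \<in> emb_set (carrier F)" if "x \<in> carrier F" for x
    using \<sigma> that refl_proj_emb[OF that, of e] unfolding emb_set_def
    by (metis (mono_tags, lifting) mem_Collect_eq smult_closed zero_closed)
  fix x assume x: "x \<in> carrier F"
  show "\<Psi> (refl_proj \<sigma> e x) \<in> carrier C" by (rule cp_onD(1)[OF \<Psi> mem[OF x]])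
  have "(if P then (1/2) \<odot> (r \<odot> x) else \<zero>) \<oplus> (if Q then (complex_of_real e / 2) \<odot> (r \<odot> x) else \<zero>)
    = r \<odot> ((if P then (1/2) \<odot> x else \<zero>) \<oplus> (if Q then (complex_of_real e / 2) \<odot> x else \<zero>))" for P Q r
    using x by (cases P; cases Q) (simp_all add: smult_add_right mult.commute[of r] flip: smult_smult)
  then have "refl_proj \<sigma> e (r \<odot> x) = r \<odot>\<^bsub>Path\<^esub> refl_proj \<sigma> e x" for r
    unfolding refl_proj_def P.BM_sel by (simp only:)
  then show "\<Psi> (refl_proj \<sigma> e (r \<odot> x)) = r \<odot>\<^bsub>C\<^esub> \<Psi> (refl_proj \<sigma> e x)" for r
    using cp_onD(3)[OF \<Psi> mem[OF x]] by (simp only:)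
  fix y assume y: "y \<in> carrier F"
  have "(if P then (1/2) \<odot> (x \<oplus> y) else \<zero>) \<oplus> (if Q then (complex_of_real e / 2) \<odot> (x \<oplus> y) else \<zero>)
    = ((if P then (1/2) \<odot> x else \<zero>) \<oplus> (if Q then (complex_of_real e / 2) \<odot> x else \<zero>))
    \<oplus> ((if P then (1/2) \<odot> y else \<zero>) \<oplus> (if Q then (complex_of_real e / 2) \<odot> y else \<zero>))" for P Q
    using x y by (cases P; cases Q) (simp_all add: smult_add_right a_ac)
  then have "refl_proj \<sigma> e (x \<oplus> y) = refl_proj \<sigma> e x \<oplus>\<^bsub>Path\<^esub> refl_proj \<sigma> e y"
    unfolding refl_proj_def P.BM_sel by (simp only:)
  then show "\<Psi> (refl_proj \<sigma> e (x \<oplus> y)) = \<Psi> (refl_proj \<sigma> e x) \<oplus>\<^bsub>C\<^esub> \<Psi> (refl_proj \<sigma> e y)"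
    using cp_onD(2)[OF \<Psi> mem[OF x] mem[OF y]] by (simp only:)
next
  interpret P: cstar_blocks F path_block by (rule path_blocks)
  have mem: "refl_proj \<sigma> e x \<in> emb_set (carrier F)" if "x \<in> carrier F" for x
    using \<sigma> that refl_proj_emb[OF that, of e] unfolding emb_set_def
    by (metis (mono_tags, lifting) mem_Collect_eq smult_closed zero_closed)
  fix n X assume X: "\<And>i j. \<lbrakk>i < n; j < n\<rbrakk> \<Longrightarrow> X i j \<in> carrier F" "mat_pos F n X"
  have "mat_pos Path n (\<lambda>i j. refl_proj \<sigma> e (X i j))"
    using \<sigma> by (intro P.refl_proj_mat_pos X e) auto
  then show "mat_pos C n (\<lambda>i j. \<Psi> (refl_proj \<sigma> e (X i j)))"
    using X(1) mem by (intro cp_onD(4)[OF \<Psi>]) simp_all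
qed

lemma refl_proj_sum:
  assumes "x \<in> carrier F"
  shows "refl_proj path_u 1 x \<oplus>\<^bsub>Path\<^esub> refl_proj path_u (-1) x = emb x \<zero> \<zero>"
    and "refl_proj path_v 1 x \<oplus>\<^bsub>Path\<^esub> refl_proj path_v (-1) x = emb x \<zero> \<zero>"
proof -
  have "(1/2) \<odot> x \<oplus> (1/2) \<odot> x = x" using smult_add_left[OF assms, of "1/2" "1/2"] assms by simp
  moreover have "(complex_of_real 1 / 2) \<odot> x \<oplus> (complex_of_real (-1) / 2) \<odot> x = \<zero>"
    using smult_add_left[OF assms, of "1/2" "-1/2"] assms by simp
  ultimately show "refl_proj path_u 1 x \<oplus>\<^bsub>Path\<^esub> refl_proj path_u (-1) x = emb x \<zero> \<zero>"
    "refl_proj path_v 1 x \<oplus>\<^bsub>Path\<^esub> refl_proj path_v (-1) x = emb x \<zero> \<zero>"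
    using assms by (simp_all only: refl_proj_emb emb_add smult_closed zero_closed l_zero)
qed

end

subsection \<open>Transport of structure\<close>

definition transport :: "('d \<Rightarrow> 'e) \<Rightarrow> 'd cstar \<Rightarrow> 'e cstar" where
  "transport f D =
    \<lparr>carrier = f ` carrier D,
     mult = (\<lambda>x y. f (inv_into UNIV f x \<otimes>\<^bsub>D\<^esub> inv_into UNIV f y)),
     one = f \<one>\<^bsub>D\<^esub>,
     zero = f \<zero>\<^bsub>D\<^esub>,
     add = (\<lambda>x y. f (inv_into UNIV f x \<oplus>\<^bsub>D\<^esub> inv_into UNIV f y)),
     smult = (\<lambda>c x. f (c \<odot>\<^bsub>D\<^esub> inv_into UNIV f x)),
     star = (\<lambda>x. f (star D (inv_into UNIV f x))),
     nrm = (\<lambda>x. nrm D (inv_into UNIV f x))\<rparr>"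

locale cstar_transport = cstar_algebra D for D :: "'d cstar" (structure) +
  fixes f :: "'d \<Rightarrow> 'e"
  assumes inj: "inj f"
begin

abbreviation T :: "'e cstar" where "T \<equiv> transport f D"

lemma inv_f [simp]: "inv_into UNIV f (f x) = x"
  using inj by simp

lemma T_sel [simp]:
  "carrier T = f ` carrier D" "mult T x y = f (inv_into UNIV f x \<otimes> inv_into UNIV f y)" "one T = f \<one>" "zero T = f \<zero>"
  "add T x y = f (inv_into UNIV f x \<oplus> inv_into UNIV f y)" "smult T c x = f (c \<odot> inv_into UNIV f x)"
  "star T x = f (star D (inv_into UNIV f x))" "nrm T x = nrm D (inv_into UNIV f x)"
  by (simp_all add: transport_def)

lemma T_ring: "ring T"
proof (intro ringI abelian_groupI monoidI)
  fix x assume "x \<in> carrier T"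
  then obtain a where a: "x = f a" "a \<in> carrier D" by auto
  show "\<exists>y\<in>carrier T. y \<oplus>\<^bsub>T\<^esub> x = \<zero>\<^bsub>T\<^esub>"
    using a by (intro bexI[of _ "f (\<ominus> a)"]) (simp_all add: l_neg)
qed (auto simp: a_ac m_assoc l_distr r_distr)

lemma T_a_minus:
  assumes "a \<in> carrier D" "b \<in> carrier D" shows "f a \<ominus>\<^bsub>T\<^esub> f b = f (a \<ominus> b)"
proof -
  interpret T: ring T by (rule T_ring)
  have "\<ominus>\<^bsub>T\<^esub> f b = f (\<ominus> b)"
    using assms by (intro T.minus_equality) (simp_all add: l_neg)
  then show ?thesis by (simp add: a_minus_def)
qed

lemma T_cstar: "cstar_algebra T"
proof (intro cstar_algebra.intro T_ring cstar_algebra_axioms.intro)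
  fix X :: "nat \<Rightarrow> 'e"
  assume X: "\<And>n. X n \<in> carrier T" and C: "\<forall>e>0. \<exists>N. \<forall>m\<ge>N. \<forall>n\<ge>N. nrm T (X m \<ominus>\<^bsub>T\<^esub> X n) < e"
  define Y where "Y n = inv_into UNIV f (X n)" for n
  have Y: "Y n \<in> carrier D" "X n = f (Y n)" for n using X[of n] by (auto simp: Y_def)
  have "\<exists>l\<in>carrier D. (\<lambda>n. nrm D (Y n \<ominus> l)) \<longlonglongrightarrow> 0"
    using C Y by (intro complete) (simp_all add: T_a_minus)
  then show "\<exists>l\<in>carrier T. (\<lambda>n. nrm T (X n \<ominus>\<^bsub>T\<^esub> l)) \<longlonglongrightarrow> 0"
    using Y by (auto simp: T_a_minus)
qed (auto simp: smult_add_left smult_add_right smult_smult smult_mult_left smult_mult_right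
  star_add star_smult star_mult nrm_nonneg nrm_eq_0 nrm_smult nrm_add nrm_mult cstar_identity
  inj_eq[OF inj])

lemma T_finsum:
  assumes "finite S" "\<And>k. x k \<in> carrier D" shows "(\<Oplus>\<^bsub>T\<^esub>k\<in>S. f (x k)) = f (\<Oplus>k\<in>S. x k)"
  using assms(1)
proof (induction S)
  interpret T: cstar_algebra T by (rule T_cstar)
  case empty
  show ?case by (simp add: T.finsum_empty finsum_empty)
next
  interpret T: cstar_algebra T by (rule T_cstar)
  case (insert k S)
  then show ?case using assms T.sum_insert[of S k "\<lambda>k. f (x k)"] by (simp add: sum_insert)
qed

lemma T_mat_pos: "mat_pos T n (\<lambda>i j. f (X i j)) \<longleftrightarrow> mat_pos D n X"
proof
  assume "mat_pos D n X"
  then obtain Y0 where Y0: "\<forall>i<n. \<forall>j<n. Y0 i j \<in> carrier D"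
    and X0: "\<forall>i<n. \<forall>j<n. X i j = (\<Oplus>k\<in>{..<n}. star D (Y0 k i) \<otimes> Y0 k j)"
    unfolding mat_pos_def by blast
  define Y where "Y = restr D n Y0"
  have Y: "Y i j \<in> carrier D" for i j using Y0 by (simp add: Y_def restr_def)
  have "f (X i j) = (\<Oplus>\<^bsub>T\<^esub>k\<in>{..<n}. star T (f (Y k i)) \<otimes>\<^bsub>T\<^esub> f (Y k j))" if "i < n" "j < n" for i j
  proof -
    have "X i j = (\<Oplus>k\<in>{..<n}. star D (Y0 k i) \<otimes> Y0 k j)" using X0 that by blast
    also have "\<dots> = (\<Oplus>k\<in>{..<n}. star D (Y k i) \<otimes> Y k j)"
      using Y0 that by (intro sum_cong) (simp_all add: Y_def restr_def)
    finally show ?thesis using Y by (simp add: T_finsum)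
  qed
  then show "mat_pos T n (\<lambda>i j. f (X i j))"
    unfolding mat_pos_def using Y by (intro exI[of _ "\<lambda>i j. f (Y i j)"]) auto
next
  interpret T: cstar_algebra T by (rule T_cstar)
  assume "mat_pos T n (\<lambda>i j. f (X i j))"
  then obtain Y0 where Y0: "\<forall>i<n. \<forall>j<n. Y0 i j \<in> carrier T"
    and X0: "\<forall>i<n. \<forall>j<n. f (X i j) = (\<Oplus>\<^bsub>T\<^esub>k\<in>{..<n}. star T (Y0 k i) \<otimes>\<^bsub>T\<^esub> Y0 k j)"
    unfolding mat_pos_def by blast
  define Y where "Y = restr D n (\<lambda>i j. inv_into UNIV f (Y0 i j))"
  have inv: "inv_into UNIV f x \<in> carrier D \<and> f (inv_into UNIV f x) = x" if "x \<in> f ` carrier D" for x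
    using that by auto
  have Y: "Y i j \<in> carrier D" for i j using Y0 by (simp add: Y_def restr_def inv)
  have fY: "f (Y i j) = Y0 i j" if "i < n" "j < n" for i j
    using Y0 that by (simp add: Y_def restr_def inv)
  have "X i j = (\<Oplus>k\<in>{..<n}. star D (Y k i) \<otimes> Y k j)" if "i < n" "j < n" for i j
  proof -
    have "f (X i j) = (\<Oplus>\<^bsub>T\<^esub>k\<in>{..<n}. star T (Y0 k i) \<otimes>\<^bsub>T\<^esub> Y0 k j)" using X0 that by blast
    also have "\<dots> = (\<Oplus>\<^bsub>T\<^esub>k\<in>{..<n}. f (star D (Y k i) \<otimes> Y k j))"
      using Y that by (intro T.sum_cong) (simp_all add: fY[symmetric])
    also have "\<dots> = f (\<Oplus>k\<in>{..<n}. star D (Y k i) \<otimes> Y k j)" using Y by (simp add: T_finsum)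
    finally show ?thesis using inj by (simp add: inj_eq)
  qed
  then show "mat_pos D n X" unfolding mat_pos_def using Y by (intro exI[of _ Y]) auto
qed

lemma T_operator_system: "operator_system E D \<Longrightarrow> operator_system (f ` E) T"
  unfolding operator_system_def by auto

end

lemma injective_cstar_extend:
  fixes C :: "'c cstar" and D :: "'d cstar" and f :: "'d \<Rightarrow> ('i \<Rightarrow> complex) \<Rightarrow> ('i \<Rightarrow> complex)"
  assumes C: "injective_cstar TYPE('i) C" and D: "cstar_algebra D" and f: "inj f"
    and EG: "operator_system E D" "operator_system G D" "E \<subseteq> G" and \<phi>: "cp_on E D C \<phi>"
  shows "\<exists>\<psi>. cp_on G D C \<psi> \<and> (\<forall>x\<in>E. \<psi> x = \<phi> x)"
proof -
  interpret cstar_transport D f by (intro cstar_transport.intro D cstar_transport_axioms.intro f)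
  have "cp_on (f ` E) T C (\<lambda>x. \<phi> (inv_into UNIV f x))"
  proof (rule cp_onI)
    fix n X assume XE: "\<And>i j. \<lbrakk>i < n; j < n\<rbrakk> \<Longrightarrow> X i j \<in> f ` E" and X: "mat_pos T n X"
    have fX: "f (inv_into UNIV f (X i j)) = X i j" "inv_into UNIV f (X i j) \<in> E" if "i < n" "j < n" for i j
      using XE[OF that] by auto
    then have "mat_pos T n (\<lambda>i j. f (inv_into UNIV f (X i j)))"
      using X mat_pos_cong[of n X "\<lambda>i j. f (inv_into UNIV f (X i j))" T] by simp
    then have "mat_pos D n (\<lambda>i j. inv_into UNIV f (X i j))" by (simp only: T_mat_pos)
    then show "mat_pos C n (\<lambda>i j. \<phi> (inv_into UNIV f (X i j)))"
      using fX(2) by (intro cp_onD(4)[OF \<phi>])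
  qed (auto simp: cp_onD(1-3)[OF \<phi>])
  then obtain \<psi> where \<psi>: "cp_on (f ` G) T C \<psi>" and ext: "\<forall>x\<in>f ` E. \<psi> x = \<phi> (inv_into UNIV f x)"
    using C T_cstar T_operator_system[OF EG(1)] T_operator_system[OF EG(2)] image_mono[OF EG(3), of f]
    unfolding injective_cstar_def by blast
  have "cp_on G D C (\<lambda>x. \<psi> (f x))"
  proof (rule cp_onI)
    show "\<psi> (f (x \<oplus>\<^bsub>D\<^esub> y)) = \<psi> (f x) \<oplus>\<^bsub>C\<^esub> \<psi> (f y)" if "x \<in> G" "y \<in> G" for x y
      using cp_onD(2)[OF \<psi>, of "f x" "f y"] that by simp
    show "\<psi> (f (c \<odot>\<^bsub>D\<^esub> x)) = c \<odot>\<^bsub>C\<^esub> \<psi> (f x)" if "x \<in> G" for c x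
      using cp_onD(3)[OF \<psi>, of "f x" c] that by simp
    show "mat_pos C n (\<lambda>i j. \<psi> (f (X i j)))"
      if "\<And>i j. \<lbrakk>i < n; j < n\<rbrakk> \<Longrightarrow> X i j \<in> G" "mat_pos D n X" for n X
      using that by (intro cp_onD(4)[OF \<psi>]) (simp_all add: T_mat_pos)
  qed (use cp_onD(1)[OF \<psi>] in simp)
  then show ?thesis using ext by (intro exI[of _ "\<lambda>x. \<psi> (f x)"]) simp
qed

text \<open>An array is encoded by the lists that consist of copies of one entry, their length coding
  the position of the entry.\<close>

lemma inj_array_encoding:
  "\<exists>f :: (nat \<times> nat \<Rightarrow> nat \<times> nat \<Rightarrow> 'b) \<Rightarrow> (('b + 'c) list \<Rightarrow> complex) \<Rightarrow> (('b + 'c) list \<Rightarrow> complex). inj f"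
proof -
  define code where "code p q = prod_encode (prod_encode p, prod_encode q)" for p q
  define g :: "(nat \<times> nat \<Rightarrow> nat \<times> nat \<Rightarrow> 'b) \<Rightarrow> ('b + 'c) list \<Rightarrow> complex"
    where "g X l = (if \<exists>p q. l = replicate (Suc (code p q)) (Inl (X p q)) then 1 else 0)" for X l
  have "X = Y" if eq: "g X = g Y" for X Y
  proof (intro ext)
    fix p q
    let ?l = "replicate (Suc (code p q)) (Inl (X p q)) :: ('b + 'c) list"
    have "\<exists>p' q'. ?l = replicate (Suc (code p' q')) (Inl (X p' q'))" by blast
    then have "g X ?l = 1" unfolding g_def by (simp only: if_True)
    then have "g Y ?l = 1" using eq by simp
    then obtain p' q' where l: "?l = replicate (Suc (code p' q')) (Inl (Y p' q'))"
      unfolding g_def by (metis zero_neq_one)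
    then have "code p q = code p' q'" by (metis length_replicate nat.inject)
    then have "p = p'" "q = q'" by (simp_all add: code_def)
    then show "X p q = Y p q" using l by simp
  qed
  then have "inj (\<lambda>X (_ :: ('b + 'c) list \<Rightarrow> complex). g X)"
    by (intro injI) (metis)
  then show ?thesis by blast
qed

lemma cp_extend_sum:
  fixes A :: "'b set" and B :: "'b cstar" and C :: "'c cstar"
  assumes C: "injective_cstar TYPE(('b + 'c) list) C" and B: "cstar_algebra B" and A: "cstar_subalgebra A B"
    and cp: "completely_positive (B\<lparr>carrier := A\<rparr>) C \<phi>1" "completely_positive (B\<lparr>carrier := A\<rparr>) C \<phi>2"
      "completely_positive (B\<lparr>carrier := A\<rparr>) C \<phi>3" "completely_positive (B\<lparr>carrier := A\<rparr>) C \<phi>4"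
    and eq: "\<forall>a\<in>A. \<phi>1 a \<oplus>\<^bsub>C\<^esub> \<phi>2 a = \<phi>3 a \<oplus>\<^bsub>C\<^esub> \<phi>4 a"
  shows "\<exists>\<psi>1 \<psi>2 \<psi>3 \<psi>4.
      completely_positive B C \<psi>1 \<and> completely_positive B C \<psi>2
      \<and> completely_positive B C \<psi>3 \<and> completely_positive B C \<psi>4
      \<and> (\<forall>a\<in>A. \<psi>1 a = \<phi>1 a) \<and> (\<forall>a\<in>A. \<psi>2 a = \<phi>2 a)
      \<and> (\<forall>a\<in>A. \<psi>3 a = \<phi>3 a) \<and> (\<forall>a\<in>A. \<psi>4 a = \<phi>4 a)
      \<and> (\<forall>b\<in>carrier B. \<psi>1 b \<oplus>\<^bsub>C\<^esub> \<psi>2 b = \<psi>3 b \<oplus>\<^bsub>C\<^esub> \<psi>4 b)"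
proof -
  interpret B: cstar_algebra B by fact
  have Cc: "cstar_algebra C" using C unfolding injective_cstar_def by blast
  interpret C: cstar_algebra C by fact
  interpret P: cstar_blocks B path_block by (rule B.path_blocks)
  define S where "S = B\<lparr>carrier := A\<rparr>"
  note cp = cp[folded S_def]
  interpret S: cstar_algebra S unfolding S_def by (rule B.sub_cstar[OF A])
  have Sc: "carrier S = A" and Ss: "add S = add B" "smult S = smult B" "zero S = zero B" by (simp_all add: S_def)
  note on = cp[unfolded completely_positive_def Sc]
  have AB: "A \<subseteq> carrier B" using B.sub_carrier[OF A] by blast
  let ?\<Phi> = "C.path_functional \<phi>1 \<phi>2 \<phi>3 \<phi>4"
  have \<Phi>: "cp_on (B.emb_set A) B.Path C ?\<Phi>"
    using eq by (intro path_functional_cp[OF B A Cc S_def cp]) blast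
  obtain f :: "(nat \<times> nat \<Rightarrow> nat \<times> nat \<Rightarrow> 'b) \<Rightarrow> (('b + 'c) list \<Rightarrow> complex) \<Rightarrow> (('b + 'c) list \<Rightarrow> complex)"
    where f: "inj f" using inj_array_encoding by blast
  have sub: "B.emb_set A \<subseteq> B.emb_set (carrier B)" using AB unfolding B.emb_set_def by blast
  obtain \<Psi> where \<Psi>: "cp_on (B.emb_set (carrier B)) B.Path C \<Psi>" and ext: "\<forall>x\<in>B.emb_set A. \<Psi> x = ?\<Phi> x"
    using injective_cstar_extend[OF C P.BM_cstar f B.emb_set_operator_system[OF A]
        B.emb_set_operator_system[OF B.carrier_cstar_subalgebra] sub \<Phi>] by blast
  let ?\<psi> = "\<lambda>\<sigma> e x. \<Psi> (B.refl_proj \<sigma> e x)"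
  have mem: "B.refl_proj path_u e x \<in> B.emb_set U" "B.refl_proj path_v e x \<in> B.emb_set U"
    if "cstar_subalgebra U B" "x \<in> U" for U x e
    using B.refl_proj_emb[OF B.sub_carrier[OF that], of e] B.sub_closed(1,6)[OF that(1)] that(2)
    unfolding B.emb_set_def by (metis (mono_tags, lifting) mem_Collect_eq)+
  have sum: "?\<psi> path_u 1 b \<oplus>\<^bsub>C\<^esub> ?\<psi> path_u (-1) b = ?\<psi> path_v 1 b \<oplus>\<^bsub>C\<^esub> ?\<psi> path_v (-1) b"
    if b: "b \<in> carrier B" for b
    using cp_onD(2)[OF \<Psi> mem(1)[OF B.carrier_cstar_subalgebra b] mem(1)[OF B.carrier_cstar_subalgebra b], of 1 "-1"]
      cp_onD(2)[OF \<Psi> mem(2)[OF B.carrier_cstar_subalgebra b] mem(2)[OF B.carrier_cstar_subalgebra b], of 1 "-1"]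
      B.refl_proj_sum[OF b] by (simp only:)
  have val: "?\<psi> path_u 1 a = \<phi>1 a \<and> ?\<psi> path_u (-1) a = \<phi>2 a \<and> ?\<psi> path_v 1 a = \<phi>3 a \<and> ?\<psi> path_v (-1) a = \<phi>4 a"
    if a: "a \<in> A" for a
  proof -
    have aB: "a \<in> carrier B" using a AB by blast
    define h where "h = (1/2) \<odot>\<^bsub>B\<^esub> a"
    have h: "h \<in> A" using B.sub_closed(1)[OF A a] by (simp add: h_def)
    have hB: "h \<in> carrier B" using h AB by blast
    have z: "\<zero>\<^bsub>B\<^esub> \<in> A" by (rule B.sub_closed(6)[OF A])
    have mh: "(complex_of_real (-1) / 2) \<odot>\<^bsub>B\<^esub> a = (-1) \<odot>\<^bsub>B\<^esub> h"
      using aB by (simp add: h_def flip: B.smult_smult)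
    have ph: "(complex_of_real 1 / 2) \<odot>\<^bsub>B\<^esub> a = h" by (simp add: h_def)
    have mA: "(-1) \<odot>\<^bsub>B\<^esub> h \<in> A" by (rule B.sub_closed(1)[OF A h])
    have em: "B.refl_proj path_u 1 a = B.emb h h \<zero>\<^bsub>B\<^esub>" "B.refl_proj path_u (-1) a = B.emb h ((-1) \<odot>\<^bsub>B\<^esub> h) \<zero>\<^bsub>B\<^esub>"
      "B.refl_proj path_v 1 a = B.emb h \<zero>\<^bsub>B\<^esub> h" "B.refl_proj path_v (-1) a = B.emb h \<zero>\<^bsub>B\<^esub> ((-1) \<odot>\<^bsub>B\<^esub> h)"
      unfolding B.refl_proj_emb[OF aB] mh ph h_def[symmetric] by simp_all
    have \<Phi>e: "\<Psi> (B.emb x y w) = \<phi>1 x \<oplus>\<^bsub>C\<^esub> \<phi>2 x \<oplus>\<^bsub>C\<^esub> (\<phi>1 y \<ominus>\<^bsub>C\<^esub> \<phi>2 y) \<oplus>\<^bsub>C\<^esub> (\<phi>3 w \<ominus>\<^bsub>C\<^esub> \<phi>4 w)"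
      if "x \<in> A" "y \<in> A" "w \<in> A" for x y w
    proof -
      have "\<Psi> (B.emb x y w) = ?\<Phi> (B.emb x y w)" using ext that unfolding B.emb_set_def by blast
      then show ?thesis
        unfolding C.path_functional_def using B.emb_coords(1-3)[of x y w] that AB by (simp only: subset_iff)
    qed
    have half: "\<phi> h \<oplus>\<^bsub>C\<^esub> \<phi> h = \<phi> a" "\<phi> ((-1) \<odot>\<^bsub>B\<^esub> h) = \<ominus>\<^bsub>C\<^esub> \<phi> h" "\<phi> \<zero>\<^bsub>B\<^esub> = \<zero>\<^bsub>C\<^esub>" "\<phi> h \<in> carrier C"
      if "completely_positive S C \<phi>" for \<phi>
    proof -
      note p = that[unfolded completely_positive_def Sc]
      show hc: "\<phi> h \<in> carrier C" by (rule cp_onD(1)[OF p h])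
      have "h \<oplus>\<^bsub>B\<^esub> h = a" using B.smult_add_left[OF aB, of "1/2" "1/2"] aB by (simp add: h_def)
      then show "\<phi> h \<oplus>\<^bsub>C\<^esub> \<phi> h = \<phi> a" using cp_onD(2)[OF p h h] by (simp add: Ss)
      show "\<phi> ((-1) \<odot>\<^bsub>B\<^esub> h) = \<ominus>\<^bsub>C\<^esub> \<phi> h"
        using cp_onD(3)[OF p h, of "-1"] hc by (simp add: Ss C.smult_minus_one)
      show "\<phi> \<zero>\<^bsub>B\<^esub> = \<zero>\<^bsub>C\<^esub>" using cp_zero[OF S.cstar_algebra_axioms Cc that] by (simp add: Ss)
    qed
    note hf = half[OF cp(1)] half[OF cp(2)] half[OF cp(3)] half[OF cp(4)]
    have e: "\<phi>1 h \<oplus>\<^bsub>C\<^esub> \<phi>2 h = \<phi>3 h \<oplus>\<^bsub>C\<^esub> \<phi>4 h" using eq h by blast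
    have 1: "x \<oplus>\<^bsub>C\<^esub> y \<oplus>\<^bsub>C\<^esub> (x \<ominus>\<^bsub>C\<^esub> y) = x \<oplus>\<^bsub>C\<^esub> x" "x \<oplus>\<^bsub>C\<^esub> y \<oplus>\<^bsub>C\<^esub> (\<ominus>\<^bsub>C\<^esub> x \<ominus>\<^bsub>C\<^esub> (\<ominus>\<^bsub>C\<^esub> y)) = y \<oplus>\<^bsub>C\<^esub> y"
      if "x \<in> carrier C" "y \<in> carrier C" for x y using that by algebra+
    have 2: "\<zero>\<^bsub>C\<^esub> \<ominus>\<^bsub>C\<^esub> \<zero>\<^bsub>C\<^esub> = \<zero>\<^bsub>C\<^esub>" by (simp add: C.minus_eq)
    have 3: "\<Psi> (B.emb h h \<zero>\<^bsub>B\<^esub>) = \<phi>1 a" "\<Psi> (B.emb h ((-1) \<odot>\<^bsub>B\<^esub> h) \<zero>\<^bsub>B\<^esub>) = \<phi>2 a"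
      using 1[OF hf(4) hf(8)] hf(4,8) h z mA on(1,2)[THEN cp_onD(1), OF a]
      by (simp_all only: \<Phi>e hf 2 C.r_zero C.a_closed C.minus_closed C.a_inv_closed)
    have 4: "\<Psi> (B.emb h \<zero>\<^bsub>B\<^esub> h) = \<phi>3 a" "\<Psi> (B.emb h \<zero>\<^bsub>B\<^esub> ((-1) \<odot>\<^bsub>B\<^esub> h)) = \<phi>4 a"
      using 1[OF hf(12) hf(16)] hf(12,16) h z mA on(3,4)[THEN cp_onD(1), OF a]
      by (simp_all only: \<Phi>e hf e 2 C.r_zero C.a_closed C.minus_closed C.a_inv_closed)
    show ?thesis unfolding em using 3 4 by blast
  qed
  have cps: "completely_positive B C (?\<psi> \<sigma> e)" if "\<sigma> = path_u \<or> \<sigma> = path_v" "e * e = 1" for \<sigma> e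
    by (rule B.cp_refl_proj[OF \<Psi> that])
  show ?thesis
    by (rule exI[of _ "?\<psi> path_u 1"], rule exI[of _ "?\<psi> path_u (-1)"],
        rule exI[of _ "?\<psi> path_v 1"], rule exI[of _ "?\<psi> path_v (-1)"])
       (intro conjI cps ballI sum; simp add: val)
qed

lemma cp_extend_majorant:
  fixes A :: "'b set" and B :: "'b cstar" and C :: "'c cstar"
  assumes C: "injective_cstar TYPE(('b + 'c) list) C" and B: "cstar_algebra B" and A: "cstar_subalgebra A B"
    and cp: "completely_positive (B\<lparr>carrier := A\<rparr>) C \<phi>1" "completely_positive (B\<lparr>carrier := A\<rparr>) C \<phi>2"
      "completely_positive (B\<lparr>carrier := A\<rparr>) C \<phi>"
    and le: "cp_le (B\<lparr>carrier := A\<rparr>) C \<phi>1 \<phi>" "cp_le (B\<lparr>carrier := A\<rparr>) C \<phi>2 \<phi>"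
  shows "\<exists>\<psi>1 \<psi>2 \<psi>.
      completely_positive B C \<psi>1 \<and> completely_positive B C \<psi>2 \<and> completely_positive B C \<psi>
      \<and> (\<forall>a\<in>A. \<psi>1 a = \<phi>1 a) \<and> (\<forall>a\<in>A. \<psi>2 a = \<phi>2 a) \<and> (\<forall>a\<in>A. \<psi> a = \<phi> a)
      \<and> cp_le B C \<psi>1 \<psi> \<and> cp_le B C \<psi>2 \<psi>"
proof -
  interpret B: cstar_algebra B by fact
  have Cc: "cstar_algebra C" using C unfolding injective_cstar_def by blast
  interpret C: cstar_algebra C by fact
  have cl: "\<phi>1 a \<in> carrier C" "\<phi>2 a \<in> carrier C" "\<phi> a \<in> carrier C" if "a \<in> A" for a
    using cp that unfolding completely_positive_def cp_on_def by simp_all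
  have ab: "x \<oplus>\<^bsub>C\<^esub> (y \<ominus>\<^bsub>C\<^esub> x) = y" "y \<oplus>\<^bsub>C\<^esub> x \<ominus>\<^bsub>C\<^esub> y = x" if "x \<in> carrier C" "y \<in> carrier C" for x y
    using that by algebra+
  have "\<forall>a\<in>A. \<phi>1 a \<oplus>\<^bsub>C\<^esub> (\<phi> a \<ominus>\<^bsub>C\<^esub> \<phi>1 a) = \<phi>2 a \<oplus>\<^bsub>C\<^esub> (\<phi> a \<ominus>\<^bsub>C\<^esub> \<phi>2 a)"
    using ab(1) cl by simp
  then obtain \<psi>1 \<psi>1' \<psi>2 \<psi>2' where \<psi>: "completely_positive B C \<psi>1" "completely_positive B C \<psi>1'"
      "completely_positive B C \<psi>2" "completely_positive B C \<psi>2'"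
    and ext: "\<forall>a\<in>A. \<psi>1 a = \<phi>1 a" "\<forall>a\<in>A. \<psi>1' a = \<phi> a \<ominus>\<^bsub>C\<^esub> \<phi>1 a" "\<forall>a\<in>A. \<psi>2 a = \<phi>2 a"
    and sum: "\<forall>b\<in>carrier B. \<psi>1 b \<oplus>\<^bsub>C\<^esub> \<psi>1' b = \<psi>2 b \<oplus>\<^bsub>C\<^esub> \<psi>2' b"
    using cp_extend_sum[OF C B A cp(1) le(1)[unfolded cp_le_def] cp(2) le(2)[unfolded cp_le_def]] by blast
  note on = \<psi>[unfolded completely_positive_def]
  note c = on[THEN cp_onD(1)]
  define \<psi> where "\<psi> b = \<psi>1 b \<oplus>\<^bsub>C\<^esub> \<psi>1' b" for b
  have "completely_positive B C \<psi>"
    unfolding completely_positive_def \<psi>_def using B.carrier_operator_system on(1,2) by (rule C.cp_on_add)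
  moreover have "\<forall>a\<in>A. \<psi> a = \<phi> a" using ext ab(1) cl by (simp add: \<psi>_def)
  moreover have "cp_le B C \<psi>1 \<psi>"
    unfolding cp_le_def completely_positive_def
    using on(2) B.carrier_operator_system by (rule cp_on_cong) (simp add: \<psi>_def ab(2) c)
  moreover have "cp_le B C \<psi>2 \<psi>"
    unfolding cp_le_def completely_positive_def
    using on(4) B.carrier_operator_system by (rule cp_on_cong) (simp add: \<psi>_def sum ab(2) c)
  ultimately show ?thesis using \<psi>(1,3) ext(1,3) by blast
qed

theorem theorem0p1:
  fixes A :: "'b set" and B :: "'b cstar" and C :: "'c cstar"
  assumes "injective_cstar TYPE(('b + 'c) list) C"
    and "cstar_algebra B"
    and "cstar_subalgebra A B"
  shows
    "(\<forall>\<phi>1 \<phi>2 \<phi>.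
        completely_positive (B\<lparr>carrier := A\<rparr>) C \<phi>1
        \<and> completely_positive (B\<lparr>carrier := A\<rparr>) C \<phi>2
        \<and> completely_positive (B\<lparr>carrier := A\<rparr>) C \<phi>
        \<and> cp_le (B\<lparr>carrier := A\<rparr>) C \<phi>1 \<phi> \<and> cp_le (B\<lparr>carrier := A\<rparr>) C \<phi>2 \<phi>
        \<longrightarrow> (\<exists>\<psi>1 \<psi>2 \<psi>.
              completely_positive B C \<psi>1 \<and> completely_positive B C \<psi>2
              \<and> completely_positive B C \<psi>
              \<and> (\<forall>a\<in>A. \<psi>1 a = \<phi>1 a) \<and> (\<forall>a\<in>A. \<psi>2 a = \<phi>2 a) \<and> (\<forall>a\<in>A. \<psi> a = \<phi> a)
              \<and> cp_le B C \<psi>1 \<psi> \<and> cp_le B C \<psi>2 \<psi>))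
     \<and> (\<forall>\<phi>1 \<phi>2 \<phi>3 \<phi>4.
        completely_positive (B\<lparr>carrier := A\<rparr>) C \<phi>1
        \<and> completely_positive (B\<lparr>carrier := A\<rparr>) C \<phi>2
        \<and> completely_positive (B\<lparr>carrier := A\<rparr>) C \<phi>3
        \<and> completely_positive (B\<lparr>carrier := A\<rparr>) C \<phi>4
        \<and> (\<forall>a\<in>A. \<phi>1 a \<oplus>\<^bsub>C\<^esub> \<phi>2 a = \<phi>3 a \<oplus>\<^bsub>C\<^esub> \<phi>4 a)
        \<longrightarrow> (\<exists>\<psi>1 \<psi>2 \<psi>3 \<psi>4.
              completely_positive B C \<psi>1 \<and> completely_positive B C \<psi>2
              \<and> completely_positive B C \<psi>3 \<and> completely_positive B C \<psi>4
              \<and> (\<forall>a\<in>A. \<psi>1 a = \<phi>1 a) \<and> (\<forall>a\<in>A. \<psi>2 a = \<phi>2 a)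
              \<and> (\<forall>a\<in>A. \<psi>3 a = \<phi>3 a) \<and> (\<forall>a\<in>A. \<psi>4 a = \<phi>4 a)
              \<and> (\<forall>b\<in>carrier B. \<psi>1 b \<oplus>\<^bsub>C\<^esub> \<psi>2 b = \<psi>3 b \<oplus>\<^bsub>C\<^esub> \<psi>4 b)))"
  by (intro conjI allI impI; elim conjE)
     (rule cp_extend_majorant[OF assms] cp_extend_sum[OF assms]; assumption)+

end
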